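(* Let $(A,\mu)$ be a Lie algebroid. Let $N$ be a vector bundle endomorphism of $A$, and let $\omega$ be a $2$-form on $A$ such that $\omega N={}^tN\omega$. If $(\omega,N)$ is an $\Omega$N-structure on $A$, then the skew-symmetric endomorphism of $A\oplus A^*$, $\mathcal N=\begin{pmatrix}N&0\\\omega&-{}^tN\end{pmatrix}$, is a weak deforming tensor for $(A\oplus A^*,\mu)$.
   Context: Let $A$ be a (smooth, real, finite rank) vector bundle over a manifold $M$, and equip $E=A\oplus A^*$ with the canonical symmetric bilinear form $\langle X+\xi,Y+\eta\rangle=\xi(Y)+\eta(X)$. $\mathcal A=\bigoplus_k\mathcal A^k$ is the graded algebra of functions on the graded manifold $T^*[2]A[1]$, with its canonical Poisson bracket $\{\cdot,\cdot\}$ of degree $-2$ (the big bracket), with $\{a,b\}=-(-1)^{|a||b|}\{b,a\}$ and the graded Leibniz and Jacobi identities. For a local basis $(e_\alpha)$ of $\Gamma A$ with dual basis $(\epsilon^\alpha)$, local coordinates are $(x^i,\tau^\alpha,p_i,\theta_\alpha)$ of degrees $0,1,2,1$, with non-vanishing brackets $\{x^i,p_j\}=\delta^i_j$, $\{\tau^\alpha,\theta_\beta\}=\delta^\alpha_\beta$. $\mathcal A^0=C^\infty(M)$; $\mathcal A^1=\Gamma(A\oplus A^* )$, with $X=X^\alpha e_\alpha$ identified with $X^\alpha\theta_\alpha$ and $\xi=\xi_\alpha\epsilon^\alpha$ with $\xi_\alpha\tau^\alpha$; $\{u,v\}=\langle u,v\rangle$ for sections of $E$. A Lie algebroid structure on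 $A$ is given by $\mu\in\mathcal A^3$, locally a combination with coefficients in $C^\infty(M)$ of terms $\tau^\alpha p_i$ and $\tau^\alpha\tau^\beta\theta_\gamma$, with $\{\mu,\mu\}=0$: anchor $\rho(X)f=\{\{X,\mu\},f\}$, bracket $[X,Y]^\mu=\{\{X,\mu\},Y\}$. Then $\Theta=\mu$ is a Courant algebroid structure on $A\oplus A^*$ (the double of the trivial Lie bialgebroid $((A,\mu),(A^*,0))$), with Dorfman bracket $\{\{u,\mu\},v\}$. For a skew-symmetric endomorphism $\mathcal N$ of $E$ ($\langle\mathcal Nu,v\rangle+\langle u,\mathcal Nv\rangle=0$), $\widetilde{\mathcal N}\in\mathcal A^2$ is the unique element with $\mathcal N(u)=\{u,\widetilde{\mathcal N}\}$ for all $u\in\Gamma E$. $\mathcal N$ is a weak deforming tensor for $(E,\Theta)$ if $\{\Theta,\{\{\widetilde{\mathcal N},\Theta\},\widetilde{\mathcal N}\}\}=0$. A $2$-form $\omega$ on $A$ is viewed as a skew-symmetric bundle map $\omega:A\to A^*$. Endomorphisms $N$ of $A$ and $2$-forms $\omega$ are identified with the elements $\widetilde{\mathcal N}$ of $\mathcal A^2$ attached to $\begin{pmatrix}N&0\\0&-{}^tN\end{pmatrix}$ and $\begin{pmatrix}0&0\\\omega&0\end{pmatrix}$. The Lie algebroid differential is $\mathrm d_\mu=\{\mu,\cdot\}$ on forms on $A$; $\mu_N=\{N,\mu\}$ and $\mathrm d_{\mu_N}=\{\{N,\mu\},\cdot\}$. $(\omega,N)$ is an $\Omega$N-structure (presymplectic–Nijenhuis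 structure) on $(A,\mu)$ if: $\mathrm d_\mu\omega=0$; $N$ is a Nijenhuis tensor, i.e. $[NX,NY]^\mu-N([NX,Y]^\mu+[X,NY]^\mu-N[X,Y]^\mu)=0$ for all sections $X,Y$; $\omega N={}^tN\omega$; and the $2$-form $\omega N$ is closed, $\mathrm d_\mu(\omega N)=0$ (equivalently, given $\mathrm d_\mu\omega=0$, $\mathrm d_{\mu_N}\omega=0$). *)

theory Defs
  imports
    "HOL-Analysis.Analysis"
    "HOL-Library.Function_Algebras"
    "HOL-Library.Poly_Mapping"
    "HOL-Library.FSet"
begin

section \<open>Graded polynomials in the fibre coordinates of $T^*[2]A[1]$\<close>

text \<open>
  At a point of the base, a function on $T^*[2]A[1]$ written in local coordinates is an element of
  $\mathbb{R}[p_0, p_1, \dots] \otimes \Lambda(\tau^0, \theta_0, \tau^1, \theta_1, \dots)$.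
  The odd coordinates are numbered in one sequence: $\tau^\alpha$ has number \<open>2 * \<alpha>\<close> and
  $\theta_\alpha$ has number \<open>2 * \<alpha> + 1\<close>.  The monomial \<open>(P, S)\<close> stands for
  $\prod_{i \in P} p_i \cdot \zeta_{s_1} \cdots \zeta_{s_k}$, where $s_1 < \dots < s_k$ are the
  elements of \<open>S\<close> and $\zeta_s$ is the odd coordinate with number $s$.
\<close>

type_synonym mono = "nat multiset \<times> nat fset"

text \<open>Sign of the permutation sorting the concatenation of two increasing words.\<close>

definition shuffle_sign :: "nat fset \<Rightarrow> nat fset \<Rightarrow> real" where
  "shuffle_sign S T =
     (if S |\<inter>| T = {||} then (- 1) ^ card {(a, b). a |\<in>| S \<and> b |\<in>| T \<and> b < a} else 0)"

definition mono_mult :: "mono \<Rightarrow> mono \<Rightarrow> mono" where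
  "mono_mult a b = (fst a + fst b, snd a |\<union>| snd b)"

typedef gpoly = "UNIV :: (mono \<Rightarrow>\<^sub>0 real) set" morphisms rep_gpoly Gpoly ..

setup_lifting type_definition_gpoly

definition coeff :: "gpoly \<Rightarrow> mono \<Rightarrow> real" where
  "coeff F = Poly_Mapping.lookup (rep_gpoly F)"

definition supp :: "gpoly \<Rightarrow> mono set" where
  "supp F = {a. coeff F a \<noteq> 0}"

lift_definition gmono :: "mono \<Rightarrow> real \<Rightarrow> gpoly" is Poly_Mapping.single .

lemma finite_supp [simp]: "finite (supp F)"
  by (simp add: supp_def coeff_def)

lemma coeff_gmono: "coeff (gmono a x) b = (if a = b then x else 0)"
  by (simp add: coeff_def gmono.rep_eq lookup_single when_def)

lemma gpoly_eq_iff: "F = G \<longleftrightarrow> (\<forall>a. coeff F a = coeff G a)"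
  by (metis coeff_def poly_mapping_eqI rep_gpoly_inject)

instantiation gpoly :: ab_group_add
begin
lift_definition zero_gpoly :: gpoly is 0 .
lift_definition plus_gpoly :: "gpoly \<Rightarrow> gpoly \<Rightarrow> gpoly" is "(+)" .
lift_definition minus_gpoly :: "gpoly \<Rightarrow> gpoly \<Rightarrow> gpoly" is "(-)" .
lift_definition uminus_gpoly :: "gpoly \<Rightarrow> gpoly" is "uminus" .
instance by standard (transfer; simp)+
end

lemma coeff_zero [simp]: "coeff 0 a = 0"
  by (simp add: coeff_def zero_gpoly.rep_eq)
lemma coeff_add [simp]: "coeff (F + G) a = coeff F a + coeff G a"
  by (simp add: coeff_def plus_gpoly.rep_eq lookup_add)
lemma coeff_diff [simp]: "coeff (F - G) a = coeff F a - coeff G a"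
  by (simp add: coeff_def minus_gpoly.rep_eq lookup_minus)
lemma coeff_uminus [simp]: "coeff (- F) a = - coeff F a"
  by (simp add: coeff_def uminus_gpoly.rep_eq)
lemma coeff_sum [simp]: "coeff (sum f A) a = (\<Sum>i\<in>A. coeff (f i) a)"
  by (induction A rule: infinite_finite_induct) auto

instantiation gpoly :: scaleR
begin
lift_definition scaleR_gpoly :: "real \<Rightarrow> gpoly \<Rightarrow> gpoly" is "\<lambda>r. Poly_Mapping.map ((*) r)" .
instance ..
end

lemma coeff_scaleR [simp]: "coeff (r *\<^sub>R F) a = r * coeff F a"
  by (simp add: coeff_def scaleR_gpoly.rep_eq Poly_Mapping.map.rep_eq when_def)

instance gpoly :: real_vector
  by standard (simp_all add: gpoly_eq_iff distrib_left distrib_right)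

lemma gpoly_expand: "finite A \<Longrightarrow> supp F \<subseteq> A \<Longrightarrow> F = (\<Sum>a\<in>A. gmono a (coeff F a))"
  by (auto simp: gpoly_eq_iff coeff_gmono supp_def)

lemma gmono_0 [simp]: "gmono a 0 = 0"
  by (simp add: gpoly_eq_iff coeff_gmono)
lemma gmono_add: "gmono a (x + y) = gmono a x + gmono a y"
  by (simp add: gpoly_eq_iff coeff_gmono)
lemma gmono_sum: "gmono a (sum f A) = (\<Sum>i\<in>A. gmono a (f i))"
  by (simp add: gpoly_eq_iff coeff_gmono)
lemma scaleR_gmono: "r *\<^sub>R gmono a x = gmono a (r * x)"
  by (simp add: gpoly_eq_iff coeff_gmono)

instantiation gpoly :: "{times, one}"
begin
definition times_gpoly :: "gpoly \<Rightarrow> gpoly \<Rightarrow> gpoly" where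
  "F * G = (\<Sum>a\<in>supp F. \<Sum>b\<in>supp G.
      gmono (mono_mult a b) (shuffle_sign (snd a) (snd b) * coeff F a * coeff G b))"
definition one_gpoly :: gpoly where "1 = gmono ({#}, {||}) 1"
instance ..
end

lemma times_gpoly_superset:
  assumes "finite A" "supp F \<subseteq> A" "finite B" "supp G \<subseteq> B"
  shows "F * G = (\<Sum>a\<in>A. \<Sum>b\<in>B.
      gmono (mono_mult a b) (shuffle_sign (snd a) (snd b) * coeff F a * coeff G b))"
proof -
  have "F * G = (\<Sum>a\<in>supp F. \<Sum>b\<in>B.
      gmono (mono_mult a b) (shuffle_sign (snd a) (snd b) * coeff F a * coeff G b))"
    unfolding times_gpoly_def using assms
    by (intro sum.cong sum.mono_neutral_left refl) (auto simp: supp_def)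
  also have "\<dots> = (\<Sum>a\<in>A. \<Sum>b\<in>B.
      gmono (mono_mult a b) (shuffle_sign (snd a) (snd b) * coeff F a * coeff G b))"
    using assms by (intro sum.mono_neutral_left) (auto simp: supp_def)
  finally show ?thesis .
qed

lemma gmono_times_gmono:
  "gmono a x * gmono b y = gmono (mono_mult a b) (shuffle_sign (snd a) (snd b) * x * y)"
  by (subst times_gpoly_superset[where A = "{a}" and B = "{b}"])
     (auto simp: supp_def coeff_gmono split: if_splits)

lemma gpoly_distrib_right: "(F + G) * H = F * H + G * (H :: gpoly)"
proof -
  let ?A = "supp F \<union> supp G \<union> supp (F + G)"
  have expand: "K * H = (\<Sum>a\<in>?A. \<Sum>b\<in>supp H. gmono (mono_mult a b)
      (shuffle_sign (snd a) (snd b) * coeff K a * coeff H b))" if "supp K \<subseteq> ?A" for K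
    using that by (intro times_gpoly_superset) auto
  have "(F + G) * H = (\<Sum>a\<in>?A. \<Sum>b\<in>supp H.
      gmono (mono_mult a b) (shuffle_sign (snd a) (snd b) * coeff F a * coeff H b) +
      gmono (mono_mult a b) (shuffle_sign (snd a) (snd b) * coeff G a * coeff H b))"
    by (subst expand, blast, intro sum.cong refl,
        simp only: coeff_add gmono_add[symmetric] distrib_left distrib_right)
  also have "\<dots> = F * H + G * H"
    by (subst (1 2) expand) (blast, blast, simp only: sum.distrib)
  finally show ?thesis .
qed

lemma gpoly_distrib_left: "H * (F + G) = H * F + H * (G :: gpoly)"
proof -
  let ?A = "supp F \<union> supp G \<union> supp (F + G)"
  have expand: "H * K = (\<Sum>a\<in>supp H. \<Sum>b\<in>?A. gmono (mono_mult a b)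
      (shuffle_sign (snd a) (snd b) * coeff H a * coeff K b))" if "supp K \<subseteq> ?A" for K
    using that by (intro times_gpoly_superset) auto
  have "H * (F + G) = (\<Sum>a\<in>supp H. \<Sum>b\<in>?A.
      gmono (mono_mult a b) (shuffle_sign (snd a) (snd b) * coeff H a * coeff F b) +
      gmono (mono_mult a b) (shuffle_sign (snd a) (snd b) * coeff H a * coeff G b))"
    by (subst expand, blast, intro sum.cong refl,
        simp only: coeff_add gmono_add[symmetric] distrib_left distrib_right)
  also have "\<dots> = H * F + H * G"
    by (subst (1 2) expand) (blast, blast, simp only: sum.distrib)
  finally show ?thesis .
qed

lemma gpoly_mult_zero: "0 * F = (0 :: gpoly)" "F * 0 = (0 :: gpoly)"
  by (simp_all add: times_gpoly_def supp_def)

lemma gpoly_mult_sum: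
  "sum f A * (F :: gpoly) = (\<Sum>i\<in>A. f i * F)" "F * sum f A = (\<Sum>i\<in>A. F * f i)"
  by (induction A rule: infinite_finite_induct;
      simp add: gpoly_mult_zero gpoly_distrib_left gpoly_distrib_right)+

lemma shuffle_sign_assoc:
  "shuffle_sign S T * shuffle_sign (S |\<union>| T) U = shuffle_sign T U * shuffle_sign S (T |\<union>| U)"
proof (cases "S |\<inter>| T = {||} \<and> S |\<inter>| U = {||} \<and> T |\<inter>| U = {||}")
  case True
  let ?inv = "\<lambda>S T. {(a, b). a |\<in>| S \<and> b |\<in>| T \<and> b < (a::nat)}"
  have fin: "finite (?inv S T)" for S T
    by (rule finite_subset[of _ "fset S \<times> fset T"]) auto
  have "?inv (S |\<union>| T) U = ?inv S U \<union> ?inv T U" "?inv S (T |\<union>| U) = ?inv S T \<union> ?inv S U"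
    by auto
  moreover have "?inv S U \<inter> ?inv T U = {}" "?inv S T \<inter> ?inv S U = {}"
    using True by auto
  ultimately have "card (?inv (S |\<union>| T) U) = card (?inv S U) + card (?inv T U)"
    "card (?inv S (T |\<union>| U)) = card (?inv S T) + card (?inv S U)"
    by (simp_all only: card_Un_disjoint[OF fin fin])
  moreover have "(S |\<union>| T) |\<inter>| U = {||}" "S |\<inter>| (T |\<union>| U) = {||}"
    using True by (simp_all add: inf_sup_distrib1 inf_sup_distrib2)
  ultimately show ?thesis
    using True by (simp add: shuffle_sign_def power_add)
next
  case False
  then show ?thesis
    by (auto simp: shuffle_sign_def inf_sup_distrib1 inf_sup_distrib2)
qed

instance gpoly :: ring_1
proof
  fix F G H :: gpoly
  have base: "gmono a x * gmono b y * gmono c z = gmono a x * (gmono b y * gmono c z)"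
    for a b c x y z
  proof -
    have "shuffle_sign (snd a |\<union>| snd b) (snd c) * shuffle_sign (snd a) (snd b)
        = shuffle_sign (snd a) (snd b |\<union>| snd c) * shuffle_sign (snd b) (snd c)"
      using shuffle_sign_assoc[of "snd a" "snd b" "snd c"] by (simp add: mult.commute)
    then show ?thesis
      by (simp add: gmono_times_gmono mono_mult_def ac_simps)
  qed
  show "F * G * H = F * (G * H)"
    by (subst (1 2) gpoly_expand[OF finite_supp order_refl, of F],
        subst (1 2) gpoly_expand[OF finite_supp order_refl, of G],
        subst (1 2) gpoly_expand[OF finite_supp order_refl, of H])
       (simp only: gpoly_mult_sum base)
  show "1 * F = F" "F * 1 = F"
    unfolding one_gpoly_def
    by (subst gpoly_expand[OF finite_supp order_refl, of F],
        simp only: gpoly_mult_sum gmono_times_gmono,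
        subst (3) gpoly_expand[OF finite_supp order_refl, of F],
        simp add: mono_mult_def shuffle_sign_def)+
  show "(F + G) * H = F * H + G * H" "F * (G + H) = F * G + F * H"
    by (rule gpoly_distrib_right gpoly_distrib_left)+
  have "coeff (1 :: gpoly) ({#}, {||}) \<noteq> coeff 0 ({#}, {||})"
    by (simp add: one_gpoly_def coeff_gmono)
  then show "(0 :: gpoly) \<noteq> 1" by metis
qed

instance gpoly :: real_algebra_1
proof
  fix F G :: gpoly and r :: real
  have sub: "supp (r *\<^sub>R K) \<subseteq> supp K" for K
    by (auto simp: supp_def)
  have "(r *\<^sub>R F) * G = (\<Sum>a\<in>supp F. \<Sum>b\<in>supp G.
      gmono (mono_mult a b) (shuffle_sign (snd a) (snd b) * coeff (r *\<^sub>R F) a * coeff G b))"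
    using sub by (intro times_gpoly_superset) auto
  also have "\<dots> = r *\<^sub>R (F * G)"
    unfolding times_gpoly_def scaleR_sum_right scaleR_gmono coeff_scaleR
    by (intro sum.cong refl arg_cong[where f = "gmono _"]) (simp add: mult_ac)
  finally show "(r *\<^sub>R F) * G = r *\<^sub>R (F * G)" .
  have "F * (r *\<^sub>R G) = (\<Sum>a\<in>supp F. \<Sum>b\<in>supp G.
      gmono (mono_mult a b) (shuffle_sign (snd a) (snd b) * coeff F a * coeff (r *\<^sub>R G) b))"
    using sub by (intro times_gpoly_superset) auto
  also have "\<dots> = r *\<^sub>R (F * G)"
    unfolding times_gpoly_def scaleR_sum_right scaleR_gmono coeff_scaleR
    by (intro sum.cong refl arg_cong[where f = "gmono _"]) (simp add: mult_ac)
  finally show "F * (r *\<^sub>R G) = r *\<^sub>R (F * G)" .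
qed

definition p_gen :: "nat \<Rightarrow> gpoly" where
  "p_gen i = gmono ({#i#}, {||}) 1"

definition odd_gen :: "nat \<Rightarrow> gpoly" where
  "odd_gen s = gmono ({#}, {|s|}) 1"

abbreviation tau_ix :: "nat \<Rightarrow> nat" where "tau_ix \<alpha> \<equiv> 2 * \<alpha>"
abbreviation theta_ix :: "nat \<Rightarrow> nat" where "theta_ix \<alpha> \<equiv> Suc (2 * \<alpha>)"
abbreviation tau :: "nat \<Rightarrow> gpoly" where "tau \<alpha> \<equiv> odd_gen (tau_ix \<alpha>)"
abbreviation theta :: "nat \<Rightarrow> gpoly" where "theta \<alpha> \<equiv> odd_gen (theta_ix \<alpha>)"

definition mono_degree :: "mono \<Rightarrow> nat" where
  "mono_degree a = 2 * size (fst a) + fcard (snd a)"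

definition p_deriv :: "nat \<Rightarrow> gpoly \<Rightarrow> gpoly" where
  "p_deriv i F = (\<Sum>a\<in>supp F.
     gmono (fst a - {#i#}, snd a) (real (count (fst a) i) * coeff F a))"

text \<open>Left and right derivatives with respect to an odd coordinate: the coordinate is moved to
  the left, respectively to the right, end of the monomial and then removed.\<close>

definition left_deriv :: "nat \<Rightarrow> gpoly \<Rightarrow> gpoly" where
  "left_deriv s F = (\<Sum>a\<in>{a \<in> supp F. s |\<in>| snd a}.
     gmono (fst a, snd a |-| {|s|}) ((- 1) ^ card {t. t |\<in>| snd a \<and> t < s} * coeff F a))"

definition right_deriv :: "nat \<Rightarrow> gpoly \<Rightarrow> gpoly" where
  "right_deriv s F = (\<Sum>a\<in>{a \<in> supp F. s |\<in>| snd a}.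
     gmono (fst a, snd a |-| {|s|}) ((- 1) ^ card {t. t |\<in>| snd a \<and> s < t} * coeff F a))"

section \<open>Smooth functions on open subsets of $\mathbb{R}^n$\<close>

definition partial :: "nat \<Rightarrow> ((nat \<Rightarrow> real) \<Rightarrow> real) \<Rightarrow> (nat \<Rightarrow> real) \<Rightarrow> real" where
  "partial i f x = deriv (\<lambda>t. f (x(i := t))) (x i)"

primrec C_diff :: "nat \<Rightarrow> nat \<Rightarrow> (nat \<Rightarrow> real) set \<Rightarrow> ((nat \<Rightarrow> real) \<Rightarrow> real) \<Rightarrow> bool" where
  "C_diff 0 n V f \<longleftrightarrow> continuous_map (subtopology (Euclidean_space n) V) euclideanreal f"
| "C_diff (Suc k) n V f \<longleftrightarrow>
     continuous_map (subtopology (Euclidean_space n) V) euclideanreal f \<and>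
     (\<forall>i<n. (\<forall>x\<in>V. (\<lambda>t. f (x(i := t))) differentiable (at (x i))) \<and> C_diff k n V (partial i f))"

definition smooth :: "nat \<Rightarrow> (nat \<Rightarrow> real) set \<Rightarrow> ((nat \<Rightarrow> real) \<Rightarrow> real) \<Rightarrow> bool" where
  "smooth n V f \<longleftrightarrow> (\<forall>k. C_diff k n V f)"

section \<open>Vector bundles\<close>

text \<open>
  The fibres are given as subspaces of one real vector space \<open>'v\<close>, which carries no topology and
  whose dimension is not restricted.  Every vector bundle is of this form: for \<open>'v\<close> one may take
  the algebraic direct sum of all the fibres.  An adapted chart is a chart of the base together
  with a local frame over its domain.  An atlas of adapted charts is the same thing as a smooth
  structure on the base together with a smooth structure on the bundle.  The base dimension and
  the rank may be zero.
\<close>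

record ('m, 'v) adapted_chart =
  cdom :: "'m set"
  coord :: "'m \<Rightarrow> nat \<Rightarrow> real"
  frame :: "nat \<Rightarrow> 'm \<Rightarrow> 'v"

record ('m, 'v) vbundle =
  base :: "'m topology"
  base_dim :: nat
  fibre_dim :: nat
  fibre :: "'m \<Rightarrow> 'v set"
  atlas :: "('m, 'v) adapted_chart set"

definition smooth_in ::
  "('m, 'v) vbundle \<Rightarrow> ('m, 'v) adapted_chart \<Rightarrow> 'm set \<Rightarrow> ('m \<Rightarrow> real) \<Rightarrow> bool" where
  "smooth_in B c W f \<longleftrightarrow>
     smooth (base_dim B) (coord c ` W) (f \<circ> inv_into (cdom c) (coord c))"

definition chart_partial ::
  "('m, 'v) adapted_chart \<Rightarrow> nat \<Rightarrow> ('m \<Rightarrow> real) \<Rightarrow> 'm \<Rightarrow> real" where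
  "chart_partial c i f m = partial i (f \<circ> inv_into (cdom c) (coord c)) (coord c m)"

definition coframe ::
  "('m, 'v::real_vector) vbundle \<Rightarrow> ('m, 'v) adapted_chart \<Rightarrow> nat \<Rightarrow> 'm \<Rightarrow> 'v \<Rightarrow> real" where
  "coframe B c \<alpha> m v =
     representation ((\<lambda>\<beta>. frame c \<beta> m) ` {..<fibre_dim B}) v (frame c \<alpha> m)"

definition vector_bundle :: "('m, 'v::real_vector) vbundle \<Rightarrow> bool" where
  "vector_bundle B \<longleftrightarrow>
     Hausdorff_space (base B) \<and> second_countable (base B) \<and>
     (\<forall>m\<in>topspace (base B). subspace (fibre B m)) \<and>
     (\<Union>c\<in>atlas B. cdom c) = topspace (base B) \<and>
     (\<forall>c\<in>atlas B.
        openin (base B) (cdom c) \<and>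
        openin (Euclidean_space (base_dim B)) (coord c ` cdom c) \<and>
        homeomorphic_map (subtopology (base B) (cdom c))
          (subtopology (Euclidean_space (base_dim B)) (coord c ` cdom c)) (coord c) \<and>
        (\<forall>m\<in>cdom c.
           inj_on (\<lambda>\<alpha>. frame c \<alpha> m) {..<fibre_dim B} \<and>
           independent ((\<lambda>\<alpha>. frame c \<alpha> m) ` {..<fibre_dim B}) \<and>
           span ((\<lambda>\<alpha>. frame c \<alpha> m) ` {..<fibre_dim B}) = fibre B m)) \<and>
     (\<forall>c\<in>atlas B. \<forall>c'\<in>atlas B.
        (\<forall>i<base_dim B. smooth_in B c (cdom c \<inter> cdom c') (\<lambda>m. coord c' m i)) \<and>
        (\<forall>\<alpha><fibre_dim B. \<forall>\<beta><fibre_dim B.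
           smooth_in B c (cdom c \<inter> cdom c') (\<lambda>m. coframe B c \<alpha> m (frame c' \<beta> m))))"

section \<open>The graded algebra of functions on $T^*[2]A[1]$ and the big bracket\<close>

text \<open>
  A function is a family of local expressions, one for each adapted chart, the coefficients being
  functions on the domain of the chart.  A family has the value 0 wherever it carries no
  information, so that equality of functions is equality of families.
\<close>

type_synonym ('m, 'v) family = "('m, 'v) adapted_chart \<Rightarrow> 'm \<Rightarrow> gpoly"

text \<open>
  Change of coordinates from \<open>c'\<close> (primed) to \<open>c\<close>, where
  $e'_\beta = g^\alpha_\beta e_\alpha$ and $h = g^{-1}$:
  $\tau'^\beta = h^\beta_\alpha \tau^\alpha$, $\theta'_\beta = g^\alpha_\beta \theta_\alpha$ and
  $p'_i = \frac{\partial x^j}{\partial x'^i} p_j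
    + \frac{\partial g^\alpha_\beta}{\partial x'^i} h^\beta_\gamma \theta_\alpha \tau^\gamma$.
  The formula for $p'_i$ is that of the cotangent lift; it is forced by
  $\{\tau^\alpha, p'_i\} = \frac{\partial g^\alpha_\beta}{\partial x'^i} \tau'^\beta$.
\<close>

definition p_image :: "('m, 'v::real_vector) vbundle \<Rightarrow> ('m, 'v) adapted_chart \<Rightarrow>
    ('m, 'v) adapted_chart \<Rightarrow> 'm \<Rightarrow> nat \<Rightarrow> gpoly" where
  "p_image B c c' m i =
     (\<Sum>j<base_dim B. chart_partial c' i (\<lambda>m. coord c m j) m *\<^sub>R p_gen j) +
     (\<Sum>\<alpha><fibre_dim B. \<Sum>\<beta><fibre_dim B. \<Sum>\<gamma><fibre_dim B.
        (chart_partial c' i (\<lambda>m. coframe B c \<alpha> m (frame c' \<beta> m)) m *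
         coframe B c' \<beta> m (frame c \<gamma> m)) *\<^sub>R (theta \<alpha> * tau \<gamma>))"

definition odd_image :: "('m, 'v::real_vector) vbundle \<Rightarrow> ('m, 'v) adapted_chart \<Rightarrow>
    ('m, 'v) adapted_chart \<Rightarrow> 'm \<Rightarrow> nat \<Rightarrow> gpoly" where
  "odd_image B c c' m s =
     (if even s
      then (\<Sum>\<alpha><fibre_dim B. coframe B c' (s div 2) m (frame c \<alpha> m) *\<^sub>R tau \<alpha>)
      else (\<Sum>\<alpha><fibre_dim B. coframe B c \<alpha> m (frame c' (s div 2) m) *\<^sub>R theta \<alpha>))"

definition change_coords :: "('m, 'v::real_vector) vbundle \<Rightarrow> ('m, 'v) adapted_chart \<Rightarrow>
    ('m, 'v) adapted_chart \<Rightarrow> 'm \<Rightarrow> gpoly \<Rightarrow> gpoly" where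
  "change_coords B c c' m F = (\<Sum>a\<in>supp F. coeff F a *\<^sub>R
     (prod_list (map (p_image B c c' m) (sorted_list_of_multiset (fst a))) *
      prod_list (map (odd_image B c c' m) (sorted_list_of_fset (snd a)))))"

text \<open>The homogeneous component $\mathcal{A}^k$.\<close>

definition graded_fun :: "('m, 'v::real_vector) vbundle \<Rightarrow> nat \<Rightarrow> ('m, 'v) family set" where
  "graded_fun B k = {F.
     (\<forall>c m. \<not> (c \<in> atlas B \<and> m \<in> cdom c) \<longrightarrow> F c m = 0) \<and>
     (\<forall>c m a. coeff (F c m) a \<noteq> 0 \<longrightarrow>
        set_mset (fst a) \<subseteq> {..<base_dim B} \<and> fset (snd a) \<subseteq> {..<2 * fibre_dim B} \<and>
        mono_degree a = k) \<and>
     (\<forall>c\<in>atlas B. \<forall>a. smooth_in B c (cdom c) (\<lambda>m. coeff (F c m) a)) \<and>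
     (\<forall>c\<in>atlas B. \<forall>c'\<in>atlas B. \<forall>m\<in>cdom c \<inter> cdom c'.
        F c m = change_coords B c c' m (F c' m))}"

text \<open>Coefficientwise derivative.  For homogeneous functions the index set is finite.\<close>

definition x_deriv ::
  "('m, 'v) adapted_chart \<Rightarrow> nat \<Rightarrow> ('m \<Rightarrow> gpoly) \<Rightarrow> 'm \<Rightarrow> gpoly" where
  "x_deriv c i F m =
     (\<Sum>a | chart_partial c i (\<lambda>m. coeff (F m) a) m \<noteq> 0.
        gmono a (chart_partial c i (\<lambda>m. coeff (F m) a) m))"

text \<open>
  The canonical bracket in local coordinates: the biderivation of degree $-2$ for which
  $\{x^i, p_j\} = \delta^i_j$ and $\{\tau^\alpha, \theta_\beta\} = \delta^\alpha_\beta$ are the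
  only non-vanishing brackets of coordinates.
\<close>

definition local_bracket :: "('m, 'v) vbundle \<Rightarrow> ('m, 'v) adapted_chart \<Rightarrow>
    ('m \<Rightarrow> gpoly) \<Rightarrow> ('m \<Rightarrow> gpoly) \<Rightarrow> 'm \<Rightarrow> gpoly" where
  "local_bracket B c F G m =
     (\<Sum>i<base_dim B. x_deriv c i F m * p_deriv i (G m) - p_deriv i (F m) * x_deriv c i G m) +
     (\<Sum>\<alpha><fibre_dim B.
        right_deriv (tau_ix \<alpha>) (F m) * left_deriv (theta_ix \<alpha>) (G m) +
        right_deriv (theta_ix \<alpha>) (F m) * left_deriv (tau_ix \<alpha>) (G m))"

definition big_bracket ::
  "('m, 'v) vbundle \<Rightarrow> ('m, 'v) family \<Rightarrow> ('m, 'v) family \<Rightarrow> ('m, 'v) family" where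
  "big_bracket B F G =
     (\<lambda>c m. if c \<in> atlas B \<and> m \<in> cdom c then local_bracket B c (F c) (G c) m else 0)"

section \<open>The bundle $E = A \oplus A^*$ and its endomorphisms\<close>

text \<open>Elements of the dual of a fibre are functions on \<open>'v\<close> that vanish off the fibre.\<close>

definition linear_on_fibre ::
  "'v::real_vector set \<Rightarrow> ('v \<Rightarrow> 'w::real_vector) \<Rightarrow> bool" where
  "linear_on_fibre V f \<longleftrightarrow>
     (\<forall>x\<in>V. \<forall>y\<in>V. \<forall>a b. f (a *\<^sub>R x + b *\<^sub>R y) = a *\<^sub>R f x + b *\<^sub>R f y)"

definition dual_fibre :: "('m, 'v::real_vector) vbundle \<Rightarrow> 'm \<Rightarrow> ('v \<Rightarrow> real) set" where
  "dual_fibre B m = {\<xi>. linear_on_fibre (fibre B m) \<xi> \<and> (\<forall>v. v \<notin> fibre B m \<longrightarrow> \<xi> v = 0)}"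

type_synonym 'v evec = "'v \<times> ('v \<Rightarrow> real)"

definition E_fibre :: "('m, 'v::real_vector) vbundle \<Rightarrow> 'm \<Rightarrow> 'v evec set" where
  "E_fibre B m = fibre B m \<times> dual_fibre B m"

definition E_comb :: "real \<Rightarrow> 'v::real_vector evec \<Rightarrow> real \<Rightarrow> 'v evec \<Rightarrow> 'v evec" where
  "E_comb a u b v = (a *\<^sub>R fst u + b *\<^sub>R fst v, \<lambda>y. a * snd u y + b * snd v y)"

definition pairing :: "'v evec \<Rightarrow> 'v evec \<Rightarrow> real" where
  "pairing u v = snd u (fst v) + snd v (fst u)"

definition E_frame ::
  "('m, 'v::real_vector) vbundle \<Rightarrow> ('m, 'v) adapted_chart \<Rightarrow> 'm \<Rightarrow> nat \<Rightarrow> 'v evec" where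
  "E_frame B c m s =
     (if even s then (0, coframe B c (s div 2) m) else (frame c (s div 2) m, 0))"

definition skew_endo ::
  "('m, 'v::real_vector) vbundle \<Rightarrow> ('m \<Rightarrow> 'v evec \<Rightarrow> 'v evec) \<Rightarrow> bool" where
  "skew_endo B \<N> \<longleftrightarrow>
     (\<forall>m\<in>topspace (base B). \<forall>u\<in>E_fibre B m.
        \<N> m u \<in> E_fibre B m \<and>
        (\<forall>v\<in>E_fibre B m.
           (\<forall>a b. \<N> m (E_comb a u b v) = E_comb a (\<N> m u) b (\<N> m v)) \<and>
           pairing (\<N> m u) v + pairing u (\<N> m v) = 0)) \<and>
     (\<forall>c\<in>atlas B. \<forall>s<2 * fibre_dim B. \<forall>t<2 * fibre_dim B.
        smooth_in B c (cdom c) (\<lambda>m. pairing (\<N> m (E_frame B c m s)) (E_frame B c m t)))"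

text \<open>
  The identification of $\Gamma(A \oplus A^*)$ with $\mathcal{A}^1$, in a chart:
  $X^\alpha e_\alpha + \xi_\alpha \epsilon^\alpha \leftrightarrow
   X^\alpha \theta_\alpha + \xi_\alpha \tau^\alpha$.  From here on a section of $E$ is an element of
  $\mathcal{A}^1$.
\<close>

definition E_to_gpoly :: "('m, 'v::real_vector) vbundle \<Rightarrow> ('m, 'v) adapted_chart \<Rightarrow> 'm \<Rightarrow>
    'v evec \<Rightarrow> gpoly" where
  "E_to_gpoly B c m u =
     (\<Sum>\<alpha><fibre_dim B. coframe B c \<alpha> m (fst u) *\<^sub>R theta \<alpha> + snd u (frame c \<alpha> m) *\<^sub>R tau \<alpha>)"

definition gpoly_to_E :: "('m, 'v::real_vector) vbundle \<Rightarrow> ('m, 'v) adapted_chart \<Rightarrow> 'm \<Rightarrow>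
    gpoly \<Rightarrow> 'v evec" where
  "gpoly_to_E B c m F =
     (\<Sum>\<alpha><fibre_dim B. coeff F ({#}, {|theta_ix \<alpha>|}) *\<^sub>R frame c \<alpha> m,
      \<lambda>v. \<Sum>\<alpha><fibre_dim B. coeff F ({#}, {|tau_ix \<alpha>|}) * coframe B c \<alpha> m v)"

definition endo_act :: "('m, 'v::real_vector) vbundle \<Rightarrow> ('m \<Rightarrow> 'v evec \<Rightarrow> 'v evec) \<Rightarrow>
    ('m, 'v) family \<Rightarrow> ('m, 'v) family" where
  "endo_act B \<N> u =
     (\<lambda>c m. if c \<in> atlas B \<and> m \<in> cdom c
            then E_to_gpoly B c m (\<N> m (gpoly_to_E B c m (u c m))) else 0)"

text \<open>Sections of $A$, as elements of $\mathcal{A}^1$ without $\tau$-components.\<close>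

definition A_sections :: "('m, 'v::real_vector) vbundle \<Rightarrow> ('m, 'v) family set" where
  "A_sections B = {X \<in> graded_fun B 1. \<forall>c m \<alpha>. coeff (X c m) ({#}, {|tau_ix \<alpha>|}) = 0}"

text \<open>The element $\widetilde{\mathcal{N}}$ of $\mathcal{A}^2$.\<close>

definition tilde :: "('m, 'v::real_vector) vbundle \<Rightarrow> ('m \<Rightarrow> 'v evec \<Rightarrow> 'v evec) \<Rightarrow>
    ('m, 'v) family" where
  "tilde B \<N> = (THE D. D \<in> graded_fun B 2 \<and>
     (\<forall>u\<in>graded_fun B 1. endo_act B \<N> u = big_bracket B u D))"

definition weak_deforming_tensor :: "('m, 'v::real_vector) vbundle \<Rightarrow> ('m, 'v) family \<Rightarrow>
    ('m \<Rightarrow> 'v evec \<Rightarrow> 'v evec) \<Rightarrow> bool" where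
  "weak_deforming_tensor B \<Theta> \<N> \<longleftrightarrow> skew_endo B \<N> \<and>
     big_bracket B \<Theta> (big_bracket B (big_bracket B (tilde B \<N>) \<Theta>) (tilde B \<N>)) = 0"

section \<open>Lie algebroids and presymplectic-Nijenhuis structures\<close>

definition lie_algebroid :: "('m, 'v::real_vector) vbundle \<Rightarrow> ('m, 'v) family \<Rightarrow> bool" where
  "lie_algebroid B \<mu> \<longleftrightarrow>
     \<mu> \<in> graded_fun B 3 \<and>
     (\<forall>c m a. coeff (\<mu> c m) a \<noteq> 0 \<longrightarrow>
        (\<exists>\<alpha> i. a = ({#i#}, {|tau_ix \<alpha>|})) \<or>
        (\<exists>\<alpha> \<beta> \<gamma>. a = ({#}, {|tau_ix \<alpha>, tau_ix \<beta>, theta_ix \<gamma>|}))) \<and>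
     big_bracket B \<mu> \<mu> = 0"

definition lie_bracket :: "('m, 'v) vbundle \<Rightarrow> ('m, 'v) family \<Rightarrow>
    ('m, 'v) family \<Rightarrow> ('m, 'v) family \<Rightarrow> ('m, 'v) family" where
  "lie_bracket B \<mu> X Y = big_bracket B (big_bracket B X \<mu>) Y"

definition bundle_endo :: "('m, 'v::real_vector) vbundle \<Rightarrow> ('m \<Rightarrow> 'v \<Rightarrow> 'v) \<Rightarrow> bool" where
  "bundle_endo B N \<longleftrightarrow>
     (\<forall>m\<in>topspace (base B). N m ` fibre B m \<subseteq> fibre B m \<and> linear_on_fibre (fibre B m) (N m)) \<and>
     (\<forall>c\<in>atlas B. \<forall>\<alpha><fibre_dim B. \<forall>\<beta><fibre_dim B.
        smooth_in B c (cdom c) (\<lambda>m. coframe B c \<beta> m (N m (frame c \<alpha> m))))"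

definition two_form :: "('m, 'v::real_vector) vbundle \<Rightarrow> ('m \<Rightarrow> 'v \<Rightarrow> 'v \<Rightarrow> real) \<Rightarrow> bool" where
  "two_form B \<omega> \<longleftrightarrow>
     (\<forall>m\<in>topspace (base B).
        \<omega> m ` fibre B m \<subseteq> dual_fibre B m \<and>
        (\<forall>y\<in>fibre B m. linear_on_fibre (fibre B m) (\<lambda>x. \<omega> m x y)) \<and>
        (\<forall>x\<in>fibre B m. \<forall>y\<in>fibre B m. \<omega> m x y = - \<omega> m y x)) \<and>
     (\<forall>c\<in>atlas B. \<forall>\<alpha><fibre_dim B. \<forall>\<beta><fibre_dim B.
        smooth_in B c (cdom c) (\<lambda>m. \<omega> m (frame c \<alpha> m) (frame c \<beta> m)))"

definition transpose_endo :: "('m, 'v) vbundle \<Rightarrow> ('m \<Rightarrow> 'v \<Rightarrow> 'v) \<Rightarrow>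
    'm \<Rightarrow> ('v \<Rightarrow> real) \<Rightarrow> ('v \<Rightarrow> real)" where
  "transpose_endo B N m \<xi> = (\<lambda>v. if v \<in> fibre B m then \<xi> (N m v) else 0)"

text \<open>\<open>block P Q R T\<close> is the endomorphism of $A \oplus A^*$ with first row \<open>P\<close>, \<open>Q\<close> and second
  row \<open>R\<close>, \<open>T\<close>.\<close>

definition block :: "('m \<Rightarrow> 'v::real_vector \<Rightarrow> 'v) \<Rightarrow> ('m \<Rightarrow> ('v \<Rightarrow> real) \<Rightarrow> 'v) \<Rightarrow>
    ('m \<Rightarrow> 'v \<Rightarrow> 'v \<Rightarrow> real) \<Rightarrow> ('m \<Rightarrow> ('v \<Rightarrow> real) \<Rightarrow> 'v \<Rightarrow> real) \<Rightarrow> 'm \<Rightarrow> 'v evec \<Rightarrow> 'v evec" where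
  "block P Q R T m u = (P m (fst u) + Q m (snd u), R m (fst u) + T m (snd u))"

text \<open>On sections of $A$, the endomorphism \<open>block N 0 0 0\<close> is $X \mapsto NX$.\<close>

definition nijenhuis_tensor :: "('m, 'v::real_vector) vbundle \<Rightarrow> ('m, 'v) family \<Rightarrow>
    ('m \<Rightarrow> 'v \<Rightarrow> 'v) \<Rightarrow> bool" where
  "nijenhuis_tensor B \<mu> N \<longleftrightarrow>
     (\<forall>X\<in>A_sections B. \<forall>Y\<in>A_sections B.
        let NN = endo_act B (block N 0 0 0); br = lie_bracket B \<mu> in
        br (NN X) (NN Y) - NN (br (NN X) Y + br X (NN Y) - NN (br X Y)) = 0)"

definition compatible_form :: "('m, 'v) vbundle \<Rightarrow> ('m \<Rightarrow> 'v \<Rightarrow> 'v \<Rightarrow> real) \<Rightarrow>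
    ('m \<Rightarrow> 'v \<Rightarrow> 'v) \<Rightarrow> bool" where
  "compatible_form B \<omega> N \<longleftrightarrow>
     (\<forall>m\<in>topspace (base B). \<forall>x\<in>fibre B m. \<omega> m (N m x) = transpose_endo B N m (\<omega> m x))"

text \<open>$\mathrm{d}_\mu \omega = 0$, where $\mathrm{d}_\mu = \{\mu, \cdot\}$.\<close>

definition closed_form :: "('m, 'v::real_vector) vbundle \<Rightarrow> ('m, 'v) family \<Rightarrow>
    ('m \<Rightarrow> 'v \<Rightarrow> 'v \<Rightarrow> real) \<Rightarrow> bool" where
  "closed_form B \<mu> \<omega> \<longleftrightarrow> big_bracket B \<mu> (tilde B (block 0 0 \<omega> 0)) = 0"

definition Omega_N_structure :: "('m, 'v::real_vector) vbundle \<Rightarrow> ('m, 'v) family \<Rightarrow>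
    ('m \<Rightarrow> 'v \<Rightarrow> 'v \<Rightarrow> real) \<Rightarrow> ('m \<Rightarrow> 'v \<Rightarrow> 'v) \<Rightarrow> bool" where
  "Omega_N_structure B \<mu> \<omega> N \<longleftrightarrow>
     two_form B \<omega> \<and> bundle_endo B N \<and>
     closed_form B \<mu> \<omega> \<and> nijenhuis_tensor B \<mu> N \<and> compatible_form B \<omega> N \<and>
     closed_form B \<mu> (\<lambda>m x. \<omega> m (N m x))"

end

theory Submission
  imports Defs
begin

text \<open>
  Write $\widetilde{\mathcal N} = N + \omega$ in $\mathcal A^2$.  Closedness of $\omega$ gives
  $\{\omega, \mu\} = 0$.  As $\{N, \omega\} = 2\, \omega N$ is closed too, the Jacobi identity gives
  $\{\{N, \mu\}, \omega\} = 0$.  Hence the iterated bracket reduces to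
  $\{\mu, \{\{N, \mu\}, N\}\}$.  With $T = \{\{\mu, N\}, N\} + \{\mu, N^2\}$, the function
  $\{\{X, T\}, Y\}$ is twice the Nijenhuis torsion of $N$ on $X$ and $Y$, so $T = 0$, and what
  remains is $\{\mu, \{\mu, N^2\}\} = 0$, which follows from $\{\mu, \mu\} = 0$.

  All brackets are computed in one chart.  Global sections enter in two places, namely the
  uniqueness of $\widetilde{\mathcal N}$ and the passage from the Nijenhuis condition to $T = 0$; there
  bump functions provide sections with prescribed first-order jets.  In rank zero
  $\widetilde{\mathcal N}$ is not unique, but then $\mu = 0$.
\<close>

section \<open>Smooth functions on open subsets of Euclidean space\<close>

text \<open>Besides its degree each function has a weight, the number of \<tau> minus the number of
  \<theta>. The bracket adds weights and lowers the degree by 2; N, \<omega> and \<mu> have degree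
  and weight (2, 0), (2, 2) and (3, 1). A monomial of positive weight contains some \<tau>, so
  brackets with sections of A detect a function of positive weight; this is why {N, \<omega>} and T
  can be tested on such sections. The origin of T is the derivation \<delta> = {., N}: applied twice
  to {{X, \<mu>}, Y} it produces the torsion twice, up to terms in \<delta>(\<delta> X) and
  \<delta>(\<delta> Y) that {\<mu>, N^2} cancels. Two obstacles shape the development.
  Differentiation along the base is additive only on smooth coefficients, so the algebra is stated
  on carriers of given degree and weight; their finitely many monomials turn sums over a varying
  support into sums over a fixed set. And the Nijenhuis condition quantifies over global sections,
  while closedness refers to a definite description, so local formulas become usable only after
  global sections have been built from chart data.\<close>

lemma Euclidean_space_top_of_set: "Euclidean_space n = top_of_set (topspace (Euclidean_space n))"
  by (simp add: Euclidean_space_def euclidean_product_topology)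

lemma continuous_map_Euclidean_subset:
  assumes "V \<subseteq> topspace (Euclidean_space n)"
  shows "continuous_map (subtopology (Euclidean_space n) V) euclideanreal f \<longleftrightarrow> continuous_on V f"
proof -
  have "subtopology (Euclidean_space n) V = top_of_set V"
    using assms Euclidean_space_top_of_set[of n] by (metis inf.absorb2 subtopology_subtopology)
  then show ?thesis
    by (simp add: continuous_map_iff_continuous)
qed

lemma openin_Euclidean_obtain:
  assumes "openin (Euclidean_space n) V"
  obtains U where "open U" "V = topspace (Euclidean_space n) \<inter> U"
  using assms Euclidean_space_top_of_set[of n] by (metis openin_open)

lemma tendsto_fun_componentwise:
  fixes f :: "'a \<Rightarrow> 'b \<Rightarrow> 'c::topological_space"
  assumes "\<And>i. ((\<lambda>t. f t i) \<longlongrightarrow> l i) F"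
  shows "(f \<longlongrightarrow> l) F"
proof -
  have "limitin (product_topology (\<lambda>i. euclidean) UNIV) f l F"
    using assms by (simp add: limitin_componentwise)
  then show ?thesis
    by (simp add: euclidean_product_topology)
qed

lemma eventually_fun_upd_in_open:
  fixes x :: "nat \<Rightarrow> real"
  assumes V: "openin (Euclidean_space n) V" and x: "x \<in> V" and i: "i < n"
  shows "\<forall>\<^sub>F t in nhds (x i). x(i := t) \<in> V"
proof -
  obtain U where U: "open U" "V = topspace (Euclidean_space n) \<inter> U"
    using V by (rule openin_Euclidean_obtain)
  have "((\<lambda>t. x(i := t)) \<longlongrightarrow> x(i := x i)) (nhds (x i))"
    by (rule tendsto_fun_componentwise, rename_tac j, case_tac "j = i") (auto simp: filterlim_ident)
  then have "\<forall>\<^sub>F t in nhds (x i). x(i := t) \<in> U"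
    using U x by (intro topological_tendstoD) auto
  then show ?thesis
    by (rule eventually_mono) (use U x i in \<open>auto simp: topspace_Euclidean_space\<close>)
qed

text \<open>Points of the space vanish from index \<open>n\<close> on, so only \<open>n\<close> of
  the radii around the coordinates of \<open>a\<close> matter and their minimum serves for all.
  Boxes suit the later arguments, which move one coordinate at a time.\<close>

lemma Euclidean_open_contains_box:
  assumes V: "openin (Euclidean_space n) V" and a: "a \<in> V"
  obtains \<delta> where "\<delta> > 0"
    "\<And>x. x \<in> topspace (Euclidean_space n) \<Longrightarrow> (\<And>i. i < n \<Longrightarrow> \<bar>x i - a i\<bar> \<le> \<delta>) \<Longrightarrow> x \<in> V"
proof -
  obtain U where U: "open U" "V = topspace (Euclidean_space n) \<inter> U"
    using V by (rule openin_Euclidean_obtain)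
  have "openin (product_topology (\<lambda>i. euclidean) UNIV) U"
    using U by (simp add: euclidean_product_topology)
  from product_topology_open_contains_basis[OF this, of a] obtain X where
    X: "a \<in> (\<Pi>\<^sub>E i\<in>UNIV. X i)" "\<And>i. open (X i)" "(\<Pi>\<^sub>E i\<in>UNIV. X i) \<subseteq> U"
    using a U by auto
  have "\<exists>d>0. cball (a i) d \<subseteq> X i" for i
    using X by (intro iffD1[OF open_contains_cball, rule_format]) auto
  then obtain d where d: "\<And>i. d i > 0" "\<And>i. cball (a i) (d i) \<subseteq> X i" by metis
  \<comment> \<open>The inserted 1 keeps the set nonempty when \<open>n = 0\<close>.\<close>
  define \<delta> where "\<delta> = Min (insert 1 (d ` {..<n}))"
  have pos: "\<delta> > 0" using d by (auto simp: \<delta>_def)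
  have le: "\<delta> \<le> d i" if "i < n" for i using that by (auto simp: \<delta>_def)
  show thesis
  proof (rule that[OF pos])
    fix x assume x: "x \<in> topspace (Euclidean_space n)" "\<And>i. i < n \<Longrightarrow> \<bar>x i - a i\<bar> \<le> \<delta>"
    have "x i \<in> X i" for i
    proof (cases "i < n")
      case True
      then have "x i \<in> cball (a i) (d i)"
        using x(2)[of i] le[of i] by (simp add: dist_real_def abs_minus_commute)
      then show ?thesis using d by blast
    next
      case False
      then have "x i = a i" using x a U by (auto simp: topspace_Euclidean_space)
      then show ?thesis using X by auto
    qed
    then show "x \<in> V" using U X x by (auto simp: PiE_def Pi_def)
  qed
qed

text \<open>\<open>partial\<close> rests on \<open>deriv\<close>, which has a value even where no
  derivative exists. This predicate asserts existence as well, and lets an explicit formula stand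
  for the derivative.\<close>

definition has_partial ::
  "nat \<Rightarrow> (nat \<Rightarrow> real) set \<Rightarrow> ((nat \<Rightarrow> real) \<Rightarrow> real) \<Rightarrow> ((nat \<Rightarrow> real) \<Rightarrow> real) \<Rightarrow> bool" where
  "has_partial i V f g \<longleftrightarrow>
     (\<forall>x\<in>V. ((\<lambda>t. f (x(i := t))) has_real_derivative g x) (at (x i)))"

lemma has_partialD: "has_partial i V f g \<Longrightarrow> x \<in> V \<Longrightarrow> partial i f x = g x"
  by (auto simp: has_partial_def partial_def DERIV_imp_deriv)

lemma C_diff_imp_continuous_on:
  assumes "C_diff k n V f" "V \<subseteq> topspace (Euclidean_space n)" shows "continuous_on V f"
  using assms continuous_map_Euclidean_subset[of V n f] by (cases k) auto

lemma C_diff_Suc_partial: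
  assumes "C_diff (Suc k) n V f" "i < n" "V \<subseteq> topspace (Euclidean_space n)"
  shows "has_partial i V f (partial i f)" "C_diff k n V (partial i f)"
  using assms by (auto simp: has_partial_def partial_def DERIV_deriv_iff_real_differentiable)

lemma C_diff_const: "C_diff k n V (\<lambda>x. c)"
proof (induction k arbitrary: c)
  case (Suc k)
  have "partial i (\<lambda>x. c) = (\<lambda>x. 0)" for i by (auto simp: partial_def)
  then show ?case using Suc by auto
qed simp

lemma C_diff_mono: "C_diff (Suc k) n V f \<Longrightarrow> C_diff k n V f"
  by (induction k arbitrary: f) auto

lemma C_diff_le: "C_diff k n V f \<Longrightarrow> l \<le> k \<Longrightarrow> C_diff l n V f"
  by (induction k) (auto simp: le_Suc_eq dest: C_diff_mono simp del: C_diff.simps)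

declare C_diff.simps(2) [simp del]

section \<open>Closure properties of the classes \<open>C_diff k\<close> on an open set\<close>

locale Euclidean_open =
  fixes n :: nat and V :: "(nat \<Rightarrow> real) set"
  assumes open_V: "openin (Euclidean_space n) V"
begin

lemma V_subset: "V \<subseteq> topspace (Euclidean_space n)"
  using open_V by (rule openin_subset)

lemma V_zero: "x \<in> V \<Longrightarrow> n \<le> i \<Longrightarrow> x i = 0"
  using V_subset by (auto simp: topspace_Euclidean_space)

lemma eventually_eq_line:
  assumes "\<And>y. y \<in> V \<Longrightarrow> f y = g y" "x \<in> V" "i < n"
  shows "\<forall>\<^sub>F t in nhds (x i). f (x(i := t)) = g (x(i := t))"
  using eventually_fun_upd_in_open[OF open_V assms(2,3)] by (rule eventually_mono) (rule assms)

lemma partial_cong: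
  assumes "\<And>y. y \<in> V \<Longrightarrow> f y = g y" "x \<in> V" "i < n"
  shows "partial i f x = partial i g x"
  unfolding partial_def using eventually_eq_line[of f g x i] assms by (intro deriv_cong_ev) auto

lemma has_partial_cong:
  assumes "\<And>y. y \<in> V \<Longrightarrow> f y = g y" "\<And>y. y \<in> V \<Longrightarrow> f' y = g' y" "i < n" "has_partial i V f f'"
  shows "has_partial i V g g'"
  unfolding has_partial_def
proof
  fix x assume x: "x \<in> V"
  then show "((\<lambda>t. g (x(i := t))) has_real_derivative g' x) (at (x i))"
    using DERIV_cong_ev[OF refl eventually_eq_line[of f g, OF assms(1) x assms(3)] assms(2)[OF x]] x assms(4)
    by (simp add: has_partial_def)
qed

text \<open>Functions are total, but only their values on the open set count. The partial
  derivatives again agree only there, hence the induction varies both functions.\<close>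

lemma C_diff_cong:
  assumes "C_diff k n V f" "\<And>y. y \<in> V \<Longrightarrow> f y = g y"
  shows "C_diff k n V g"
  using assms
proof (induction k arbitrary: f g)
  case 0
  then show ?case
    using V_subset by (simp add: continuous_map_Euclidean_subset cong: continuous_on_cong)
next
  case (Suc k)
  have "continuous_on V g"
    using C_diff_imp_continuous_on[OF Suc.prems(1) V_subset] Suc.prems(2)
    by (simp cong: continuous_on_cong)
  moreover have "has_partial i V g (partial i g) \<and> C_diff k n V (partial i g)" if i: "i < n" for i
  proof -
    note P = C_diff_Suc_partial[OF Suc.prems(1) i V_subset]
    have eq: "partial i f y = partial i g y" if "y \<in> V" for y
      using partial_cong Suc.prems(2) that i by blast
    show ?thesis
      using has_partial_cong[OF Suc.prems(2) eq i P(1)] Suc.IH[OF P(2) eq] by auto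
  qed
  ultimately show ?case
    using V_subset
    by (auto simp: C_diff.simps(2) continuous_map_Euclidean_subset has_partial_def real_differentiable_def)
qed

text \<open>Any function that is a derivative on \<open>V\<close> may replace
  \<open>partial i f\<close>, so smoothness of a formula follows from the rules of differentiation,
  whatever \<open>partial i f\<close> is off \<open>V\<close>.\<close>

lemma C_diff_SucI:
  assumes "continuous_on V f" "\<And>i. i < n \<Longrightarrow> \<exists>g. has_partial i V f g \<and> C_diff k n V g"
  shows "C_diff (Suc k) n V f"
proof -
  have "C_diff k n V (partial i f)" if i: "i < n" for i
  proof -
    obtain g where g: "has_partial i V f g" "C_diff k n V g" using assms(2) i by blast
    show ?thesis using C_diff_cong[OF g(2), of "partial i f"] has_partialD[OF g(1)] by simp
  qed
  moreover have "(\<lambda>t. f (x(i := t))) differentiable at (x i)" if "i < n" "x \<in> V" for i x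
    using assms(2)[OF that(1)] that(2) by (auto simp: has_partial_def real_differentiable_def)
  ultimately show ?thesis
    using V_subset assms(1) by (simp add: C_diff.simps(2) continuous_map_Euclidean_subset)
qed

lemma C_diff_coord: "C_diff k n V (\<lambda>x. x j)"
proof (cases k)
  case 0
  have "continuous_on V (\<lambda>x. x j)"
    by (rule continuous_on_subset[OF continuous_on_product_coordinates]) simp
  then show ?thesis using 0 V_subset by (simp add: continuous_map_Euclidean_subset)
next
  case (Suc l)
  have "continuous_on V (\<lambda>x. x j)"
    by (rule continuous_on_subset[OF continuous_on_product_coordinates]) simp
  moreover have "has_partial i V (\<lambda>x. x j) (\<lambda>x. if i = j then 1 else 0)" for i
    by (auto simp: has_partial_def)
  ultimately show ?thesis
    unfolding Suc by (intro C_diff_SucI) (auto intro!: exI C_diff_const)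
qed

lemma C_diff_add:
  assumes "C_diff k n V f" "C_diff k n V g"
  shows "C_diff k n V (\<lambda>x. f x + g x)"
  using assms
proof (induction k arbitrary: f g)
  case 0
  then show ?case
    using V_subset by (simp add: continuous_map_Euclidean_subset continuous_on_add)
next
  case (Suc k)
  note F = C_diff_Suc_partial[OF Suc.prems(1) _ V_subset]
  note G = C_diff_Suc_partial[OF Suc.prems(2) _ V_subset]
  show ?case
  proof (rule C_diff_SucI)
    show "continuous_on V (\<lambda>x. f x + g x)"
      using Suc.prems V_subset by (intro continuous_on_add C_diff_imp_continuous_on)
    fix i assume i: "i < n"
    have "has_partial i V (\<lambda>x. f x + g x) (\<lambda>x. partial i f x + partial i g x)"
      using F(1)[OF i] G(1)[OF i] by (auto simp: has_partial_def intro!: DERIV_add)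
    then show "\<exists>h. has_partial i V (\<lambda>x. f x + g x) h \<and> C_diff k n V h"
      using Suc.IH[OF F(2)[OF i] G(2)[OF i]] by blast
  qed
qed

lemma C_diff_mult:
  assumes "C_diff k n V f" "C_diff k n V g"
  shows "C_diff k n V (\<lambda>x. f x * g x)"
  using assms
proof (induction k arbitrary: f g)
  case 0
  then show ?case
    using V_subset by (simp add: continuous_map_Euclidean_subset continuous_on_mult)
next
  case (Suc k)
  note F = C_diff_Suc_partial[OF Suc.prems(1) _ V_subset]
  note G = C_diff_Suc_partial[OF Suc.prems(2) _ V_subset]
  show ?case
  proof (rule C_diff_SucI)
    show "continuous_on V (\<lambda>x. f x * g x)"
      using Suc.prems V_subset by (intro continuous_on_mult C_diff_imp_continuous_on)
    fix i assume i: "i < n"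
    have "has_partial i V (\<lambda>x. f x * g x) (\<lambda>x. partial i f x * g x + partial i g x * f x)"
      unfolding has_partial_def
    proof
      fix x assume x: "x \<in> V"
      show "((\<lambda>t. f (x(i := t)) * g (x(i := t))) has_real_derivative
          partial i f x * g x + partial i g x * f x) (at (x i))"
        using DERIV_mult[of "\<lambda>t. f (x(i := t))" "partial i f x" "x i" UNIV
            "\<lambda>t. g (x(i := t))" "partial i g x"] F(1)[OF i] G(1)[OF i] x
        by (simp add: has_partial_def)
    qed
    moreover have "C_diff k n V (\<lambda>x. partial i f x * g x + partial i g x * f x)"
      using F(2)[OF i] G(2)[OF i] Suc.prems by (intro C_diff_add Suc.IH) (auto dest: C_diff_mono)
    ultimately show "\<exists>h. has_partial i V (\<lambda>x. f x * g x) h \<and> C_diff k n V h"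
      by blast
  qed
qed

lemma C_diff_uminus: "C_diff k n V f \<Longrightarrow> C_diff k n V (\<lambda>x. - f x)"
  using C_diff_mult[OF C_diff_const[of k n V "- 1"], of f] by simp

lemma C_diff_sum: "(\<And>j. j \<in> J \<Longrightarrow> C_diff k n V (f j)) \<Longrightarrow> C_diff k n V (\<lambda>x. \<Sum>j\<in>J. f j x)"
  by (induction J rule: infinite_finite_induct) (auto intro!: C_diff_const C_diff_add)

lemma C_diff_prod: "(\<And>j. j \<in> J \<Longrightarrow> C_diff k n V (f j)) \<Longrightarrow> C_diff k n V (\<lambda>x. \<Prod>j\<in>J. f j x)"
  by (induction J rule: infinite_finite_induct) (auto intro!: C_diff_const C_diff_mult)

lemma C_diff_subset:
  assumes "C_diff k n V f" "openin (Euclidean_space n) W" "W \<subseteq> V"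
  shows "C_diff k n W f"
  using assms(1)
proof (induction k arbitrary: f)
  case 0
  then have "continuous_on W f"
    using V_subset assms(3) continuous_on_subset continuous_map_Euclidean_subset by auto
  then show ?case
    using V_subset assms(3) by (simp add: continuous_map_Euclidean_subset)
next
  case (Suc k)
  interpret W: Euclidean_open n W by unfold_locales (rule assms(2))
  note F = C_diff_Suc_partial[OF Suc.prems _ V_subset]
  show ?case
  proof (rule W.C_diff_SucI)
    show "continuous_on W f"
      using C_diff_imp_continuous_on[OF Suc.prems V_subset] assms(3) by (rule continuous_on_subset)
    fix i assume i: "i < n"
    show "\<exists>g. has_partial i W f g \<and> C_diff k n W g"
      using F(1)[OF i] Suc.IH[OF F(2)[OF i]] assms(3) by (auto simp: has_partial_def)
  qed
qed

text \<open>Smoothness is local. This serves for sections given by a formula on one open set and by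
  zero on another.\<close>

lemma C_diff_glue:
  assumes "\<And>x. x \<in> V \<Longrightarrow> \<exists>W. openin (Euclidean_space n) W \<and> x \<in> W \<and> W \<subseteq> V \<and> C_diff k n W f"
  shows "C_diff k n V f"
proof -
  have cont: "continuous_on V f"
    if "\<And>x. x \<in> V \<Longrightarrow> \<exists>W. openin (Euclidean_space n) W \<and> x \<in> W \<and> W \<subseteq> V \<and> continuous_on W f" for f :: "(nat \<Rightarrow> real) \<Rightarrow> real"
  proof (rule iffD2[OF continuous_on_eq_continuous_within], rule ballI)
    fix x assume "x \<in> V"
    from that[OF this] obtain W where
      W: "openin (Euclidean_space n) W" "x \<in> W" "W \<subseteq> V" "continuous_on W f" by blast
    obtain U where U: "open U" "W = topspace (Euclidean_space n) \<inter> U"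
      using W(1) by (rule openin_Euclidean_obtain)
    have "at x within W = at x within V"
      by (rule at_within_nhd[of _ U]) (use U W V_subset in auto)
    then show "continuous (at x within V) f"
      using W by (auto simp: continuous_on_eq_continuous_within)
  qed
  show ?thesis
    using assms
  proof (induction k arbitrary: f)
    case 0
    have "continuous_on V f"
    proof (rule cont)
      fix x assume "x \<in> V"
      from 0[OF this] show "\<exists>W. openin (Euclidean_space n) W \<and> x \<in> W \<and> W \<subseteq> V \<and> continuous_on W f"
        using C_diff_imp_continuous_on openin_subset by metis
    qed
    then show ?case using V_subset by (simp add: continuous_map_Euclidean_subset)
  next
    case (Suc k)
    have 1: "continuous_on V f"
    proof (rule cont)
      fix x assume "x \<in> V"
      from Suc.prems[OF this] show "\<exists>W. openin (Euclidean_space n) W \<and> x \<in> W \<and> W \<subseteq> V \<and> continuous_on W f"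
        using C_diff_imp_continuous_on openin_subset by metis
    qed
    have 2: "has_partial i V f (partial i f)" if i: "i < n" for i
      unfolding has_partial_def
    proof
      fix x assume "x \<in> V"
      from Suc.prems[OF this] obtain W where
        W: "openin (Euclidean_space n) W" "x \<in> W" "C_diff (Suc k) n W f" by blast
      show "((\<lambda>t. f (x(i := t))) has_real_derivative partial i f x) (at (x i))"
        using C_diff_Suc_partial(1)[OF W(3) i openin_subset[OF W(1)]] W(2)
        by (auto simp: has_partial_def)
    qed
    have 3: "C_diff k n V (partial i f)" if i: "i < n" for i
    proof (rule Suc.IH)
      fix x assume "x \<in> V"
      from Suc.prems[OF this] obtain W where
        W: "openin (Euclidean_space n) W" "x \<in> W" "W \<subseteq> V" "C_diff (Suc k) n W f" by blast
      then show "\<exists>W. openin (Euclidean_space n) W \<and> x \<in> W \<and> W \<subseteq> V \<and> C_diff k n W (partial i f)"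
        using C_diff_Suc_partial(2)[OF W(4) i openin_subset[OF W(1)]] by blast
    qed
    show ?case using 1 2 3 by (intro C_diff_SucI) auto
  qed
qed

end

section \<open>Mean value theorem, chain rule and composition\<close>

lemma MVT_unordered:
  fixes f f' :: "real \<Rightarrow> real"
  assumes "\<And>s. \<bar>s - a\<bar> \<le> \<bar>b - a\<bar> \<Longrightarrow> (f has_real_derivative f' s) (at s)"
  obtains \<xi> where "\<bar>\<xi> - a\<bar> \<le> \<bar>b - a\<bar>" "f b - f a = (b - a) * f' \<xi>"
proof (cases a b rule: linorder_cases)
  case less
  then obtain z where "a < z" "z < b" "f b - f a = (b - a) * f' z"
    using MVT2[of a b f f'] assms by force
  then show ?thesis using less by (intro that[of z]) auto
next
  case equal
  then show ?thesis by (intro that[of a]) auto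
next
  case greater
  then obtain z where "b < z" "z < a" "f a - f b = (a - b) * f' z"
    using MVT2[of b a f f'] assms by force
  then show ?thesis using greater by (intro that[of z]) (auto simp: algebra_simps)
qed

context Euclidean_open
begin

text \<open>The derivatives at hand are those along the axes, so the way from \<open>a\<close> to
  the moving point is an axis-parallel polygon: \<open>z j t\<close> has the first \<open>j\<close>
  coordinates already replaced. On each leg the mean value theorem and continuity of the partial
  derivative give one summand.\<close>

lemma chain_rule:
  fixes \<gamma> :: "real \<Rightarrow> nat \<Rightarrow> real"
  assumes f: "C_diff (Suc 0) n V f" and a: "\<gamma> t0 \<in> V"
    and in_space: "\<forall>\<^sub>F t in at t0. \<gamma> t \<in> topspace (Euclidean_space n)"
    and \<gamma>: "\<And>j. j < n \<Longrightarrow> ((\<lambda>t. \<gamma> t j) has_real_derivative \<gamma>' j) (at t0)"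
  shows "((\<lambda>t. f (\<gamma> t)) has_real_derivative (\<Sum>j<n. partial j f (\<gamma> t0) * \<gamma>' j)) (at t0)"
proof -
  define a where "a = \<gamma> t0"
  define z where "z j t = (\<lambda>i. if i < j then \<gamma> t i else a i)" for j t
  have aV: "a \<in> V" using a by (simp add: a_def)
  obtain \<delta> where \<delta>: "\<delta> > 0"
    "\<And>x. x \<in> topspace (Euclidean_space n) \<Longrightarrow> (\<And>i. i < n \<Longrightarrow> \<bar>x i - a i\<bar> \<le> \<delta>) \<Longrightarrow> x \<in> V"
    using Euclidean_open_contains_box[OF open_V aV] by metis
  have lim: "((\<lambda>t. \<gamma> t j) \<longlongrightarrow> a j) (at t0)" if "j < n" for j
    using DERIV_isCont[OF \<gamma>[OF that]] by (simp add: isCont_def a_def)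
  have "\<forall>\<^sub>F t in at t0. \<bar>\<gamma> t j - a j\<bar> \<le> \<delta>" if "j < n" for j
    using tendstoD[OF lim[OF that] \<delta>(1)] by (rule eventually_mono) (simp add: dist_real_def)
  then have near: "\<forall>\<^sub>F t in at t0. \<forall>j<n. \<bar>\<gamma> t j - a j\<bar> \<le> \<delta>"
    using eventually_ball_finite[of "{..<n}" "\<lambda>t j. \<bar>\<gamma> t j - a j\<bar> \<le> \<delta>" "at t0"] by (simp add: Ball_def)
  have zSuc: "z (Suc j) t = (z j t)(j := \<gamma> t j)" "z j t = (z j t)(j := a j)" for j t
    by (auto simp: z_def fun_eq_iff less_Suc_eq)
  have step: "((\<lambda>t. f (z (Suc j) t) - f (z j t)) has_real_derivative partial j f a * \<gamma>' j) (at t0)"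
    if j: "j < n" for j
  proof -
    note P = C_diff_Suc_partial[OF f j V_subset]
    define w where "w \<xi> t = (z j t)(j := \<xi> t)" for \<xi> :: "real \<Rightarrow> real" and t
    have inV: "(z j t)(j := s) \<in> V" if "\<forall>i<n. \<bar>\<gamma> t i - a i\<bar> \<le> \<delta>" "\<bar>s - a j\<bar> \<le> \<delta>" for s t
      using V_zero[OF aV] that j by (intro \<delta>(2)) (auto simp: topspace_Euclidean_space z_def \<delta>(1) less_imp_le)
    \<comment> \<open>The implication makes the intermediate point a total function of
      \<open>t\<close>, arbitrary where the curve has left the box.\<close>
    have "\<exists>\<xi>. (\<forall>i<n. \<bar>\<gamma> t i - a i\<bar> \<le> \<delta>) \<longrightarrow> \<bar>\<xi> - a j\<bar> \<le> \<bar>\<gamma> t j - a j\<bar> \<and>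
        f (z (Suc j) t) - f (z j t) = (\<gamma> t j - a j) * partial j f ((z j t)(j := \<xi>))" for t
    proof (cases "\<forall>i<n. \<bar>\<gamma> t i - a i\<bar> \<le> \<delta>")
      case True
      have "((\<lambda>s. f ((z j t)(j := s))) has_real_derivative partial j f ((z j t)(j := s))) (at s)"
        if "\<bar>s - a j\<bar> \<le> \<bar>\<gamma> t j - a j\<bar>" for s
      proof -
        have "\<bar>s - a j\<bar> \<le> \<delta>" using that True j by fastforce
        from bspec[OF P(1)[unfolded has_partial_def] inV[OF True this]] show ?thesis by simp
      qed
      from MVT_unordered[OF this] obtain \<xi> where "\<bar>\<xi> - a j\<bar> \<le> \<bar>\<gamma> t j - a j\<bar>"
        "f ((z j t)(j := \<gamma> t j)) - f ((z j t)(j := a j)) = (\<gamma> t j - a j) * partial j f ((z j t)(j := \<xi>))"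
        by blast
      then show ?thesis using zSuc by metis
    qed auto
    then obtain \<xi> where \<xi>: "\<And>t. \<forall>i<n. \<bar>\<gamma> t i - a i\<bar> \<le> \<delta> \<Longrightarrow> \<bar>\<xi> t - a j\<bar> \<le> \<bar>\<gamma> t j - a j\<bar>"
      "\<And>t. \<forall>i<n. \<bar>\<gamma> t i - a i\<bar> \<le> \<delta> \<Longrightarrow>
        f (z (Suc j) t) - f (z j t) = (\<gamma> t j - a j) * partial j f ((z j t)(j := \<xi> t))"
      by metis
    have \<xi>lim: "(\<xi> \<longlongrightarrow> a j) (at t0)"
    proof (rule LIM_zero_cancel, rule Lim_null_comparison)
      show "\<forall>\<^sub>F t in at t0. norm (\<xi> t - a j) \<le> \<bar>\<gamma> t j - a j\<bar>"
        using near by (rule eventually_mono) (use \<xi>(1) in auto)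
      show "((\<lambda>t. \<bar>\<gamma> t j - a j\<bar>) \<longlongrightarrow> 0) (at t0)"
        using lim[OF j] by (intro tendsto_rabs_zero LIM_zero)
    qed
    have wlim: "(w \<xi> \<longlongrightarrow> a) (at t0)"
    proof (rule tendsto_fun_componentwise)
      fix i show "((\<lambda>t. w \<xi> t i) \<longlongrightarrow> a i) (at t0)"
        using lim[of i] \<xi>lim j by (cases "i = j"; cases "i < j") (auto simp: w_def z_def)
    qed
    have "((\<lambda>t. partial j f (w \<xi> t)) \<longlongrightarrow> partial j f a) (at t0)"
    proof (rule continuous_on_tendsto_compose[OF _ wlim aV])
      show "continuous_on V (partial j f)" by (rule C_diff_imp_continuous_on[OF P(2) V_subset])
      show "\<forall>\<^sub>F t in at t0. w \<xi> t \<in> V"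
        using near
      proof (rule eventually_mono)
        fix t assume t: "\<forall>i<n. \<bar>\<gamma> t i - a i\<bar> \<le> \<delta>"
        then have "\<bar>\<xi> t - a j\<bar> \<le> \<delta>" using \<xi>(1)[OF t] j by force
        then show "w \<xi> t \<in> V" unfolding w_def by (rule inV[OF t])
      qed
    qed
    moreover have "((\<lambda>t. (\<gamma> t j - a j) / (t - t0)) \<longlongrightarrow> \<gamma>' j) (at t0)"
      using \<gamma>[OF j] by (simp add: has_field_derivative_iff a_def)
    ultimately have "((\<lambda>t. partial j f (w \<xi> t) * ((\<gamma> t j - a j) / (t - t0))) \<longlongrightarrow>
        partial j f a * \<gamma>' j) (at t0)"
      by (rule tendsto_mult)
    moreover have "\<forall>\<^sub>F t in at t0. partial j f (w \<xi> t) * ((\<gamma> t j - a j) / (t - t0)) =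
        ((f (z (Suc j) t) - f (z j t)) - (f (z (Suc j) t0) - f (z j t0))) / (t - t0)"
      using near by (rule eventually_mono) (use \<xi>(2) in \<open>auto simp: w_def z_def a_def if_distrib cong: if_cong\<close>)
    ultimately show ?thesis
      unfolding has_field_derivative_iff by (rule Lim_transform_eventually)
  qed
  have "((\<lambda>t. f (z j t)) has_real_derivative (\<Sum>i<j. partial i f a * \<gamma>' i)) (at t0)" if "j \<le> n" for j
    using that
  proof (induction j)
    case (Suc j)
    have "((\<lambda>t. f (z j t) + (f (z (Suc j) t) - f (z j t))) has_real_derivative
       (\<Sum>i<j. partial i f a * \<gamma>' i) + partial j f a * \<gamma>' j) (at t0)"
      using Suc by (intro DERIV_add step) auto
    then show ?case by simp
  qed (simp add: z_def)
  from this[of n] have "((\<lambda>t. f (z n t)) has_real_derivative (\<Sum>i<n. partial i f a * \<gamma>' i)) (at t0)"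
    by simp
  \<comment> \<open>Coordinates from \<open>n\<close> on vanish both in \<open>a\<close> and along
    the curve, so the last corner of the polygon is the point of the curve itself.\<close>
  moreover have "\<forall>\<^sub>F t in nhds t0. f (z n t) = f (\<gamma> t)"
  proof -
    have "\<gamma> t0 \<in> topspace (Euclidean_space n)" using a V_subset by auto
    then have "\<forall>\<^sub>F t in nhds t0. \<gamma> t \<in> topspace (Euclidean_space n)"
      using in_space by (simp add: eventually_nhds_conv_at)
    then show ?thesis
    proof (rule eventually_mono)
      fix t assume t: "\<gamma> t \<in> topspace (Euclidean_space n)"
      have "z n t = \<gamma> t"
        using t V_zero[OF aV] by (auto simp: z_def topspace_Euclidean_space fun_eq_iff)
      then show "f (z n t) = f (\<gamma> t)" by simp
    qed
  qed
  ultimately show ?thesis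
    using DERIV_cong_ev[OF refl _ refl, of "\<lambda>t. f (z n t)" "\<lambda>t. f (\<gamma> t)" t0]
    unfolding a_def by blast
qed

text \<open>The chain rule expresses a partial derivative through composites of the partial
  derivatives of \<open>f\<close> with the same \<open>G\<close>. The induction therefore varies
  \<open>f\<close> and keeps \<open>G\<close>.\<close>

lemma C_diff_compose:
  assumes W: "openin (Euclidean_space n) W"
    and f: "C_diff k n V f" and G: "\<And>y. y \<in> W \<Longrightarrow> G y \<in> V"
    and Gk: "\<And>j. j < n \<Longrightarrow> C_diff k n W (\<lambda>y. G y j)"
  shows "C_diff k n W (\<lambda>y. f (G y))"
proof -
  interpret W: Euclidean_open n W by unfold_locales (rule W)
  have contG: "continuous_on W G" if "\<And>j. j < n \<Longrightarrow> C_diff k n W (\<lambda>y. G y j)" for k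
  proof (rule continuous_on_coordinatewise_then_product)
    fix j show "continuous_on W (\<lambda>y. G y j)"
    proof (cases "j < n")
      case True then show ?thesis using C_diff_imp_continuous_on[OF that W.V_subset] by blast
    next
      case False
      then have "G y j = 0" if "y \<in> W" for y using V_zero[OF G[OF that]] by simp
      then show ?thesis by (simp cong: continuous_on_cong)
    qed
  qed
  have cont: "continuous_on W (\<lambda>y. f (G y))"
    if "C_diff k n V f" "\<And>j. j < n \<Longrightarrow> C_diff k n W (\<lambda>y. G y j)" for k f
    by (rule continuous_on_compose2[OF C_diff_imp_continuous_on[OF that(1) V_subset] contG[OF that(2)]])
       (use G in auto)
  show ?thesis
    using f Gk
  proof (induction k arbitrary: f)
    case 0
    then show ?case
      using cont[OF 0] W.V_subset by (simp add: continuous_map_Euclidean_subset)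
  next
    case (Suc k)
    note F = C_diff_Suc_partial[OF Suc.prems(1) _ V_subset]
    note GG = C_diff_Suc_partial[OF Suc.prems(2) _ W.V_subset]
    show ?case
    proof (rule W.C_diff_SucI)
      show "continuous_on W (\<lambda>y. f (G y))" by (rule cont[OF Suc.prems])
      fix i assume i: "i < n"
      let ?h = "\<lambda>y. \<Sum>j<n. partial j f (G y) * partial i (\<lambda>y. G y j) y"
      have "has_partial i W (\<lambda>y. f (G y)) ?h"
        unfolding has_partial_def
      proof
        fix y assume y: "y \<in> W"
        have "\<forall>\<^sub>F t in nhds (y i). G (y(i := t)) \<in> topspace (Euclidean_space n)"
          using eventually_fun_upd_in_open[OF W y i] by (rule eventually_mono) (use G V_subset in auto)
        then have "\<forall>\<^sub>F t in at (y i). G (y(i := t)) \<in> topspace (Euclidean_space n)"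
          by (auto simp: eventually_nhds_conv_at)
        moreover have "((\<lambda>t. G (y(i := t)) j) has_real_derivative partial i (\<lambda>y. G y j) y) (at (y i))"
          if "j < n" for j using GG(1)[OF that i] y by (simp add: has_partial_def)
        moreover have "C_diff (Suc 0) n V f" using Suc.prems(1) by (rule C_diff_le) simp
        ultimately show "((\<lambda>t. f (G (y(i := t)))) has_real_derivative ?h y) (at (y i))"
          using chain_rule[of f "\<lambda>t. G (y(i := t))" "y i"] G[OF y] by simp
      qed
      moreover have "C_diff k n W ?h"
      proof (intro W.C_diff_sum W.C_diff_mult)
        fix j assume "j \<in> {..<n}"
        then have j: "j < n" by simp
        show "C_diff k n W (\<lambda>y. partial j f (G y))"
          using Suc.IH[OF F(2)[OF j]] Suc.prems(2) by (auto dest: C_diff_mono)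
        show "C_diff k n W (partial i (\<lambda>y. G y j))" by (rule GG(2)[OF j i])
      qed
      ultimately show "\<exists>g. has_partial i W (\<lambda>y. f (G y)) g \<and> C_diff k n W g" by blast
    qed
  qed
qed

section \<open>Symmetry of second partial derivatives\<close>

lemma second_difference:
  assumes f: "C_diff (Suc (Suc 0)) n V f" and ij: "i < n" "j < n" "i \<noteq> j" and h: "h > 0"
    and box: "\<And>s t. \<bar>s - x i\<bar> \<le> h \<Longrightarrow> \<bar>t - x j\<bar> \<le> h \<Longrightarrow> x(i := s, j := t) \<in> V"
  obtains s t where "\<bar>s - x i\<bar> \<le> h" "\<bar>t - x j\<bar> \<le> h"
    "f (x(i := x i + h, j := x j + h)) - f (x(i := x i + h)) - f (x(j := x j + h)) + f x =
      h * h * partial j (partial i f) (x(i := s, j := t))"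
proof -
  note P = C_diff_Suc_partial[OF f ij(1) V_subset]
  note PP = C_diff_Suc_partial(1)[OF P(2) ij(2) V_subset]
  \<comment> \<open>The increment in direction \<open>j\<close>, as a function of coordinate
    \<open>i\<close>. The mean value theorem is applied to it in direction \<open>i\<close>, and
    then to \<open>partial i f\<close> in direction \<open>j\<close>; the second difference is
    symmetric in the two directions, the mixed derivative so obtained is not visibly so.\<close>
  define g where "g s = f (x(i := s, j := x j + h)) - f (x(i := s, j := x j))" for s
  have Di: "((\<lambda>s. f (x(i := s, j := t))) has_real_derivative partial i f (x(i := s, j := t))) (at s)"
    if "\<bar>s - x i\<bar> \<le> h" "\<bar>t - x j\<bar> \<le> h" for s t
    using bspec[OF P(1)[unfolded has_partial_def] box[OF that]] ij(3)
    by (simp add: fun_upd_twist[of i j])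
  have Dj: "((\<lambda>t. partial i f (x(i := s, j := t))) has_real_derivative
      partial j (partial i f) (x(i := s, j := t))) (at t)"
    if "\<bar>s - x i\<bar> \<le> h" "\<bar>t - x j\<bar> \<le> h" for s t
    using bspec[OF PP[unfolded has_partial_def] box[OF that]] by simp
  have "(g has_real_derivative partial i f (x(i := s, j := x j + h)) - partial i f (x(i := s, j := x j))) (at s)"
    if "\<bar>s - x i\<bar> \<le> \<bar>(x i + h) - x i\<bar>" for s
    unfolding g_def using that h by (intro DERIV_diff Di) auto
  from MVT_unordered[of "x i" "x i + h" g, OF this] obtain s where s: "\<bar>s - x i\<bar> \<le> h"
    "g (x i + h) - g (x i) = h * (partial i f (x(i := s, j := x j + h)) - partial i f (x(i := s, j := x j)))"
    using h by (metis abs_of_pos add_diff_cancel_left')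
  have "((\<lambda>t. partial i f (x(i := s, j := t))) has_real_derivative
      partial j (partial i f) (x(i := s, j := t))) (at t)" if "\<bar>t - x j\<bar> \<le> \<bar>(x j + h) - x j\<bar>" for t
    using that h s by (intro Dj) auto
  from MVT_unordered[of "x j" "x j + h" "\<lambda>t. partial i f (x(i := s, j := t))", OF this] obtain t where t: "\<bar>t - x j\<bar> \<le> h"
    "partial i f (x(i := s, j := x j + h)) - partial i f (x(i := s, j := x j)) =
      h * partial j (partial i f) (x(i := s, j := t))"
    using h by (metis abs_of_pos add_diff_cancel_left')
  have "f (x(i := x i + h, j := x j + h)) - f (x(i := x i + h)) - f (x(j := x j + h)) + f x
      = g (x i + h) - g (x i)"
    using ij by (simp add: g_def fun_upd_idem)
  then show ?thesis using s t by (intro that[of s t]) auto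
qed

text \<open>The same second difference equals h^2 times a mixed derivative in either order, taken at
  two points within distance h of \<open>x\<close> in each coordinate. Division by h^2 and
  continuity as h tends to 0 from the right identify the two values.\<close>

lemma partial_commute:
  assumes f: "C_diff (Suc (Suc 0)) n V f" and ij: "i < n" "j < n" and x: "x \<in> V"
  shows "partial i (partial j f) x = partial j (partial i f) x"
proof (cases "i = j")
  case False
  obtain \<delta> where \<delta>: "\<delta> > 0"
    "\<And>y. y \<in> topspace (Euclidean_space n) \<Longrightarrow> (\<And>k. k < n \<Longrightarrow> \<bar>y k - x k\<bar> \<le> \<delta>) \<Longrightarrow> y \<in> V"
    using Euclidean_open_contains_box[OF open_V x] by metis
  have box: "x(i := s, j := t) \<in> V" if "\<bar>s - x i\<bar> \<le> \<delta>" "\<bar>t - x j\<bar> \<le> \<delta>" for s t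
    using V_zero[OF x] that ij \<delta>(1) by (intro \<delta>(2)) (auto simp: topspace_Euclidean_space)
  \<comment> \<open>The indices are bound afresh, since the claim is used for both orders of
    differentiation.\<close>
  have "\<exists>p. \<forall>h. 0 < h \<and> h \<le> \<delta> \<longrightarrow> (\<forall>k. \<bar>p h k - x k\<bar> \<le> h) \<and> p h \<in> V \<and>
      f (x(i := x i + h, j := x j + h)) - f (x(i := x i + h)) - f (x(j := x j + h)) + f x =
      h * h * partial j (partial i f) (p h)"
    if ij: "i < n" "j < n" "i \<noteq> j"
      and box: "\<And>s t. \<bar>s - x i\<bar> \<le> \<delta> \<Longrightarrow> \<bar>t - x j\<bar> \<le> \<delta> \<Longrightarrow> x(i := s, j := t) \<in> V" for i j
  proof (rule choice, intro allI)
    fix h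
    show "\<exists>p. 0 < h \<and> h \<le> \<delta> \<longrightarrow> (\<forall>k. \<bar>p k - x k\<bar> \<le> h) \<and> p \<in> V \<and>
      f (x(i := x i + h, j := x j + h)) - f (x(i := x i + h)) - f (x(j := x j + h)) + f x =
      h * h * partial j (partial i f) p"
    proof (cases "0 < h \<and> h \<le> \<delta>")
      case True
      then have "x(i := s, j := t) \<in> V" if "\<bar>s - x i\<bar> \<le> h" "\<bar>t - x j\<bar> \<le> h" for s t
        using that by (intro box) auto
      from second_difference[OF f ij _ this, of h] True obtain s t where
        "\<bar>s - x i\<bar> \<le> h" "\<bar>t - x j\<bar> \<le> h"
        "f (x(i := x i + h, j := x j + h)) - f (x(i := x i + h)) - f (x(j := x j + h)) + f x =
          h * h * partial j (partial i f) (x(i := s, j := t))" by blast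
      then show ?thesis using True by (intro exI[of _ "x(i := s, j := t)"]) (auto intro: box)
    qed auto
  qed
  note ex = this
  from ex[OF ij False box] obtain p where p: "\<And>h. 0 < h \<Longrightarrow> h \<le> \<delta> \<Longrightarrow> (\<forall>k. \<bar>p h k - x k\<bar> \<le> h) \<and> p h \<in> V \<and>
      f (x(i := x i + h, j := x j + h)) - f (x(i := x i + h)) - f (x(j := x j + h)) + f x =
      h * h * partial j (partial i f) (p h)"
    by auto
  have box': "x(j := s, i := t) \<in> V" if "\<bar>s - x j\<bar> \<le> \<delta>" "\<bar>t - x i\<bar> \<le> \<delta>" for s t
    using box[OF that(2,1)] False by (simp add: fun_upd_twist)
  from ex[OF ij(2,1) False[symmetric] box'] obtain q where q: "\<And>h. 0 < h \<Longrightarrow> h \<le> \<delta> \<Longrightarrow> (\<forall>k. \<bar>q h k - x k\<bar> \<le> h) \<and> q h \<in> V \<and>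
      f (x(j := x j + h, i := x i + h)) - f (x(j := x j + h)) - f (x(i := x i + h)) + f x =
      h * h * partial i (partial j f) (q h)"
    by auto
  have small: "\<forall>\<^sub>F h in at_right (0::real). 0 < h \<and> h \<le> \<delta>"
    using \<delta>(1) by (auto simp: eventually_at_right_field intro!: exI[of _ \<delta>])
  have lim: "((\<lambda>h. g (p h)) \<longlongrightarrow> g x) (at_right 0)"
    if "continuous_on V g" "\<And>h. 0 < h \<Longrightarrow> h \<le> \<delta> \<Longrightarrow> (\<forall>k. \<bar>p h k - x k\<bar> \<le> h) \<and> p h \<in> V"
    for g :: "(nat \<Rightarrow> real) \<Rightarrow> real" and p
  proof (rule continuous_on_tendsto_compose[OF that(1) _ x])
    show "\<forall>\<^sub>F h in at_right 0. p h \<in> V"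
      using small by (rule eventually_mono) (use that(2) in auto)
    show "(p \<longlongrightarrow> x) (at_right 0)"
    proof (rule tendsto_fun_componentwise)
      fix k
      show "((\<lambda>h. p h k) \<longlongrightarrow> x k) (at_right 0)"
      proof (rule LIM_zero_cancel, rule Lim_null_comparison)
        show "\<forall>\<^sub>F h in at_right 0. norm (p h k - x k) \<le> h"
          using small by (rule eventually_mono) (use that(2) in auto)
      qed (auto intro: tendsto_ident_at)
    qed
  qed
  have eq: "partial j (partial i f) (p h) = partial i (partial j f) (q h)" if "0 < h" "h \<le> \<delta>" for h
  proof -
    have "x(i := x i + h, j := x j + h) = x(j := x j + h, i := x i + h)"
      using False by (simp add: fun_upd_twist)
    then have "f (x(i := x i + h, j := x j + h)) = f (x(j := x j + h, i := x i + h))"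
      by (rule arg_cong)
    then have "h * h * partial j (partial i f) (p h) = h * h * partial i (partial j f) (q h)"
      using conjunct2[OF conjunct2[OF p[OF that]]] conjunct2[OF conjunct2[OF q[OF that]]] by linarith
    then show ?thesis using that by simp
  qed
  have c: "continuous_on V (partial a (partial b f))" if "a < n" "b < n" for a b
    using C_diff_imp_continuous_on[OF _ V_subset]
      C_diff_Suc_partial(2)[OF C_diff_Suc_partial(2)[OF f that(2) V_subset] that(1) V_subset] by blast
  have "((\<lambda>h. partial j (partial i f) (p h)) \<longlongrightarrow> partial j (partial i f) x) (at_right 0)"
    using c ij p by (intro lim) auto
  moreover have "((\<lambda>h. partial i (partial j f) (q h)) \<longlongrightarrow> partial i (partial j f) x) (at_right 0)"
    using c ij q by (intro lim) auto
  then have "((\<lambda>h. partial j (partial i f) (p h)) \<longlongrightarrow> partial i (partial j f) x) (at_right 0)"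
    by (rule Lim_transform_eventually) (use small in \<open>rule eventually_mono, simp add: eq\<close>)
  ultimately show ?thesis
    using tendsto_unique trivial_limit_at_right_real by blast
qed simp

end

text \<open>The classical exp(- 1 / t), continued by zero. The polynomial factor makes the family
  closed under differentiation, so that smoothness is an induction over the whole family.\<close>

definition flat :: "real poly \<Rightarrow> real \<Rightarrow> real" where
  "flat p t = (if t > 0 then poly p (1 / t) * exp (- (1 / t)) else 0)"

lemma flat_tendsto_0: "(flat q \<longlongrightarrow> 0) (at 0)"
proof -
  have "((\<lambda>u. \<Sum>i\<le>degree q. Polynomial.coeff q i * (u ^ i / exp u)) \<longlongrightarrow>
      (\<Sum>i\<le>degree q. Polynomial.coeff q i * 0)) (at_top :: real filter)"
    by (intro tendsto_sum tendsto_mult tendsto_const tendsto_power_div_exp_0)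
  then have "((\<lambda>u. poly q u * exp (- u)) \<longlongrightarrow> 0) at_top"
    by (simp add: poly_altdef sum_distrib_right exp_minus divide_inverse mult.assoc)
  then have "((\<lambda>t. poly q (inverse t) * exp (- inverse t)) \<longlongrightarrow> 0) (at_right 0)"
    using filterlim_inverse_at_top_right by (rule filterlim_compose)
  moreover have "\<forall>\<^sub>F t in at_right (0::real). poly q (inverse t) * exp (- inverse t) = flat q t"
    using eventually_at_right_less[of 0]
    by (rule eventually_mono) (simp add: flat_def divide_inverse)
  ultimately have "(flat q \<longlongrightarrow> 0) (at_right 0)"
    by (rule Lim_transform_eventually)
  moreover have "\<forall>\<^sub>F t in at_left (0::real). 0 = flat q t"
    by (auto simp: flat_def eventually_at_filter)
  then have "(flat q \<longlongrightarrow> 0) (at_left 0)"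
    by (rule Lim_transform_eventually[OF tendsto_const])
  ultimately show ?thesis
    by (simp add: filterlim_split_at)
qed

text \<open>With u = 1 / t the derivative by t is - u^2 times the derivative by u, which turns p(u)
  exp(- u) into u^2 (p(u) - p'(u)) exp(- u).\<close>

lemma DERIV_flat: "(flat p has_real_derivative flat ([:0, 0, 1:] * (p - pderiv p)) t) (at t)"
proof (cases t "0 :: real" rule: linorder_cases)
  case less
  have "\<forall>\<^sub>F s in nhds t. flat p s = 0"
    using eventually_nhds_in_open[OF open_lessThan[of 0], of t] less
    by (auto elim!: eventually_mono simp: flat_def)
  then show ?thesis
    using DERIV_cong_ev[OF refl, of "flat p" "\<lambda>_. 0" t 0 0] less by (simp add: flat_def)
next
  case equal
  \<comment> \<open>The difference quotient at 0 is again a member of the family, with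
    \<open>p\<close> multiplied by the variable 1 / t, and so tends to 0.\<close>
  have "(\<lambda>h. (flat p h - flat p 0) / (h - 0)) = flat ([:0, 1:] * p)"
    by (auto simp: flat_def fun_eq_iff)
  then show ?thesis
    using flat_tendsto_0[of "[:0, 1:] * p"] equal by (simp add: has_field_derivative_iff flat_def)
next
  case greater
  have "\<forall>\<^sub>F s in nhds t. flat p s = poly p (1 / s) * exp (- (1 / s))"
    using eventually_nhds_in_open[OF open_greaterThan[of 0], of t] greater
    by (auto elim!: eventually_mono simp: flat_def)
  moreover have "((\<lambda>s. poly p (1 / s) * exp (- (1 / s))) has_real_derivative
      flat ([:0, 0, 1:] * (p - pderiv p)) t) (at t)"
    using greater
    by (auto intro!: derivative_eq_intros DERIV_chain2[where f = "poly p"] poly_DERIV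
        simp: flat_def field_simps power2_eq_square)
  ultimately show ?thesis
    using DERIV_cong_ev[OF refl _ refl, of "flat p" "\<lambda>s. poly p (1 / s) * exp (- (1 / s))" t] by blast
qed

lemma (in Euclidean_open) C_diff_flat:
  assumes "C_diff k n V g" shows "C_diff k n V (\<lambda>x. flat p (g x))"
  using assms
proof (induction k arbitrary: p)
  have cont: "continuous_on V (\<lambda>x. flat p (g x))" if "C_diff k n V g" for p k
  proof (rule continuous_on_compose2[OF _ C_diff_imp_continuous_on[OF that V_subset]])
    show "continuous_on UNIV (flat p)"
      using DERIV_flat by (auto intro!: continuous_at_imp_continuous_on DERIV_isCont)
  qed auto
  {
    case 0
    then show ?case using cont[OF 0] V_subset by (simp add: continuous_map_Euclidean_subset)
  next
    case (Suc k)
    note G = C_diff_Suc_partial[OF Suc.prems _ V_subset]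
    show ?case
    proof (rule C_diff_SucI[OF cont[OF Suc.prems]])
      fix i assume i: "i < n"
      let ?h = "\<lambda>x. flat ([:0, 0, 1:] * (p - pderiv p)) (g x) * partial i g x"
      have "has_partial i V (\<lambda>x. flat p (g x)) ?h"
        unfolding has_partial_def
      proof
        fix x assume "x \<in> V"
        then have "((\<lambda>t. g (x(i := t))) has_real_derivative partial i g x) (at (x i))"
          using G(1)[OF i] by (simp add: has_partial_def)
        from DERIV_chain2[OF DERIV_flat this, of p]
        show "((\<lambda>t. flat p (g (x(i := t)))) has_real_derivative ?h x) (at (x i))"
          by simp
      qed
      moreover have "C_diff k n V ?h"
        using Suc G(2)[OF i] by (intro C_diff_mult) (auto dest: C_diff_mono)
      ultimately show "\<exists>h. has_partial i V (\<lambda>x. flat p (g x)) h \<and> C_diff k n V h" by blast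
    qed
  }
qed

section \<open>Derivations of graded polynomials\<close>

text \<open>Derivatives and the parity involution all send a monomial to a multiple of a monomial.
  In this common form additivity, composition and commutation with base derivatives are proved
  once.\<close>

definition mono_map :: "(mono \<Rightarrow> mono) \<Rightarrow> (mono \<Rightarrow> real) \<Rightarrow> gpoly \<Rightarrow> gpoly" where
  "mono_map \<phi> w F = (\<Sum>a\<in>supp F. gmono (\<phi> a) (w a * coeff F a))"

lemma mono_map_superset:
  "finite A \<Longrightarrow> supp F \<subseteq> A \<Longrightarrow> mono_map \<phi> w F = (\<Sum>a\<in>A. gmono (\<phi> a) (w a * coeff F a))"
  unfolding mono_map_def by (rule sum.mono_neutral_left) (auto simp: supp_def)

lemma coeff_mono_map:
  assumes "finite A" "supp F \<subseteq> A"
  shows "coeff (mono_map \<phi> w F) b = (\<Sum>a\<in>A. if \<phi> a = b then w a * coeff F a else 0)"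
  by (simp add: mono_map_superset[OF assms] coeff_gmono)

lemma mono_map_nonzero:
  assumes "coeff (mono_map \<phi> w F) b \<noteq> 0"
  obtains a where "coeff F a \<noteq> 0" "\<phi> a = b" "w a \<noteq> 0"
proof -
  from assms have "(\<Sum>a\<in>supp F. if \<phi> a = b then w a * coeff F a else 0) \<noteq> 0"
    by (simp add: coeff_mono_map[OF finite_supp order_refl])
  then obtain a where "a \<in> supp F" "(if \<phi> a = b then w a * coeff F a else 0) \<noteq> 0"
    by (rule sum.not_neutral_contains_not_neutral)
  then show thesis using that[of a] by (auto split: if_splits)
qed

lemma mono_map_gmono: "mono_map \<phi> w (gmono a x) = gmono (\<phi> a) (w a * x)"
  by (subst mono_map_superset[of "{a}"]) (auto simp: supp_def coeff_gmono split: if_splits)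

lemma additive_mono_map: "Modules.additive (mono_map \<phi> w)"
proof
  fix F G
  let ?A = "supp F \<union> supp G \<union> supp (F + G)"
  have sub: "supp F \<subseteq> ?A" "supp G \<subseteq> ?A" "supp (F + G) \<subseteq> ?A" by auto
  have fin: "finite ?A" by simp
  show "mono_map \<phi> w (F + G) = mono_map \<phi> w F + mono_map \<phi> w G"
    unfolding mono_map_superset[OF fin sub(1)] mono_map_superset[OF fin sub(2)]
      mono_map_superset[OF fin sub(3)]
    by (simp add: distrib_left gmono_add sum.distrib)
qed

lemmas mono_map_add = Modules.additive.add[OF additive_mono_map]
  and mono_map_sum = Modules.additive.sum[OF additive_mono_map]
  and mono_map_zero [simp] = Modules.additive.zero[OF additive_mono_map]

lemma mono_map_scaleR: "mono_map \<phi> w (r *\<^sub>R F) = r *\<^sub>R mono_map \<phi> w F"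
proof -
  have "supp (r *\<^sub>R F) \<subseteq> supp F" by (auto simp: supp_def)
  from mono_map_superset[OF finite_supp this] show ?thesis
    by (simp add: mono_map_def scaleR_sum_right scaleR_gmono mult.left_commute)
qed

lemma additive_gpoly_eqI:
  assumes "Modules.additive L" "Modules.additive M" "\<And>a x. L (gmono a x) = M (gmono a x)"
  shows "L F = (M F :: gpoly)"
proof -
  have F: "F = (\<Sum>a\<in>supp F. gmono a (coeff F a))"
    by (rule gpoly_expand) auto
  show ?thesis
    by (subst (1 2) F) (simp only: Modules.additive.sum[OF assms(1)] Modules.additive.sum[OF assms(2)] assms(3))
qed

text \<open>The sign of moving the factor \<open>s\<close> to the front, written as a shuffle sign
  so that all sign rules reduce to the cocycle identity \<open>shuffle_sign_assoc\<close>.\<close>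

definition odd_sign :: "nat \<Rightarrow> nat fset \<Rightarrow> real" where
  "odd_sign s S = (if s |\<in>| S then shuffle_sign {|s|} (S |-| {|s|}) else 0)"

definition grade_sign :: "mono \<Rightarrow> real" where
  "grade_sign a = (- 1) ^ fcard (snd a)"

text \<open>The parity involution. In the graded Leibniz rule it replaces a sign depending on the
  parity of the first factor, so that the rule holds for inhomogeneous factors as well.\<close>

abbreviation grade_inv :: "gpoly \<Rightarrow> gpoly" where
  "grade_inv \<equiv> mono_map (\<lambda>a. a) grade_sign"

lemma p_deriv_mono_map:
  "p_deriv i = mono_map (\<lambda>a. (fst a - {#i#}, snd a)) (\<lambda>a. real (count (fst a) i))"
  by (simp add: p_deriv_def mono_map_def fun_eq_iff)

lemma left_deriv_mono_map:
  "left_deriv s = mono_map (\<lambda>a. (fst a, snd a |-| {|s|})) (\<lambda>a. odd_sign s (snd a))"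
proof
  fix F
  have "odd_sign s S = (- 1) ^ card {t. t |\<in>| S \<and> t < s}" if "s |\<in>| S" for S
  proof -
    have "{(a, b). a |\<in>| {|s|} \<and> b |\<in>| S |-| {|s|} \<and> b < a} = Pair s ` {t. t |\<in>| S \<and> t < s}"
      by auto
    then show ?thesis
      using that by (auto simp: odd_sign_def shuffle_sign_def card_image inj_on_def)
  qed
  then show "left_deriv s F = mono_map (\<lambda>a. (fst a, snd a |-| {|s|})) (\<lambda>a. odd_sign s (snd a)) F"
    unfolding left_deriv_def mono_map_def
    by (intro sum.mono_neutral_cong_left) (auto simp: odd_sign_def)
qed

lemma fcard_singleton [simp]: "fcard {|s|} = 1"
  by (simp add: fcard.rep_eq)

text \<open>For disjoint sets each pair of elements is an inversion in exactly one of the two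
  orders, so the two inversion numbers add up to the product of the cardinalities.\<close>

lemma shuffle_sign_swap: "shuffle_sign S T = (- 1) ^ (fcard S * fcard T) * shuffle_sign T S"
proof (cases "S |\<inter>| T = {||}")
  case True
  let ?X = "{(a, b). a |\<in>| S \<and> b |\<in>| T \<and> b < a}" and ?Y = "{(a, b). a |\<in>| T \<and> b |\<in>| S \<and> b < a}"
  have fin: "finite ?X" "finite ?Y"
    by (rule finite_subset[of _ "fset S \<times> fset T"], auto)
      (rule finite_subset[of _ "fset T \<times> fset S"], auto)
  have "fset S \<times> fset T = ?X \<union> prod.swap ` ?Y"
  proof -
    have "a \<noteq> b" if "a |\<in>| S" "b |\<in>| T" for a b
      using True that by auto
    then show ?thesis by (force simp: image_iff linorder_neq_iff)
  qed
  moreover have "?X \<inter> prod.swap ` ?Y = {}" by auto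
  ultimately have "fcard S * fcard T = card ?X + card ?Y"
    using fin card_Un_disjoint[of ?X "prod.swap ` ?Y"]
    by (simp add: fcard.rep_eq card_cartesian_product[symmetric] card_image)
  then show ?thesis
    using True by (simp add: shuffle_sign_def power_add inf_commute flip: power_mult_distrib mult.assoc)
qed (simp add: shuffle_sign_def inf_commute)

lemma shuffle_sign_idem [simp]: "S |\<inter>| T = {||} \<Longrightarrow> shuffle_sign S T * shuffle_sign S T = 1"
  by (simp add: shuffle_sign_def flip: power_mult_distrib)

text \<open>Taking the factor out on the right instead of the left costs one sign for each remaining
  factor. There is one factor fewer than in the monomial, hence the minus sign before
  \<open>grade_sign\<close>.\<close>

lemma right_deriv_mono_map:
  "right_deriv s = mono_map (\<lambda>a. (fst a, snd a |-| {|s|})) (\<lambda>a. - grade_sign a * odd_sign s (snd a))"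
proof
  fix F
  have "- grade_sign a * odd_sign s (snd a) = (- 1) ^ card {t. t |\<in>| snd a \<and> s < t}"
    if s: "s |\<in>| snd a" for a
  proof -
    have "{(a, b). a |\<in>| S |-| {|s|} \<and> b |\<in>| {|s|} \<and> b < a} = (\<lambda>t. (t, s)) ` {t. t |\<in>| S \<and> s < t}" for S
      by auto
    then have 1: "shuffle_sign (snd a |-| {|s|}) {|s|} = (- 1) ^ card {t. t |\<in>| snd a \<and> s < t}"
      by (auto simp: shuffle_sign_def card_image inj_on_def)
    have "snd a = finsert s (snd a |-| {|s|})" using s by auto
    then have "fcard (snd a) = Suc (fcard (snd a |-| {|s|}))"
      by (metis fcard_finsert_disjoint fminus_iff finsertI1)
    then have "- grade_sign a = (- 1) ^ fcard (snd a |-| {|s|})"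
      by (simp add: grade_sign_def)
    then show ?thesis
      using s shuffle_sign_swap[of "snd a |-| {|s|}" "{|s|}"] by (simp add: odd_sign_def 1)
  qed
  then show "right_deriv s F =
      mono_map (\<lambda>a. (fst a, snd a |-| {|s|})) (\<lambda>a. - grade_sign a * odd_sign s (snd a)) F"
    unfolding right_deriv_def mono_map_def
    by (intro sum.mono_neutral_cong_left) (auto simp: odd_sign_def)
qed

text \<open>The sign part of the Leibniz rule, according to which of the two monomials contains
  \<open>s\<close>. Each case is the cocycle identity with the singleton of \<open>s\<close> split
  off; if both contain \<open>s\<close>, the product is zero and the two Leibniz terms
  cancel.\<close>

lemma odd_sign_mult:
  shows "s |\<in>| S \<Longrightarrow> s |\<notin>| T \<Longrightarrow>
      odd_sign s (S |\<union>| T) * shuffle_sign S T = shuffle_sign (S |-| {|s|}) T * odd_sign s S"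
    and "s |\<notin>| S \<Longrightarrow> s |\<in>| T \<Longrightarrow>
      odd_sign s (S |\<union>| T) * shuffle_sign S T =
      (- 1) ^ fcard S * (shuffle_sign S (T |-| {|s|}) * odd_sign s T)"
    and "s |\<in>| S \<Longrightarrow> s |\<in>| T \<Longrightarrow>
      shuffle_sign (S |-| {|s|}) T * odd_sign s S +
      (- 1) ^ fcard S * (shuffle_sign S (T |-| {|s|}) * odd_sign s T) = 0"
proof -
  assume s: "s |\<in>| S" "s |\<notin>| T"
  define S' where "S' = S |-| {|s|}"
  have S: "S = {|s|} |\<union>| S'" "s |\<notin>| S'" using s by (auto simp: S'_def)
  have e: "(S |\<union>| T) |-| {|s|} = S' |\<union>| T" using s by (auto simp: S'_def)
  have "{|s|} |\<inter>| (S' |\<union>| T) = {||}" "{|s|} |\<inter>| S' = {||}" using s by (auto simp: S'_def)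
  note sq = this[THEN shuffle_sign_idem]
  have "shuffle_sign {|s|} S' * shuffle_sign S T = shuffle_sign S' T * shuffle_sign {|s|} (S' |\<union>| T)"
    using shuffle_sign_assoc[of "{|s|}" S' T] S(1) by simp
  then have "shuffle_sign {|s|} (S' |\<union>| T) * shuffle_sign S T = shuffle_sign S' T * shuffle_sign {|s|} S'"
    using sq by algebra
  then show "odd_sign s (S |\<union>| T) * shuffle_sign S T = shuffle_sign (S |-| {|s|}) T * odd_sign s S"
    using s e by (simp add: odd_sign_def S'_def)
next
  assume s: "s |\<notin>| S" "s |\<in>| T"
  define T' where "T' = T |-| {|s|}"
  have T: "T = {|s|} |\<union>| T'" "s |\<notin>| T'" using s by (auto simp: T'_def)
  have e: "(S |\<union>| T) |-| {|s|} = S |\<union>| T'" using s by (auto simp: T'_def)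
  have "{|s|} |\<inter>| (S |\<union>| T') = {||}" "{|s|} |\<inter>| T' = {||}" "{|s|} |\<inter>| S = {||}"
    using s by (auto simp: T'_def)
  note sq = this[THEN shuffle_sign_idem]
  have 1: "shuffle_sign S {|s|} * shuffle_sign (S |\<union>| {|s|}) T' = shuffle_sign {|s|} T' * shuffle_sign S T"
    using shuffle_sign_assoc[of S "{|s|}" T'] T(1) by simp
  have 2: "shuffle_sign {|s|} S * shuffle_sign (S |\<union>| {|s|}) T' = shuffle_sign S T' * shuffle_sign {|s|} (S |\<union>| T')"
    using shuffle_sign_assoc[of "{|s|}" S T'] by (simp add: sup_commute)
  have 3: "shuffle_sign S {|s|} = (- 1) ^ fcard S * shuffle_sign {|s|} S"
    using shuffle_sign_swap[of S "{|s|}"] by simp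
  \<comment> \<open>The signs are abstracted to real variables, two of which have square 1; what
    remains is a polynomial consequence of the three identities.\<close>
  have "x * u = e * (w * r)"
    if "p * q = r * u" "v * q = w * x" "p = e * v" "x * x = 1" "r * r = 1" for p q r u v w x e :: real
    using that by algebra
  from this[OF 1 2 3 sq(1,2)]
  have "shuffle_sign {|s|} (S |\<union>| T') * shuffle_sign S T =
      (- 1) ^ fcard S * (shuffle_sign S T' * shuffle_sign {|s|} T')" .
  then show "odd_sign s (S |\<union>| T) * shuffle_sign S T =
      (- 1) ^ fcard S * (shuffle_sign S (T |-| {|s|}) * odd_sign s T)"
    using s e by (simp add: odd_sign_def T'_def)
next
  assume s: "s |\<in>| S" "s |\<in>| T"
  define S' where "S' = S |-| {|s|}"
  define T' where "T' = T |-| {|s|}"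
  have S: "S = {|s|} |\<union>| S'" "s |\<notin>| S'" using s by (auto simp: S'_def)
  have T: "T = {|s|} |\<union>| T'" "s |\<notin>| T'" using s by (auto simp: T'_def)
  have "{|s|} |\<inter>| S' = {||}" "{|s|} |\<inter>| T' = {||}" using s by (auto simp: T'_def S'_def)
  note sq = this[THEN shuffle_sign_idem]
  have 1: "shuffle_sign S' {|s|} * shuffle_sign S T' = shuffle_sign {|s|} T' * shuffle_sign S' T"
    using shuffle_sign_assoc[of S' "{|s|}" T'] T(1) S(1) by (simp add: sup_commute)
  have 2: "shuffle_sign S' {|s|} = (- 1) ^ fcard S' * shuffle_sign {|s|} S'"
    using shuffle_sign_swap[of S' "{|s|}"] by simp
  have "fcard S = Suc (fcard S')"
    using S fcard_finsert_disjoint[of s S'] by simp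
  then have 3: "(- 1) ^ fcard S = - ((- 1 :: real) ^ fcard S')" by simp
  have "shuffle_sign S' T * shuffle_sign {|s|} S' +
      (- 1) ^ fcard S * (shuffle_sign S T' * shuffle_sign {|s|} T') = 0"
  proof -
    have "u * v + - e * (w * r) = 0"
      if "p * w = r * u" "p = e * v" "v * v = 1" "r * r = 1" "e * e = 1" for p r u v w e :: real
      using that by algebra
    from this[OF 1 2 sq] show ?thesis
      unfolding 3 by (simp flip: power_mult_distrib)
  qed
  then show "shuffle_sign (S |-| {|s|}) T * odd_sign s S +
      (- 1) ^ fcard S * (shuffle_sign S (T |-| {|s|}) * odd_sign s T) = 0"
    using s by (simp add: odd_sign_def S'_def T'_def)
qed

lemma left_deriv_mult_gmono:
  "left_deriv s (gmono a x * gmono b y) =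
    left_deriv s (gmono a x) * gmono b y + grade_inv (gmono a x) * left_deriv s (gmono b y)"
proof -
  obtain P S Q T where ab: "a = (P, S)" "b = (Q, T)" by (cases a, cases b) auto
  let ?U = "(S |\<union>| T) |-| {|s|}"
  have lhs: "left_deriv s (gmono a x * gmono b y) =
      gmono (P + Q, ?U) (odd_sign s (S |\<union>| T) * shuffle_sign S T * (x * y))"
    by (simp add: ab left_deriv_mono_map gmono_times_gmono mono_mult_def mono_map_gmono mult_ac)
  have rhs: "left_deriv s (gmono a x) * gmono b y + grade_inv (gmono a x) * left_deriv s (gmono b y) =
      gmono (P + Q, (S |-| {|s|}) |\<union>| T) (shuffle_sign (S |-| {|s|}) T * odd_sign s S * (x * y)) +
      gmono (P + Q, S |\<union>| (T |-| {|s|}))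
        ((- 1) ^ fcard S * (shuffle_sign S (T |-| {|s|}) * odd_sign s T) * (x * y))"
    by (simp add: ab left_deriv_mono_map gmono_times_gmono mono_mult_def mono_map_gmono grade_sign_def mult_ac)
  consider "s |\<notin>| S" "s |\<notin>| T" | "s |\<in>| S" "s |\<notin>| T" | "s |\<notin>| S" "s |\<in>| T" | "s |\<in>| S" "s |\<in>| T"
    by blast
  then show ?thesis
  proof cases
    case 1
    then show ?thesis unfolding lhs rhs by (simp add: odd_sign_def)
  next
    case 2
    then have "?U = (S |-| {|s|}) |\<union>| T" by auto
    moreover have "odd_sign s T = 0" using 2 by (simp add: odd_sign_def)
    ultimately show ?thesis unfolding lhs rhs using odd_sign_mult(1)[OF 2] by simp
  next
    case 3
    then have "?U = S |\<union>| (T |-| {|s|})" by auto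
    moreover have "odd_sign s S = 0" using 3 by (simp add: odd_sign_def)
    ultimately show ?thesis unfolding lhs rhs using odd_sign_mult(2)[OF 3] by simp
  next
    case 4
    then have "S |\<union>| (T |-| {|s|}) = (S |-| {|s|}) |\<union>| T" by auto
    moreover have "shuffle_sign S T = 0" using 4 by (auto simp: shuffle_sign_def)
    ultimately show ?thesis
      unfolding lhs rhs using odd_sign_mult(3)[OF 4]
      by (simp add: gmono_add[symmetric] flip: distrib_right)
  qed
qed

lemma p_deriv_mult_gmono:
  "p_deriv i (gmono a x * gmono b y) =
    p_deriv i (gmono a x) * gmono b y + gmono a x * p_deriv i (gmono b y)"
proof -
  obtain P S Q T where ab: "a = (P, S)" "b = (Q, T)" by (cases a, cases b) auto
  \<comment> \<open>Subtraction of multisets is truncated, so moving it into one summand is valid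
    only if that summand contains \<open>i\<close>; otherwise the multiplicity in the coefficient is
    0.\<close>
  have 1: "gmono (P + Q - {#i#}, U) (real (count P i) * z) = gmono ((P - {#i#}) + Q, U) (real (count P i) * z)" for U z
  proof (cases "i \<in># P")
    case True
    then obtain P' where "P = add_mset i P'" by (rule mset_add)
    then show ?thesis by simp
  qed (simp add: not_in_iff)
  have 2: "gmono (P + Q - {#i#}, U) (real (count Q i) * z) = gmono (P + (Q - {#i#}), U) (real (count Q i) * z)" for U z
  proof (cases "i \<in># Q")
    case True
    then obtain Q' where "Q = add_mset i Q'" by (rule mset_add)
    then show ?thesis by simp
  qed (simp add: not_in_iff)
  let ?z = "shuffle_sign S T * (x * y)"
  have "p_deriv i (gmono a x * gmono b y) =
      gmono (P + Q - {#i#}, S |\<union>| T) (real (count P i) * ?z + real (count Q i) * ?z)"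
    by (simp add: ab p_deriv_mono_map gmono_times_gmono mono_mult_def mono_map_gmono algebra_simps)
  also have "\<dots> = gmono ((P - {#i#}) + Q, S |\<union>| T) (real (count P i) * ?z) +
      gmono (P + (Q - {#i#}), S |\<union>| T) (real (count Q i) * ?z)"
    unfolding gmono_add 1 2 ..
  also have "\<dots> = p_deriv i (gmono a x) * gmono b y + gmono a x * p_deriv i (gmono b y)"
    by (simp add: ab p_deriv_mono_map gmono_times_gmono mono_mult_def mono_map_gmono mult_ac)
  finally show ?thesis .
qed

lemma bilinear_gpoly_eqI:
  fixes L M :: "gpoly \<Rightarrow> gpoly \<Rightarrow> gpoly"
  assumes "\<And>F. Modules.additive (L F)" "\<And>G. Modules.additive (\<lambda>F. L F G)"
    and "\<And>F. Modules.additive (M F)" "\<And>G. Modules.additive (\<lambda>F. M F G)"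
    and "\<And>a x b y. L (gmono a x) (gmono b y) = M (gmono a x) (gmono b y)"
  shows "L F G = M F G"
proof -
  have 1: "L F (gmono b y) = M F (gmono b y)" for b y
    by (rule additive_gpoly_eqI[of "\<lambda>F. L F (gmono b y)" "\<lambda>F. M F (gmono b y)" F,
          OF assms(2)[of "gmono b y"] assms(4)[of "gmono b y"] assms(5)])
  show ?thesis
    by (rule additive_gpoly_eqI[of "L F" "M F" G, OF assms(1)[of F] assms(3)[of F] 1])
qed

lemma left_deriv_mult: "left_deriv s (F * G) = left_deriv s F * G + grade_inv F * left_deriv s G"
  by (rule bilinear_gpoly_eqI[of "\<lambda>F G. left_deriv s (F * G)"
        "\<lambda>F G. left_deriv s F * G + grade_inv F * left_deriv s G"];
      (rule Modules.additive.intro)?;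
      simp add: left_deriv_mult_gmono[unfolded left_deriv_mono_map] left_deriv_mono_map mono_map_add
        algebra_simps)

lemma p_deriv_mult: "p_deriv i (F * G) = p_deriv i F * G + F * p_deriv i G"
  by (rule bilinear_gpoly_eqI[of "\<lambda>F G. p_deriv i (F * G)" "\<lambda>F G. p_deriv i F * G + F * p_deriv i G"];
      (rule Modules.additive.intro)?;
      simp add: p_deriv_mult_gmono[unfolded p_deriv_mono_map] p_deriv_mono_map mono_map_add algebra_simps)

lemma mono_map_comp: "mono_map \<phi> w (mono_map \<psi> v F) = mono_map (\<lambda>a. \<phi> (\<psi> a)) (\<lambda>a. w (\<psi> a) * v a) F"
  by (rule additive_gpoly_eqI[of "\<lambda>F. mono_map \<phi> w (mono_map \<psi> v F)"])
     (auto intro!: Modules.additive.intro simp: mono_map_add mono_map_gmono mult_ac)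

text \<open>Targets have to agree only where the weight is nonzero, because the removal of an absent
  factor has a meaningless target but weight 0.\<close>

lemma mono_map_cong:
  "(\<And>a. coeff F a \<noteq> 0 \<Longrightarrow> w a = v a \<and> (w a \<noteq> 0 \<longrightarrow> \<phi> a = \<psi> a)) \<Longrightarrow> mono_map \<phi> w F = mono_map \<psi> v F"
  unfolding mono_map_def by (intro sum.cong refl) (force simp: supp_def)

lemma mono_map_uminus_weight: "mono_map \<phi> (\<lambda>a. - w a) F = - mono_map \<phi> w F"
  unfolding mono_map_def sum_negf[symmetric]
  by (intro sum.cong refl) (simp add: gpoly_eq_iff coeff_gmono)

lemma mono_map_id [simp]: "mono_map (\<lambda>a. a) (\<lambda>a. 1) F = F"
  unfolding mono_map_def mult_1 by (rule gpoly_expand[OF finite_supp order_refl, symmetric])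

lemma p_deriv_commute: "p_deriv i (p_deriv j F) = p_deriv j (p_deriv i F)"
  unfolding p_deriv_mono_map mono_map_comp
  by (rule mono_map_cong) (auto simp: diff_right_commute add_mset_commute)

lemma p_left_deriv_commute: "p_deriv i (left_deriv s F) = left_deriv s (p_deriv i F)"
  unfolding p_deriv_mono_map left_deriv_mono_map mono_map_comp by (rule mono_map_cong) simp

text \<open>Both orders bring the two factors to the front, in opposite arrangements. By the cocycle
  identity the signs differ by the sign of exchanging two odd factors.\<close>

lemma left_deriv_anticommute: "left_deriv s (left_deriv t F) = - left_deriv t (left_deriv s F)"
proof -
  have "odd_sign s (S |-| {|t|}) * odd_sign t S = - (odd_sign t (S |-| {|s|}) * odd_sign s S)" for S
  proof (cases "s |\<in>| S \<and> t |\<in>| S \<and> s \<noteq> t")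
    case True
    define R where "R = S |-| {|s|} |-| {|t|}"
    have e: "S |-| {|t|} |-| {|s|} = R" "S |-| {|t|} = {|s|} |\<union>| R" "S |-| {|s|} = {|t|} |\<union>| R"
      using True by (auto simp: R_def)
    have 1: "shuffle_sign {|t|} {|s|} * shuffle_sign ({|s|} |\<union>| {|t|}) R = shuffle_sign {|s|} R * shuffle_sign {|t|} ({|s|} |\<union>| R)"
      using shuffle_sign_assoc[of "{|t|}" "{|s|}" R] by (simp add: finsert_commute)
    have 2: "shuffle_sign {|s|} {|t|} * shuffle_sign ({|s|} |\<union>| {|t|}) R = shuffle_sign {|t|} R * shuffle_sign {|s|} ({|t|} |\<union>| R)"
      using shuffle_sign_assoc[of "{|s|}" "{|t|}" R] by simp
    have 3: "shuffle_sign {|t|} {|s|} = - shuffle_sign {|s|} {|t|}"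
      using shuffle_sign_swap[of "{|t|}" "{|s|}"] by simp
    have "shuffle_sign {|s|} R * shuffle_sign {|t|} ({|s|} |\<union>| R) = - (shuffle_sign {|t|} R * shuffle_sign {|s|} ({|t|} |\<union>| R))"
      by (metis 1 2 3 mult_minus_left)
    moreover have "odd_sign s (S |-| {|t|}) = shuffle_sign {|s|} R" "odd_sign t (S |-| {|s|}) = shuffle_sign {|t|} R"
      using True e(1) R_def by (simp_all add: odd_sign_def)
    moreover have "odd_sign t S = shuffle_sign {|t|} ({|s|} |\<union>| R)" "odd_sign s S = shuffle_sign {|s|} ({|t|} |\<union>| R)"
      using True by (simp_all add: odd_sign_def e(2,3))
    ultimately show ?thesis by simp
  qed (auto simp: odd_sign_def)
  moreover have "S |-| {|t|} |-| {|s|} = S |-| {|s|} |-| {|t|}" for S :: "nat fset"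
    by auto
  ultimately show ?thesis
    unfolding left_deriv_mono_map mono_map_comp mono_map_uminus_weight[symmetric]
    by (intro mono_map_cong) simp
qed

text \<open>Signs act on a bare abelian group and carry an integer exponent, since exponents are
  formed from degrees by subtraction as well. Identities of signs then become parity statements
  through \<open>sg_cong\<close>.\<close>

definition sg :: "int \<Rightarrow> 'a::ab_group_add \<Rightarrow> 'a" where
  "sg k x = (if even k then x else - x)"

definition gpoly_parity :: "int \<Rightarrow> gpoly \<Rightarrow> bool" where
  "gpoly_parity k F \<longleftrightarrow> (\<forall>a. coeff F a \<noteq> 0 \<longrightarrow> even (int (fcard (snd a)) - k))"

lemma sg_add: "sg k (x + y) = sg k x + sg k y"
  by (simp add: sg_def)

lemma sg_sum: "sg k (sum f A) = (\<Sum>i\<in>A. sg k (f i))"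
  by (simp add: sg_def sum_negf)

lemma gpoly_parityD: "gpoly_parity k F \<Longrightarrow> coeff F a \<noteq> 0 \<Longrightarrow> even (fcard (snd a)) = even k"
  unfolding gpoly_parity_def by (drule spec[of _ a]) auto

lemma grade_sign_parity:
  assumes "gpoly_parity k F" "coeff F a \<noteq> 0" shows "grade_sign a = (if even k then 1 else - 1)"
  using gpoly_parityD[OF assms] by (simp add: grade_sign_def)

lemma grade_inv_parity:
  assumes "gpoly_parity k F" shows "grade_inv F = sg k F"
proof -
  have "grade_inv F = mono_map (\<lambda>a. a) (\<lambda>_. if even k then 1 else - 1) F"
    by (rule mono_map_cong) (simp add: grade_sign_parity[OF assms])
  then show ?thesis
    using mono_map_uminus_weight[of "\<lambda>a. a" "\<lambda>_. 1" F] by (simp add: sg_def)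
qed

lemma right_deriv_parity:
  assumes "gpoly_parity k F" shows "right_deriv s F = sg (k + 1) (left_deriv s F)"
proof -
  let ?\<phi> = "\<lambda>a. (fst a, snd a |-| {|s|})"
  have "right_deriv s F = mono_map ?\<phi> (\<lambda>a. (if even k then - 1 else 1) * odd_sign s (snd a)) F"
    unfolding right_deriv_mono_map by (rule mono_map_cong) (simp add: grade_sign_parity[OF assms])
  then show ?thesis
    using mono_map_uminus_weight[of ?\<phi> "\<lambda>a. odd_sign s (snd a)" F]
    by (auto simp: sg_def left_deriv_mono_map)
qed

lemma gmono_uminus: "gmono a (- x) = - gmono a x"
  by (simp add: gpoly_eq_iff coeff_gmono)

lemma gmono_sg: "gmono a (sg k x) = sg k (gmono a x)"
  by (simp add: sg_def gmono_uminus)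

lemma gpoly_mult_commute:
  assumes "gpoly_parity k F" "gpoly_parity l G" shows "F * G = sg (k * l) (G * F)"
proof -
  have key: "gmono (mono_mult a b) (shuffle_sign (snd a) (snd b) * coeff F a * coeff G b) =
      sg (k * l) (gmono (mono_mult b a) (shuffle_sign (snd b) (snd a) * coeff G b * coeff F a))"
    if "a \<in> supp F" "b \<in> supp G" for a b
  proof -
    have "even (fcard (snd a) * fcard (snd b)) = even (k * l)"
      using assms that by (simp add: gpoly_parityD supp_def)
    then have "(- 1) ^ (fcard (snd a) * fcard (snd b)) = (if even (k * l) then 1 else - 1 :: real)"
      by (simp only: minus_one_power_iff)
    then have "shuffle_sign (snd a) (snd b) * coeff F a * coeff G b =
        sg (k * l) (shuffle_sign (snd b) (snd a) * coeff G b * coeff F a)"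
      by (subst shuffle_sign_swap) (simp add: sg_def)
    moreover have "mono_mult a b = mono_mult b a"
      unfolding mono_mult_def by (simp only: add.commute sup_commute)
    ultimately show ?thesis
      by (simp only: gmono_sg)
  qed
  have "F * G = (\<Sum>a\<in>supp F. \<Sum>b\<in>supp G.
      sg (k * l) (gmono (mono_mult b a) (shuffle_sign (snd b) (snd a) * coeff G b * coeff F a)))"
    unfolding times_gpoly_def by (intro sum.cong refl key)
  also have "\<dots> = sg (k * l) (\<Sum>a\<in>supp F. \<Sum>b\<in>supp G.
      gmono (mono_mult b a) (shuffle_sign (snd b) (snd a) * coeff G b * coeff F a))"
    by (simp only: sg_sum)
  also have "(\<Sum>a\<in>supp F. \<Sum>b\<in>supp G.
      gmono (mono_mult b a) (shuffle_sign (snd b) (snd a) * coeff G b * coeff F a)) = G * F"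
    unfolding times_gpoly_def by (rule sum.swap)
  finally show ?thesis .
qed

section \<open>The graded Jacobi identity\<close>

lemma sg_sg: "sg k (sg l x) = sg (k + l) x"
  by (simp add: sg_def)

lemma sg_mult_left: "sg k x * y = sg k (x * y :: 'a::ring)"
  by (simp add: sg_def)

lemma sg_mult_right: "x * sg k y = sg k (x * y :: 'a::ring)"
  by (simp add: sg_def)

lemma sg_uminus: "sg k (- x) = - sg k x"
  by (simp add: sg_def)

lemma uminus_sg: "- sg k x = sg (k + 1) x"
  by (simp add: sg_def)

lemma sg_cong: "even (k - l) \<Longrightarrow> sg k x = sg l x"
  by (auto simp: sg_def)

lemma sg_zero [simp]: "sg k 0 = 0"
  by (simp add: sg_def)

text \<open>
  The spaces \<open>hom k w\<close> carry the degree \<open>k\<close> and a weight \<open>w\<close>.  The left derivations \<open>D a\<close>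
  and right derivations \<open>DR a\<close> belong to coordinates \<open>a\<close>, \<open>dual a\<close> is the coordinate conjugate
  to \<open>a\<close>, and \<open>e a\<close> is the exponent of the sign of the bracket of \<open>a\<close> and \<open>dual a\<close>.
\<close>

locale poisson_algebra =
  fixes hom :: "int \<Rightarrow> int \<Rightarrow> 'r::ring set"
    and I :: "'i set" and D DR :: "'i \<Rightarrow> 'r \<Rightarrow> 'r"
    and dual :: "'i \<Rightarrow> 'i" and e deg wt :: "'i \<Rightarrow> int"
  assumes dual_in: "a \<in> I \<Longrightarrow> dual a \<in> I"
    and dual_dual: "dual (dual a) = a"
    and e_dual: "odd (e (dual a) + e a + deg a)"
    and deg_dual: "deg (dual a) = 2 - deg a"
    and wt_dual: "wt (dual a) = - wt a"
    and hom_zero: "0 \<in> hom k w"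
    and hom_add: "F \<in> hom k w \<Longrightarrow> G \<in> hom k w \<Longrightarrow> F + G \<in> hom k w"
    and hom_uminus: "F \<in> hom k w \<Longrightarrow> - F \<in> hom k w"
    and hom_mult: "F \<in> hom k w \<Longrightarrow> G \<in> hom l v \<Longrightarrow> F * G \<in> hom (k + l) (w + v)"
    and mult_commute: "F \<in> hom k w \<Longrightarrow> G \<in> hom l v \<Longrightarrow> F * G = sg (k * l) (G * F)"
    and D_hom: "a \<in> I \<Longrightarrow> F \<in> hom k w \<Longrightarrow> D a F \<in> hom (k - deg a) (w - wt a)"
    and D_add: "a \<in> I \<Longrightarrow> F \<in> hom k w \<Longrightarrow> G \<in> hom k w \<Longrightarrow> D a (F + G) = D a F + D a G"
    and D_mult: "a \<in> I \<Longrightarrow> F \<in> hom k w \<Longrightarrow> G \<in> hom l v \<Longrightarrow>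
      D a (F * G) = D a F * G + sg (deg a * k) (F * D a G)"
    and D_commute: "a \<in> I \<Longrightarrow> b \<in> I \<Longrightarrow> F \<in> hom k w \<Longrightarrow>
      D a (D b F) = sg (deg a * deg b) (D b (D a F))"
    and DR_eq: "a \<in> I \<Longrightarrow> F \<in> hom k w \<Longrightarrow> DR a F = sg (deg a * (k + 1)) (D a F)"
begin

definition br :: "'r \<Rightarrow> 'r \<Rightarrow> 'r" where
  "br F G = (\<Sum>a\<in>I. sg (e a) (DR a F * D (dual a) G))"

text \<open>Once the degree of the first argument is known, right derivations disappear in favour of
  left ones, for which the Leibniz and commutation rules are assumed.\<close>

lemma br_eq: "F \<in> hom k w \<Longrightarrow>
    br F G = (\<Sum>a\<in>I. sg (e a + deg a * (k + 1)) (D a F * D (dual a) G))"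
  unfolding br_def by (intro sum.cong refl) (simp add: DR_eq sg_mult_left sg_sg)

lemma hom_sg: "F \<in> hom k w \<Longrightarrow> sg l F \<in> hom k w"
  by (simp add: sg_def hom_uminus)

lemma hom_sum: "(\<And>i. i \<in> A \<Longrightarrow> f i \<in> hom k w) \<Longrightarrow> sum f A \<in> hom k w"
  by (induction A rule: infinite_finite_induct) (auto intro: hom_zero hom_add)

lemma hom_diff: "F \<in> hom k w \<Longrightarrow> G \<in> hom k w \<Longrightarrow> F - G \<in> hom k w"
  using hom_add[OF _ hom_uminus, of F k w G] by simp

lemma D_zero: "a \<in> I \<Longrightarrow> D a 0 = 0"
  using D_add[OF _ hom_zero hom_zero, of a] by simp

lemma D_uminus: "a \<in> I \<Longrightarrow> F \<in> hom k w \<Longrightarrow> D a (- F) = - D a F"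
  using D_add[of a F k w "- F"] D_zero hom_uminus[of F k w] by (simp add: minus_unique)

lemma D_sg: "a \<in> I \<Longrightarrow> F \<in> hom k w \<Longrightarrow> D a (sg l F) = sg l (D a F)"
  by (simp add: sg_def D_uminus)

lemma D_sum:
  assumes "a \<in> I" "\<And>i. i \<in> A \<Longrightarrow> f i \<in> hom k w" shows "D a (sum f A) = (\<Sum>i\<in>A. D a (f i))"
  using assms(2)
proof (induction A rule: infinite_finite_induct)
  case (insert x A)
  then show ?case using D_add[OF assms(1), of "f x" k w "sum f A"] hom_sum[of A f k w] by simp
qed (simp_all add: D_zero assms(1))

lemma DD_hom:
  assumes "a \<in> I" "F \<in> hom k w" "G \<in> hom l v"
  shows "D a F * D (dual a) G \<in> hom (k + l - 2) (w + v)"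
  using hom_mult[OF D_hom[OF assms(1,2)] D_hom[OF dual_in[OF assms(1)] assms(3)]]
  by (simp add: deg_dual wt_dual algebra_simps)

lemma br_hom:
  assumes "F \<in> hom k w" "G \<in> hom l v" shows "br F G \<in> hom (k + l - 2) (w + v)"
  unfolding br_eq[OF assms(1)] by (intro hom_sum hom_sg DD_hom assms)

lemma br_add_left: "F \<in> hom k w \<Longrightarrow> F' \<in> hom k w \<Longrightarrow> br (F + F') G = br F G + br F' G"
  unfolding br_eq[OF hom_add] br_eq sum.distrib[symmetric]
  by (intro sum.cong refl) (simp add: D_add sg_add distrib_right)

lemma br_add_right: "G \<in> hom k w \<Longrightarrow> G' \<in> hom k w \<Longrightarrow> br F (G + G') = br F G + br F G'"
  unfolding br_def sum.distrib[symmetric]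
  by (intro sum.cong refl) (simp add: D_add dual_in sg_add distrib_left)

lemma br_uminus_right: "G \<in> hom k w \<Longrightarrow> br F (- G) = - br F G"
  unfolding br_def sum_negf[symmetric]
  by (intro sum.cong refl) (simp add: D_uminus dual_in sg_uminus)

lemma br_uminus_left: "F \<in> hom k w \<Longrightarrow> br (- F) G = - br F G"
  unfolding br_eq[OF hom_uminus] br_eq sum_negf[symmetric]
  by (intro sum.cong refl) (simp add: D_uminus sg_uminus)

lemma br_zero: "br 0 G = 0" "br F 0 = 0"
  using br_add_left[OF hom_zero hom_zero] br_add_right[OF hom_zero hom_zero] by simp_all

lemma br_diff_right: "G \<in> hom k w \<Longrightarrow> G' \<in> hom k w \<Longrightarrow> br F (G - G') = br F G - br F G'"
  using br_add_right[OF _ hom_uminus, of G k w G' F] br_uminus_right[of G' k w F] by simp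

lemma sum_dual: "(\<Sum>a\<in>I. f a) = (\<Sum>a\<in>I. f (dual a))"
  by (rule sum.reindex_bij_witness[of _ dual dual]) (auto simp: dual_in dual_dual)

text \<open>Replacing each coordinate by its conjugate matches the two sums term by term. The
  remaining sign is governed by \<open>e_dual\<close>, which says that the brackets of conjugate
  coordinates are graded skew-symmetric.\<close>

lemma br_skew:
  assumes F: "F \<in> hom k w" and G: "G \<in> hom l v"
  shows "br F G = sg (k * l + 1) (br G F)"
proof -
  have "sg (e a + deg a * (k + 1)) (D a F * D (dual a) G) =
      sg (k * l + 1) (sg (e (dual a) + deg (dual a) * (l + 1)) (D (dual a) G * D a F))" if a: "a \<in> I" for a
    unfolding mult_commute[OF D_hom[OF a F] D_hom[OF dual_in[OF a] G]] sg_sg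
    using e_dual[of a] by (intro sg_cong) (auto simp: deg_dual)
  then show ?thesis
    unfolding br_eq[OF F] br_eq[OF G] sg_sum by (subst (2) sum_dual) (simp add: dual_dual)
qed

text \<open>
  The double brackets of \<open>F\<close>, \<open>G\<close>, \<open>H\<close> are sums of terms with a second derivative of \<open>G\<close>, of \<open>H\<close>
  and of \<open>F\<close> respectively; the Jacobi identity compares these three sums separately.
\<close>

definition jac_mid :: "int \<Rightarrow> int \<Rightarrow> 'r \<Rightarrow> 'r \<Rightarrow> 'r \<Rightarrow> 'r" where
  "jac_mid f g F G H = (\<Sum>a\<in>I. \<Sum>c\<in>I. sg (e a + deg a * (f + 1) + e c + deg c * (g + 1))
     (D a F * (D (dual a) (D c G) * D (dual c) H)))"

definition jac_last :: "int \<Rightarrow> int \<Rightarrow> 'r \<Rightarrow> 'r \<Rightarrow> 'r \<Rightarrow> 'r" where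
  "jac_last f g F G H = (\<Sum>a\<in>I. \<Sum>c\<in>I.
     sg (e a + deg a * (f + 1) + e c + deg c * (g + 1) + deg a * (g + deg c))
     (D a F * (D c G * D (dual a) (D (dual c) H))))"

definition jac_first :: "int \<Rightarrow> int \<Rightarrow> 'r \<Rightarrow> 'r \<Rightarrow> 'r \<Rightarrow> 'r" where
  "jac_first f g F G H = (\<Sum>a\<in>I. \<Sum>c\<in>I.
     sg (e a + deg a * (f + 1) + e c + deg c * (f + g + 1))
     (D c (D a F) * (D (dual a) G * D (dual c) H)))"

lemma br_br_right:
  assumes F: "F \<in> hom f u" and G: "G \<in> hom g v" and H: "H \<in> hom h w"
  shows "br F (br G H) = jac_mid f g F G H + jac_last f g F G H"
proof -
  have "D a F * D (dual a) (br G H) = (\<Sum>c\<in>I. sg (e c + deg c * (g + 1))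
      (D a F * (D (dual a) (D c G) * D (dual c) H) +
        sg (deg a * (g + deg c)) (D a F * (D c G * D (dual a) (D (dual c) H)))))" if a: "a \<in> I" for a
  proof -
    have "D (dual a) (br G H) = (\<Sum>c\<in>I. sg (e c + deg c * (g + 1)) (D (dual a) (D c G * D (dual c) H)))"
      unfolding br_eq[OF G]
      by (subst D_sum[OF dual_in[OF a], of _ _ "g + h - 2" "v + w"])
         (auto intro!: hom_sg DD_hom G H sum.cong D_sg dual_in a)
    also have "\<dots> = (\<Sum>c\<in>I. sg (e c + deg c * (g + 1))
        (D (dual a) (D c G) * D (dual c) H + sg (deg a * (g + deg c)) (D c G * D (dual a) (D (dual c) H))))"
    proof (intro sum.cong refl arg_cong[where f = "sg _"])
      fix c assume c: "c \<in> I"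
      \<comment> \<open>As \<open>deg (dual a)\<close> is \<open>2 - deg a\<close>, it has the
        parity of \<open>deg a\<close>, and differences in an exponent may be read as sums.\<close>
      have "sg (deg (dual a) * (g - deg c)) x = sg (deg a * (g + deg c)) x" for x :: 'r
        by (intro sg_cong) (auto simp: deg_dual)
      then show "D (dual a) (D c G * D (dual c) H) =
          D (dual a) (D c G) * D (dual c) H + sg (deg a * (g + deg c)) (D c G * D (dual a) (D (dual c) H))"
        using D_mult[OF dual_in[OF a] D_hom[OF c G] D_hom[OF dual_in[OF c] H]] by simp
    qed
    finally show ?thesis
      by (simp add: sum_distrib_left sg_mult_right distrib_left)
  qed
  then show ?thesis
    unfolding br_eq[OF F] jac_mid_def jac_last_def
    by (simp add: sg_sum sg_sg sg_add sum.distrib add.assoc)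
qed

lemma br_br_left:
  assumes F: "F \<in> hom f u" and G: "G \<in> hom g v" and H: "H \<in> hom h w"
  shows "br (br F G) H = jac_first f g F G H + jac_mid f g F G H"
proof -
  have "D c (br F G) * D (dual c) H = (\<Sum>a\<in>I. sg (e a + deg a * (f + 1))
      (D c (D a F) * (D (dual a) G * D (dual c) H) +
        sg (deg c * f) (D a F * (D (dual a) (D c G) * D (dual c) H))))" if c: "c \<in> I" for c
  proof -
    have "D c (br F G) = (\<Sum>a\<in>I. sg (e a + deg a * (f + 1)) (D c (D a F * D (dual a) G)))"
      unfolding br_eq[OF F]
      by (subst D_sum[OF c, of _ _ "f + g - 2" "u + v"])
         (auto intro!: hom_sg DD_hom F G sum.cong D_sg c)
    also have "\<dots> = (\<Sum>a\<in>I. sg (e a + deg a * (f + 1))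
        (D c (D a F) * D (dual a) G + sg (deg c * f) (D a F * D (dual a) (D c G))))"
    proof (intro sum.cong refl arg_cong[where f = "sg _"])
      fix a assume a: "a \<in> I"
      have "sg (deg c * (f - deg a) + deg c * deg (dual a)) x = sg (deg c * f) x" for x :: 'r
        by (intro sg_cong) (auto simp: deg_dual)
      then show "D c (D a F * D (dual a) G) =
          D c (D a F) * D (dual a) G + sg (deg c * f) (D a F * D (dual a) (D c G))"
        using D_mult[OF c D_hom[OF a F] D_hom[OF dual_in[OF a] G]] D_commute[OF c dual_in[OF a] G]
        by (simp add: sg_mult_right sg_sg)
    qed
    finally show ?thesis
      by (simp add: sum_distrib_right sg_mult_left distrib_right mult.assoc)
  qed
  then have "br (br F G) H = (\<Sum>c\<in>I. \<Sum>a\<in>I.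
      sg (e c + deg c * (f + g - 2 + 1) + (e a + deg a * (f + 1)))
        (D c (D a F) * (D (dual a) G * D (dual c) H)) +
      sg (e c + deg c * (f + g - 2 + 1) + (e a + deg a * (f + 1) + deg c * f))
        (D a F * (D (dual a) (D c G) * D (dual c) H)))"
    unfolding br_eq[OF br_hom[OF F G]] by (simp add: sg_sum sg_sg sg_add)
  also have "\<dots> = (\<Sum>a\<in>I. \<Sum>c\<in>I.
      sg (e a + deg a * (f + 1) + e c + deg c * (f + g + 1))
        (D c (D a F) * (D (dual a) G * D (dual c) H)) +
      sg (e a + deg a * (f + 1) + e c + deg c * (g + 1))
        (D a F * (D (dual a) (D c G) * D (dual c) H)))"
    by (subst sum.swap, intro sum.cong refl arg_cong2[where f = "(+)"] sg_cong) auto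
  finally show ?thesis
    unfolding jac_first_def jac_mid_def by (simp add: sum.distrib)
qed

text \<open>The two derivations on \<open>H\<close> commute up to sign, and so do the derivatives of
  \<open>F\<close> and \<open>G\<close>; renaming the summation indices does the rest.\<close>

lemma jac_last_swap:
  assumes F: "F \<in> hom f u" and G: "G \<in> hom g v" and H: "H \<in> hom h w"
  shows "sg (f * g) (jac_last g f G F H) = jac_last f g F G H"
proof -
  have "sg (f * g + (e c + deg c * (g + 1) + e a + deg a * (f + 1) + deg c * (f + deg a)))
      (D c G * (D a F * D (dual c) (D (dual a) H))) =
    sg (e a + deg a * (f + 1) + e c + deg c * (g + 1) + deg a * (g + deg c))
      (D a F * (D c G * D (dual a) (D (dual c) H)))" if a: "a \<in> I" and c: "c \<in> I" for a c
  proof -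
    have "D c G * (D a F * D (dual c) (D (dual a) H)) = (D c G * D a F) * D (dual c) (D (dual a) H)"
      by (simp add: mult.assoc)
    also have "\<dots> = sg ((g - deg c) * (f - deg a) + deg (dual c) * deg (dual a))
        (D a F * (D c G * D (dual a) (D (dual c) H)))"
      unfolding mult_commute[OF D_hom[OF c G] D_hom[OF a F]]
        D_commute[OF dual_in[OF c] dual_in[OF a] H]
      by (simp add: sg_mult_left sg_mult_right sg_sg mult.assoc add.commute)
    finally show ?thesis
      by (simp only: sg_sg) (intro sg_cong, auto simp: deg_dual)
  qed
  then show ?thesis
    unfolding jac_last_def sg_sum sg_sg by (subst sum.swap) (intro sum.cong refl)
qed

text \<open>With \<open>F\<close> and \<open>G\<close> exchanged, the function in the middle is
  \<open>F\<close>. Reindexing by \<open>dual\<close> reverses the sign through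
  \<open>e_dual\<close>, so these terms cancel exactly the part of \<open>br (br F G) H\<close> that
  \<open>br F (br G H)\<close> does not contain.\<close>

lemma jac_mid_swap:
  assumes F: "F \<in> hom f u" and G: "G \<in> hom g v" and H: "H \<in> hom h w"
  shows "sg (f * g) (jac_mid g f G F H) = - jac_first f g F G H"
proof -
  have "sg (f * g + (e (dual a) + deg (dual a) * (g + 1) + e c + deg c * (f + 1)))
      (D (dual a) G * (D a (D c F) * D (dual c) H)) =
    - sg (e a + deg a * (f + 1) + e c + deg c * (f + g + 1))
      (D c (D a F) * (D (dual a) G * D (dual c) H))" if a: "a \<in> I" and c: "c \<in> I" for a c
  proof -
    have "D (dual a) G * (D a (D c F) * D (dual c) H) = (D (dual a) G * D a (D c F)) * D (dual c) H"
      by (simp add: mult.assoc)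
    also have "\<dots> = sg ((g - deg (dual a)) * (f - deg c - deg a) + deg a * deg c)
        (D c (D a F) * (D (dual a) G * D (dual c) H))"
      unfolding mult_commute[OF D_hom[OF dual_in[OF a] G] D_hom[OF a D_hom[OF c F]]]
      by (simp add: D_commute[OF a c F] sg_mult_left sg_mult_right sg_sg mult.assoc add.commute)
    finally show ?thesis
      using e_dual[of a] by (simp only: sg_sg uminus_sg) (intro sg_cong, auto simp: deg_dual)
  qed
  then show ?thesis
    unfolding jac_mid_def jac_first_def sg_sum sg_sg sum_negf[symmetric]
    by (subst sum_dual, unfold dual_dual) (intro sum.cong refl)
qed

theorem jacobi:
  assumes F: "F \<in> hom f u" and G: "G \<in> hom g v" and H: "H \<in> hom h w"
  shows "br F (br G H) = br (br F G) H + sg (f * g) (br G (br F H))"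
  unfolding br_br_right[OF F G H] br_br_left[OF F G H] br_br_right[OF G F H] sg_add
    jac_last_swap[OF F G H] jac_mid_swap[OF F G H]
  by simp

end

section \<open>The Poisson algebra of a chart\<close>

lemma openin_coord_image:
  assumes "vector_bundle B" "c \<in> atlas B" "openin (base B) W" "W \<subseteq> cdom c"
  shows "openin (Euclidean_space (base_dim B)) (coord c ` W)"
proof -
  have c: "openin (base B) (cdom c)" "openin (Euclidean_space (base_dim B)) (coord c ` cdom c)"
    "homeomorphic_map (subtopology (base B) (cdom c))
      (subtopology (Euclidean_space (base_dim B)) (coord c ` cdom c)) (coord c)"
    using assms(1,2) by (auto simp: vector_bundle_def)
  have W: "openin (subtopology (base B) (cdom c)) W"
    using assms(3,4) by (rule subset_openin_subtopology)
  then have "openin (subtopology (Euclidean_space (base_dim B)) (coord c ` cdom c)) (coord c ` W)"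
    using homeomorphic_map_openness[OF c(3) openin_subset[OF W]] by simp
  then show ?thesis
    using c(2) by (rule openin_trans_full)
qed

section \<open>Smooth functions on the domain of a chart and their partial derivatives\<close>

locale bundle_chart =
  fixes B :: "('m, 'v::real_vector) vbundle" and c :: "('m, 'v) adapted_chart"
  assumes vb: "vector_bundle B" and c_in: "c \<in> atlas B"
begin

abbreviation "n \<equiv> base_dim B"
abbreviation "r \<equiv> fibre_dim B"
abbreviation "U \<equiv> cdom c"
abbreviation "\<psi> \<equiv> inv_into (cdom c) (coord c)"

lemma inj_coord: "inj_on (coord c) U"
proof -
  have "openin (base B) U" "homeomorphic_map (subtopology (base B) U)
      (subtopology (Euclidean_space n) (coord c ` U)) (coord c)"
    using vb c_in by (auto simp: vector_bundle_def)
  then show ?thesis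
    using homeomorphic_imp_injective_map openin_subset topspace_subtopology_subset by metis
qed

sublocale V: Euclidean_open n "coord c ` U"
  using vb c_in by unfold_locales (auto simp: vector_bundle_def)

lemma psi_coord [simp]: "m \<in> U \<Longrightarrow> \<psi> (coord c m) = m"
  using inj_coord by simp

lemma coord_psi [simp]: "x \<in> coord c ` U \<Longrightarrow> coord c (\<psi> x) = x"
  by (rule f_inv_into_f)

lemma psi_in: "x \<in> coord c ` U \<Longrightarrow> \<psi> x \<in> U"
  by (rule inv_into_into)

abbreviation sm :: "('m \<Rightarrow> real) \<Rightarrow> bool" where "sm \<equiv> smooth_in B c U"
abbreviation pd :: "nat \<Rightarrow> ('m \<Rightarrow> real) \<Rightarrow> 'm \<Rightarrow> real" where "pd \<equiv> chart_partial c"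

lemma sm_iff: "sm f \<longleftrightarrow> (\<forall>k. C_diff k n (coord c ` U) (f \<circ> \<psi>))"
  by (simp add: smooth_in_def smooth_def)

lemma sm_cong: "sm f \<Longrightarrow> (\<And>m. m \<in> U \<Longrightarrow> f m = g m) \<Longrightarrow> sm g"
  unfolding sm_iff using V.C_diff_cong[of _ "f \<circ> \<psi>" "g \<circ> \<psi>"] psi_in by auto

lemma sm_const: "sm (\<lambda>m. x)"
  by (auto simp: sm_iff o_def intro: C_diff_const)

lemma sm_add: "sm f \<Longrightarrow> sm g \<Longrightarrow> sm (\<lambda>m. f m + g m)"
  by (auto simp: sm_iff o_def intro: V.C_diff_add)

lemma sm_mult: "sm f \<Longrightarrow> sm g \<Longrightarrow> sm (\<lambda>m. f m * g m)"
  by (auto simp: sm_iff o_def intro: V.C_diff_mult)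

lemma sm_uminus: "sm f \<Longrightarrow> sm (\<lambda>m. - f m)"
  using sm_mult[OF sm_const[of "- 1"]] by simp

lemma sm_sum: "(\<And>i. i \<in> A \<Longrightarrow> sm (f i)) \<Longrightarrow> sm (\<lambda>m. \<Sum>i\<in>A. f i m)"
  by (induction A rule: infinite_finite_induct) (auto intro: sm_const sm_add)

lemma sm_if: "sm f \<Longrightarrow> sm (\<lambda>m. if Q then f m else 0)"
  by (cases Q) (simp_all add: sm_const)

lemma pd_psi: "x \<in> coord c ` U \<Longrightarrow> pd i f (\<psi> x) = partial i (f \<circ> \<psi>) x"
  by (simp add: chart_partial_def)

lemma sm_pd: "sm f \<Longrightarrow> i < n \<Longrightarrow> sm (pd i f)"
  unfolding sm_iff
proof
  fix k assume f: "\<forall>k. C_diff k n (coord c ` U) (f \<circ> \<psi>)" and i: "i < n"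
  show "C_diff k n (coord c ` U) (pd i f \<circ> \<psi>)"
    using C_diff_Suc_partial(2)[OF f[rule_format, of "Suc k"] i V.V_subset]
    by (rule V.C_diff_cong) (simp add: pd_psi)
qed

lemma pd_cong: "(\<And>m. m \<in> U \<Longrightarrow> f m = g m) \<Longrightarrow> m \<in> U \<Longrightarrow> i < n \<Longrightarrow> pd i f m = pd i g m"
  unfolding chart_partial_def by (intro V.partial_cong) (auto simp: psi_in)

lemma pd_const [simp]: "pd i (\<lambda>m. x) m = 0"
  by (simp add: chart_partial_def partial_def o_def)

lemma sm_DERIV:
  assumes "sm f" "i < n" "m \<in> U"
  shows "((\<lambda>t. f (\<psi> ((coord c m)(i := t)))) has_real_derivative pd i f m) (at (coord c m i))"
  using C_diff_Suc_partial(1)[of 0 n "coord c ` U" "f \<circ> \<psi>" i] assms V.V_subset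
  by (auto simp: sm_iff has_partial_def chart_partial_def)

lemma pd_eqI:
  assumes "((\<lambda>t. f (\<psi> ((coord c m)(i := t)))) has_real_derivative D) (at (coord c m i))"
  shows "pd i f m = D"
  using DERIV_imp_deriv[OF assms] by (simp add: chart_partial_def partial_def)

lemma pd_add:
  "sm f \<Longrightarrow> sm g \<Longrightarrow> i < n \<Longrightarrow> m \<in> U \<Longrightarrow> pd i (\<lambda>m. f m + g m) m = pd i f m + pd i g m"
  by (intro pd_eqI DERIV_add sm_DERIV)

lemma pd_mult:
  assumes "sm f" "sm g" "i < n" "m \<in> U"
  shows "pd i (\<lambda>m. f m * g m) m = pd i f m * g m + f m * pd i g m"
  using DERIV_mult[OF sm_DERIV[OF assms(1,3,4)] sm_DERIV[OF assms(2,3,4)]] assms(4)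
  by (intro pd_eqI) (simp add: mult.commute)

lemma pd_cmult: "sm f \<Longrightarrow> i < n \<Longrightarrow> m \<in> U \<Longrightarrow> pd i (\<lambda>m. x * f m) m = x * pd i f m"
  using pd_mult[OF sm_const] by simp

lemma pd_sum:
  "(\<And>j. j \<in> A \<Longrightarrow> sm (f j)) \<Longrightarrow> i < n \<Longrightarrow> m \<in> U \<Longrightarrow>
    pd i (\<lambda>m. \<Sum>j\<in>A. f j m) m = (\<Sum>j\<in>A. pd i (f j) m)"
  by (induction A rule: infinite_finite_induct) (simp_all add: pd_add sm_sum)

lemma pd_commute:
  assumes "sm f" "i < n" "j < n" "m \<in> U"
  shows "pd i (pd j f) m = pd j (pd i f) m"
proof -
  have "pd i (pd j f) m = partial i (partial j (f \<circ> \<psi>)) (coord c m)" if "i < n" for i j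
    unfolding chart_partial_def[of c i]
    by (rule V.partial_cong) (use that assms in \<open>auto simp: pd_psi\<close>)
  then show ?thesis
    using V.partial_commute[of "f \<circ> \<psi>" i j "coord c m"] assms by (simp add: sm_iff)
qed

lemma sm_coord: "j < n \<Longrightarrow> sm (\<lambda>m. coord c m j)"
  unfolding sm_iff
proof
  fix k show "C_diff k n (coord c ` U) ((\<lambda>m. coord c m j) \<circ> \<psi>)"
    using V.C_diff_coord[of k j] by (rule V.C_diff_cong) simp
qed

lemma pd_coord:
  assumes "i < n" "m \<in> U" shows "pd i (\<lambda>m. coord c m j) m = (if i = j then 1 else 0)"
proof -
  have "pd i (\<lambda>m. coord c m j) m = partial i (\<lambda>x. x j) (coord c m)"
    unfolding chart_partial_def by (rule V.partial_cong) (use assms in auto)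
  also have "\<dots> = (if i = j then 1 else 0)"
    unfolding partial_def by (rule DERIV_imp_deriv) auto
  finally show ?thesis .
qed

end

text \<open>
  Degree and weight together determine the type of a monomial: degree 3 and weight 1 means
  $\tau p$ or $\tau\tau\theta$, degree 2 and weight 2 means $\tau\tau$.
\<close>

definition mono_weight :: "mono \<Rightarrow> int" where
  "mono_weight a = (\<Sum>s\<in>fset (snd a). if even s then 1 else - 1)"

section \<open>The coordinates of a chart and the carriers of given degree and weight\<close>

datatype coordinate = Base nat | Mom nat | Odd nat

fun conjugate :: "coordinate \<Rightarrow> coordinate" where
  "conjugate (Base i) = Mom i"
| "conjugate (Mom i) = Base i"
| "conjugate (Odd s) = Odd (if even s then Suc s else s - 1)"

text \<open>The exponents express {x, p} = 1 and {p, x} = -1, while {\<tau>, \<theta>} and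
  {\<theta>, \<tau>} are both 1, the bracket being symmetric in degree 1.\<close>

fun coordinate_sign :: "coordinate \<Rightarrow> int" where
  "coordinate_sign (Base i) = 0"
| "coordinate_sign (Mom i) = 1"
| "coordinate_sign (Odd s) = 0"

fun coordinate_degree :: "coordinate \<Rightarrow> int" where
  "coordinate_degree (Base i) = 0"
| "coordinate_degree (Mom i) = 2"
| "coordinate_degree (Odd s) = 1"

fun coordinate_weight :: "coordinate \<Rightarrow> int" where
  "coordinate_weight (Base i) = 0"
| "coordinate_weight (Mom i) = 0"
| "coordinate_weight (Odd s) = (if even s then 1 else - 1)"

context bundle_chart
begin

definition coordinates :: "coordinate set" where
  "coordinates = Base ` {..<n} \<union> Mom ` {..<n} \<union> Odd ` {..<2 * r}"

text \<open>Base derivatives are cut off outside the domain, where the inverse chart has no meaning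
  and elements of the carriers have to vanish.\<close>

fun cderiv :: "coordinate \<Rightarrow> ('m \<Rightarrow> gpoly) \<Rightarrow> 'm \<Rightarrow> gpoly" where
  "cderiv (Base i) F = (\<lambda>m. if m \<in> U then x_deriv c i F m else 0)"
| "cderiv (Mom i) F = (\<lambda>m. p_deriv i (F m))"
| "cderiv (Odd s) F = (\<lambda>m. left_deriv s (F m))"

fun cderiv_right :: "coordinate \<Rightarrow> ('m \<Rightarrow> gpoly) \<Rightarrow> 'm \<Rightarrow> gpoly" where
  "cderiv_right (Odd s) F = (\<lambda>m. right_deriv s (F m))"
| "cderiv_right a F = cderiv a F"

definition monomials :: "int \<Rightarrow> int \<Rightarrow> mono set" where
  "monomials k w = {a. set_mset (fst a) \<subseteq> {..<n} \<and> fset (snd a) \<subseteq> {..<2 * r} \<and>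
     int (mono_degree a) = k \<and> mono_weight a = w}"

definition hom :: "int \<Rightarrow> int \<Rightarrow> ('m \<Rightarrow> gpoly) set" where
  "hom k w = {F. (\<forall>m. m \<notin> U \<longrightarrow> F m = 0) \<and> (\<forall>m. supp (F m) \<subseteq> monomials k w) \<and>
     (\<forall>a. sm (\<lambda>m. coeff (F m) a))}"

text \<open>The degree bounds the number of momenta, and there are finitely many odd coordinates.
  Sums over the support, which varies with the point, can thus be written over a fixed finite set
  and be differentiated along the base.\<close>

lemma finite_monomials [simp]: "finite (monomials k w)"
proof -
  have sub: "monomials k w \<subseteq> (\<Union>l\<le>nat k. multisets_of_size {..<n} l) \<times> {S. fset S \<subseteq> {..<2 * r}}"
    by (auto simp: monomials_def mono_degree_def multisets_of_size_def)
  have "finite {S. fset S \<subseteq> {..<2 * r}}"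
    by (rule finite_imageD[of fset]) (auto simp: inj_on_def fset_inject intro: finite_subset[of _ "Pow {..<2 * r}"])
  then show ?thesis
    by (intro finite_subset[OF sub] finite_cartesian_product) (auto intro: finite_multisets_of_size)
qed

lemma homI:
  assumes "\<And>m. m \<notin> U \<Longrightarrow> F m = 0" "\<And>m a. m \<in> U \<Longrightarrow> coeff (F m) a \<noteq> 0 \<Longrightarrow> a \<in> monomials k w"
    "\<And>a. sm (\<lambda>m. coeff (F m) a)"
  shows "F \<in> hom k w"
proof -
  have "a \<in> monomials k w" if "coeff (F m) a \<noteq> 0" for m a
    using assms(1,2)[of m] that by (cases "m \<in> U") auto
  then show ?thesis using assms(1,3) unfolding hom_def supp_def by blast
qed

lemma homD:
  assumes "F \<in> hom k w"
  shows "m \<notin> U \<Longrightarrow> F m = 0" "supp (F m) \<subseteq> monomials k w" "sm (\<lambda>m. coeff (F m) a)"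
    "coeff (F m) a \<noteq> 0 \<Longrightarrow> a \<in> monomials k w" "a \<notin> monomials k w \<Longrightarrow> coeff (F m) a = 0"
  using assms unfolding hom_def supp_def by blast+

lemma hom_eqI:
  "F \<in> hom k w \<Longrightarrow> G \<in> hom k' w' \<Longrightarrow> (\<And>m. m \<in> U \<Longrightarrow> F m = G m) \<Longrightarrow> F = G"
  using homD(1) by (metis ext)

lemma monomials_parity: "a \<in> monomials k w \<Longrightarrow> even (int (fcard (snd a)) - k)"
  by (auto simp: monomials_def mono_degree_def)

lemma hom_parity: "F \<in> hom k w \<Longrightarrow> gpoly_parity k (F m)"
  unfolding gpoly_parity_def by (intro allI impI monomials_parity homD(4))

lemma monomials_mult:
  assumes "a \<in> monomials k w" "b \<in> monomials l v" "snd a |\<inter>| snd b = {||}"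
  shows "mono_mult a b \<in> monomials (k + l) (w + v)"
proof -
  have disj: "fset (snd a) \<inter> fset (snd b) = {}"
    using assms(3) by (metis bot_fset.rep_eq inf_fset.rep_eq)
  have "fcard (snd a |\<union>| snd b) = fcard (snd a) + fcard (snd b)"
    using disj by (simp add: fcard.rep_eq sup_fset.rep_eq card_Un_disjoint)
  then show ?thesis
    using assms(1,2) disj
    by (auto simp: monomials_def mono_mult_def mono_degree_def mono_weight_def sup_fset.rep_eq sum.union_disjoint)
qed

lemma hom_mono_map:
  assumes F: "F \<in> hom k w"
    and \<phi>: "\<And>a. a \<in> monomials k w \<Longrightarrow> u a \<noteq> 0 \<Longrightarrow> \<phi> a \<in> monomials k' w'"
  shows "(\<lambda>m. mono_map \<phi> u (F m)) \<in> hom k' w'"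
proof (rule homI)
  fix m a assume "coeff (mono_map \<phi> u (F m)) a \<noteq> 0"
  then show "a \<in> monomials k' w'"
    using \<phi> homD(4)[OF F] by (metis mono_map_nonzero)
next
  fix b
  have "sm (\<lambda>m. \<Sum>a\<in>monomials k w. if \<phi> a = b then u a * coeff (F m) a else 0)"
    by (intro sm_sum sm_if sm_mult sm_const homD(3)[OF F])
  then show "sm (\<lambda>m. coeff (mono_map \<phi> u (F m)) b)"
    by (simp add: coeff_mono_map[OF finite_monomials homD(2)[OF F]])
qed (simp add: homD(1)[OF F])

text \<open>Homogeneity makes the index set in \<open>x_deriv\<close> finite; over an infinite index
  set that sum would be 0 by convention.\<close>

lemma coeff_x_deriv:
  assumes F: "F \<in> hom k w"
  shows "coeff (x_deriv c i F m) a = pd i (\<lambda>m. coeff (F m) a) m"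
proof -
  let ?A = "{a. pd i (\<lambda>m. coeff (F m) a) m \<noteq> 0}"
  have "pd i (\<lambda>m. coeff (F m) a) m = 0" if "a \<notin> monomials k w" for a
    using homD(5)[OF F that] by simp
  then have "finite ?A" by (intro finite_subset[OF _ finite_monomials[of k w]]) auto
  then show ?thesis
    by (auto simp: x_deriv_def coeff_gmono)
qed

lemma hom_x_deriv:
  assumes F: "F \<in> hom k w" and i: "i < n" shows "cderiv (Base i) F \<in> hom k w"
proof (rule homI)
  fix m a assume "m \<in> U" "coeff (cderiv (Base i) F m) a \<noteq> 0"
  then show "a \<in> monomials k w"
    using homD(5)[OF F, of a] by (cases "a \<in> monomials k w") (auto simp: coeff_x_deriv[OF F])
next
  fix a
  show "sm (\<lambda>m. coeff (cderiv (Base i) F m) a)"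
    using sm_pd[OF homD(3)[OF F] i] by (rule sm_cong) (simp add: coeff_x_deriv[OF F])
qed auto

lemma sg_fun: "sg k F m = sg k (F m)"
  by (simp add: sg_def)

lemma coeff_mult:
  assumes F: "F \<in> hom k w" and G: "G \<in> hom l v"
  shows "coeff (F m * G m) d = (\<Sum>a\<in>monomials k w. \<Sum>b\<in>monomials l v. if mono_mult a b = d
      then shuffle_sign (snd a) (snd b) * (coeff (F m) a * coeff (G m) b) else 0)"
  by (simp add: times_gpoly_superset[OF finite_monomials homD(2)[OF F] finite_monomials homD(2)[OF G]]
      coeff_gmono mult.assoc)

lemma hom_times:
  assumes F: "F \<in> hom k w" and G: "G \<in> hom l v" shows "F * G \<in> hom (k + l) (w + v)"
proof (rule homI)
  fix m d assume "coeff ((F * G) m) d \<noteq> 0"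
  then have "(\<Sum>a\<in>monomials k w. \<Sum>b\<in>monomials l v. if mono_mult a b = d
      then shuffle_sign (snd a) (snd b) * (coeff (F m) a * coeff (G m) b) else 0) \<noteq> 0"
    by (simp add: coeff_mult[OF F G])
  then obtain a where a: "a \<in> monomials k w" "(\<Sum>b\<in>monomials l v. if mono_mult a b = d
      then shuffle_sign (snd a) (snd b) * (coeff (F m) a * coeff (G m) b) else 0) \<noteq> 0"
    by (rule sum.not_neutral_contains_not_neutral)
  from this(2) obtain b where b: "b \<in> monomials l v" "(if mono_mult a b = d
      then shuffle_sign (snd a) (snd b) * (coeff (F m) a * coeff (G m) b) else 0) \<noteq> 0"
    by (rule sum.not_neutral_contains_not_neutral)
  then have "mono_mult a b = d" "snd a |\<inter>| snd b = {||}"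
    by (auto simp: shuffle_sign_def split: if_splits)
  then show "d \<in> monomials (k + l) (w + v)" using monomials_mult a b by blast
next
  fix d
  show "sm (\<lambda>m. coeff ((F * G) m) d)"
    by (simp add: coeff_mult[OF F G])
       (intro sm_sum sm_if sm_mult sm_const homD(3)[OF F] homD(3)[OF G])
qed (simp add: homD(1)[OF F])

lemma x_deriv_mult:
  assumes F: "F \<in> hom k w" and G: "G \<in> hom l v" and i: "i < n"
  shows "cderiv (Base i) (F * G) = cderiv (Base i) F * G + F * cderiv (Base i) G"
proof (rule hom_eqI)
  show "cderiv (Base i) (F * G) \<in> hom (k + l) (w + v)"
    by (intro hom_x_deriv hom_times F G i)
  show "cderiv (Base i) F * G + F * cderiv (Base i) G \<in> hom (k + l) (w + v)"
  proof (rule homI)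
    fix m a assume "coeff ((cderiv (Base i) F * G + F * cderiv (Base i) G) m) a \<noteq> 0"
    then show "a \<in> monomials (k + l) (w + v)"
      using homD(5)[OF hom_times[OF hom_x_deriv[OF F i] G]] homD(5)[OF hom_times[OF F hom_x_deriv[OF G i]]]
      by fastforce
  next
    fix a show "sm (\<lambda>m. coeff ((cderiv (Base i) F * G + F * cderiv (Base i) G) m) a)"
      using sm_add[OF homD(3)[OF hom_times[OF hom_x_deriv[OF F i] G]] homD(3)[OF hom_times[OF F hom_x_deriv[OF G i]]]]
      by simp
  qed (simp add: homD(1)[OF F] homD(1)[OF G])
  fix m assume m: "m \<in> U"
  have "coeff (x_deriv c i (F * G) m) d =
      coeff (x_deriv c i F m * G m + F m * x_deriv c i G m) d" for d
  proof -
    have sm1: "sm (\<lambda>m. coeff (F m) a * coeff (G m) b)" for a b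
      by (intro sm_mult homD(3)[OF F] homD(3)[OF G])
    have pd1: "pd i (\<lambda>m. if mono_mult a b = d
        then shuffle_sign (snd a) (snd b) * (coeff (F m) a * coeff (G m) b) else 0) m =
      (if mono_mult a b = d then shuffle_sign (snd a) (snd b) *
         (coeff (cderiv (Base i) F m) a * coeff (G m) b) else 0) +
      (if mono_mult a b = d then shuffle_sign (snd a) (snd b) *
         (coeff (F m) a * coeff (cderiv (Base i) G m) b) else 0)" for a b
      using pd_cmult[OF sm1 i m] pd_mult[OF homD(3)[OF F] homD(3)[OF G] i m]
      by (simp add: m coeff_x_deriv[OF F] coeff_x_deriv[OF G] distrib_left)
    have "coeff (x_deriv c i (F * G) m) d = pd i (\<lambda>m. coeff (F m * G m) d) m"
      by (simp add: coeff_x_deriv[OF hom_times[OF F G]])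
    also have "\<dots> = coeff (cderiv (Base i) F m * G m) d + coeff (F m * cderiv (Base i) G m) d"
      unfolding coeff_mult[OF F G] coeff_mult[OF hom_x_deriv[OF F i] G]
        coeff_mult[OF F hom_x_deriv[OF G i]]
      by (subst pd_sum[OF _ i m], intro sm_sum sm_if sm_mult sm_const homD(3)[OF F] homD(3)[OF G],
          subst pd_sum[OF _ i m], intro sm_sum sm_if sm_mult sm_const homD(3)[OF F] homD(3)[OF G],
          simp only: pd1 sum.distrib)
    finally show ?thesis using m by simp
  qed
  then show "cderiv (Base i) (F * G) m = (cderiv (Base i) F * G + F * cderiv (Base i) G) m"
    using m by (simp add: gpoly_eq_iff)
qed

text \<open>The weights \<open>u\<close> do not depend on the base point. Momentum and odd
  derivatives are covered at once.\<close>

lemma x_deriv_mono_map: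
  assumes F: "F \<in> hom k w" and i: "i < n" and H: "(\<lambda>m. mono_map \<phi> u (F m)) \<in> hom k' w'"
  shows "cderiv (Base i) (\<lambda>m. mono_map \<phi> u (F m)) = (\<lambda>m. mono_map \<phi> u (cderiv (Base i) F m))"
proof
  fix m
  have "coeff (x_deriv c i (\<lambda>m. mono_map \<phi> u (F m)) m) b = coeff (mono_map \<phi> u (x_deriv c i F m)) b"
    if m: "m \<in> U" for b
  proof -
    have pd1: "pd i (\<lambda>m. if \<phi> a = b then u a * coeff (F m) a else 0) m =
        (if \<phi> a = b then u a * coeff (cderiv (Base i) F m) a else 0)" for a
      using pd_cmult[OF homD(3)[OF F] i m] m by (simp add: coeff_x_deriv[OF F])
    have "coeff (x_deriv c i (\<lambda>m. mono_map \<phi> u (F m)) m) b =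
        pd i (\<lambda>m. \<Sum>a\<in>monomials k w. if \<phi> a = b then u a * coeff (F m) a else 0) m"
      unfolding coeff_x_deriv[OF H] coeff_mono_map[OF finite_monomials homD(2)[OF F]] ..
    also have "\<dots> = coeff (mono_map \<phi> u (cderiv (Base i) F m)) b"
      unfolding coeff_mono_map[OF finite_monomials homD(2)[OF hom_x_deriv[OF F i]]]
      by (subst pd_sum[OF _ i m], intro sm_sum sm_if sm_mult sm_const homD(3)[OF F], simp only: pd1)
    finally show ?thesis using m by simp
  qed
  then show "cderiv (Base i) (\<lambda>m. mono_map \<phi> u (F m)) m = mono_map \<phi> u (cderiv (Base i) F m)"
    by (simp add: gpoly_eq_iff)
qed

end

lemma sum_even_odd: "(\<Sum>s<2 * k. f s) = (\<Sum>\<alpha><k. f (2 * \<alpha>) + f (Suc (2 * \<alpha>)))"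
  for f :: "nat \<Rightarrow> 'a::comm_monoid_add"
  by (induction k) (simp_all add: add.assoc)

lemma sum_fun_apply: "(\<Sum>i\<in>A. f i) m = (\<Sum>i\<in>A. f i m)"
  by (induction A rule: infinite_finite_induct) simp_all

section \<open>The chart as an instance of the abstract Poisson algebra\<close>

context bundle_chart
begin

lemma monomials_remove_momentum:
  assumes "a \<in> monomials k w" "count (fst a) i \<noteq> 0"
  shows "(fst a - {#i#}, snd a) \<in> monomials (k - 2) w"
proof -
  have "i \<in># fst a" using assms(2) by (simp add: not_in_iff)
  then obtain P where "fst a = add_mset i P" by (rule mset_add)
  then show ?thesis
    using assms(1) by (auto simp: monomials_def mono_degree_def mono_weight_def)
qed

lemma monomials_remove_odd:
  assumes "a \<in> monomials k w" "s |\<in>| snd a"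
  shows "(fst a, snd a |-| {|s|}) \<in> monomials (k - 1) (w - (if even s then 1 else - 1))"
proof -
  have "fcard (snd a) = Suc (fcard (snd a |-| {|s|}))"
    using assms(2) by (metis fcard_Suc_fminus1)
  moreover have "mono_weight a = (if even s then 1 else - 1) + mono_weight (fst a, snd a |-| {|s|})"
    using assms(2) unfolding mono_weight_def
    by (simp add: sum.remove[of "fset (snd a)" s] minus_fset.rep_eq)
  moreover have "fset (snd a |-| {|s|}) \<subseteq> fset (snd a)" by auto
  ultimately show ?thesis
    using assms(1) unfolding monomials_def mono_degree_def by auto
qed

lemma cderiv_hom:
  assumes "a \<in> coordinates" "F \<in> hom k w"
  shows "cderiv a F \<in> hom (k - coordinate_degree a) (w - coordinate_weight a)"
proof (cases a)
  case (Base i)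
  then show ?thesis using assms hom_x_deriv[of F k w i] by (auto simp: coordinates_def)
next
  case (Mom i)
  have "(\<lambda>m. p_deriv i (F m)) \<in> hom (k - 2) w"
    unfolding p_deriv_mono_map
    using assms(2) by (rule hom_mono_map) (rule monomials_remove_momentum, simp_all)
  then show ?thesis using Mom by simp
next
  case (Odd s)
  have "(\<lambda>m. left_deriv s (F m)) \<in> hom (k - 1) (w - (if even s then 1 else - 1))"
    unfolding left_deriv_mono_map
    using assms(2) by (rule hom_mono_map) (rule monomials_remove_odd, auto simp: odd_sign_def split: if_splits)
  then show ?thesis using Odd by simp
qed

lemma hom_plus:
  assumes F: "F \<in> hom k w" and G: "G \<in> hom k w" shows "F + G \<in> hom k w"
proof (rule homI)
  fix m a assume "coeff ((F + G) m) a \<noteq> 0"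
  then show "a \<in> monomials k w" using homD(5)[OF F] homD(5)[OF G] by fastforce
next
  fix a show "sm (\<lambda>m. coeff ((F + G) m) a)"
    using sm_add[OF homD(3)[OF F] homD(3)[OF G]] by simp
qed (simp add: homD(1)[OF F] homD(1)[OF G])

lemma hom_minus:
  assumes F: "F \<in> hom k w" shows "- F \<in> hom k w"
proof (rule homI)
  fix m a assume "coeff ((- F) m) a \<noteq> 0"
  then show "a \<in> monomials k w" using homD(5)[OF F] by fastforce
next
  fix a show "sm (\<lambda>m. coeff ((- F) m) a)"
    using sm_uminus[OF homD(3)[OF F]] by simp
qed (simp add: homD(1)[OF F])

lemma cderiv_add:
  assumes a: "a \<in> coordinates" and F: "F \<in> hom k w" and G: "G \<in> hom k w"
  shows "cderiv a (F + G) = cderiv a F + cderiv a G"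
proof (cases a)
  case (Base i)
  then have i: "i < n" using a by (auto simp: coordinates_def)
  show ?thesis
  proof
    fix m
    show "cderiv a (F + G) m = (cderiv a F + cderiv a G) m"
      using pd_add[OF homD(3)[OF F] homD(3)[OF G] i]
      by (simp add: Base gpoly_eq_iff coeff_x_deriv[OF hom_plus[OF F G]] coeff_x_deriv[OF F] coeff_x_deriv[OF G])
  qed
qed (auto simp: fun_eq_iff p_deriv_mono_map left_deriv_mono_map mono_map_add)

lemma cderiv_mult:
  assumes a: "a \<in> coordinates" and F: "F \<in> hom k w" and G: "G \<in> hom l v"
  shows "cderiv a (F * G) = cderiv a F * G + sg (coordinate_degree a * k) (F * cderiv a G)"
proof (cases a)
  case (Base i)
  then show ?thesis using a x_deriv_mult[OF F G] by (auto simp: coordinates_def sg_def)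
next
  case (Mom i)
  then show ?thesis by (auto simp: fun_eq_iff p_deriv_mult sg_def)
next
  case (Odd s)
  then show ?thesis
    by (auto simp: fun_eq_iff left_deriv_mult sg_fun grade_inv_parity[OF hom_parity[OF F]] sg_mult_left)
qed

lemma cderiv_commute_Base:
  assumes i: "i < n" and a: "a \<in> coordinates" and F: "F \<in> hom k w"
  shows "cderiv (Base i) (cderiv a F) = cderiv a (cderiv (Base i) F)"
proof (cases a)
  case (Base j)
  then have j: "j < n" using a by (auto simp: coordinates_def)
  have "x_deriv c i (cderiv (Base j) F) m = x_deriv c j (cderiv (Base i) F) m" if m: "m \<in> U" for m
  proof -
    have "pd i (\<lambda>m. coeff (cderiv (Base j) F m) a) m = pd i (pd j (\<lambda>m. coeff (F m) a)) m" if "i < n" for i j a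
      by (rule pd_cong[OF _ m that]) (simp add: coeff_x_deriv[OF F])
    then show ?thesis
      using pd_commute[OF homD(3)[OF F] i j m] i j
      by (simp only: gpoly_eq_iff coeff_x_deriv[OF hom_x_deriv[OF F j]] coeff_x_deriv[OF hom_x_deriv[OF F i]])
        simp
  qed
  then show ?thesis using Base by (auto simp: fun_eq_iff)
next
  case (Mom j)
  have H: "(\<lambda>m. p_deriv j (F m)) \<in> hom (k - 2) w"
    using cderiv_hom[OF a F] Mom by simp
  show ?thesis
    using x_deriv_mono_map[OF F i H[unfolded p_deriv_mono_map]] Mom by (simp add: p_deriv_mono_map)
next
  case (Odd s)
  have H: "(\<lambda>m. left_deriv s (F m)) \<in> hom (k - 1) (w - (if even s then 1 else - 1))"
    using cderiv_hom[OF a F] Odd by simp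
  show ?thesis
    using x_deriv_mono_map[OF F i H[unfolded left_deriv_mono_map]] Odd by (simp add: left_deriv_mono_map)
qed

lemma cderiv_commute:
  assumes a: "a \<in> coordinates" and b: "b \<in> coordinates" and F: "F \<in> hom k w"
  shows "cderiv a (cderiv b F) = sg (coordinate_degree a * coordinate_degree b) (cderiv b (cderiv a F))"
proof -
  consider i where "a = Base i" "i < n" | i where "b = Base i" "i < n" | i j where "a = Mom i" "b = Mom j" | i s where "a = Mom i" "b = Odd s"
    | s i where "a = Odd s" "b = Mom i" | s t where "a = Odd s" "b = Odd t"
    using a b by (cases a; cases b) (auto simp: coordinates_def)
  then show ?thesis
  proof cases
    case (1 i)
    show ?thesis
      unfolding 1(1) cderiv_commute_Base[OF 1(2) b F] by (simp add: sg_def)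
  next
    case (2 i)
    show ?thesis
      unfolding 2(1) cderiv_commute_Base[OF 2(2) a F] by (simp add: sg_def)
  next
    case (3 i j)
    show ?thesis unfolding 3 by (simp add: sg_def fun_eq_iff p_deriv_commute[of i j])
  next
    case (4 i s)
    then show ?thesis by (simp add: sg_def p_left_deriv_commute)
  next
    case (5 s i)
    then show ?thesis by (simp add: sg_def p_left_deriv_commute)
  next
    case (6 s t)
    show ?thesis unfolding 6 by (simp add: sg_def fun_eq_iff left_deriv_anticommute[of s t])
  qed
qed

lemma cderiv_right_eq:
  assumes F: "F \<in> hom k w"
  shows "cderiv_right a F = sg (coordinate_degree a * (k + 1)) (cderiv a F)"
  using right_deriv_parity[OF hom_parity[OF F]]
  by (cases a) (auto simp: fun_eq_iff sg_fun, auto simp: sg_def)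

sublocale P: poisson_algebra hom coordinates cderiv cderiv_right conjugate
  coordinate_sign coordinate_degree coordinate_weight
proof
  fix a b F G k w l v
  show "conjugate a \<in> coordinates" if "a \<in> coordinates"
    using that by (auto simp: coordinates_def elim!: oddE evenE)
  show "conjugate (conjugate a) = a" by (cases a) auto
  show "odd (coordinate_sign (conjugate a) + coordinate_sign a + coordinate_degree a)" by (cases a) auto
  show "coordinate_degree (conjugate a) = 2 - coordinate_degree a" by (cases a) auto
  show "coordinate_weight (conjugate a) = - coordinate_weight a" by (cases a) auto
  show "0 \<in> hom k w" by (rule homI) (auto simp: sm_const)
  show "F * G = sg (k * l) (G * F)" if "F \<in> hom k w" "G \<in> hom l v"
    using gpoly_mult_commute[OF hom_parity[OF that(1)] hom_parity[OF that(2)]]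
    by (simp add: fun_eq_iff sg_fun)
  show "cderiv_right a F = sg (coordinate_degree a * (k + 1)) (cderiv a F)" if "F \<in> hom k w"
    using that by (rule cderiv_right_eq)
qed (fact hom_plus hom_minus hom_times cderiv_hom cderiv_add cderiv_mult cderiv_commute)+

lemma sum_coordinates:
  fixes h :: "coordinate \<Rightarrow> 'a::comm_monoid_add"
  shows "(\<Sum>a\<in>coordinates. h a) = (\<Sum>i<n. h (Base i)) + (\<Sum>i<n. h (Mom i)) + (\<Sum>s<2 * r. h (Odd s))"
proof -
  have "(\<Sum>a\<in>coordinates. h a) = sum h (Base ` {..<n} \<union> Mom ` {..<n}) + sum h (Odd ` {..<2 * r})"
    unfolding coordinates_def by (rule sum.union_disjoint) auto
  also have "sum h (Base ` {..<n} \<union> Mom ` {..<n}) = sum h (Base ` {..<n}) + sum h (Mom ` {..<n})"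
    by (rule sum.union_disjoint) auto
  finally show ?thesis
    by (simp add: sum.reindex inj_on_def)
qed

lemma br_apply:
  assumes m: "m \<in> U" shows "P.br F G m = local_bracket B c F G m"
proof -
  have "P.br F G m = (\<Sum>a\<in>coordinates. sg (coordinate_sign a)
      (cderiv_right a F m * cderiv (conjugate a) G m))"
    by (simp add: P.br_def sum_fun_apply sg_fun)
  also have "\<dots> = (\<Sum>i<n. x_deriv c i F m * p_deriv i (G m)) + (\<Sum>i<n. - (p_deriv i (F m) * x_deriv c i G m)) +
      (\<Sum>s<2 * r. right_deriv s (F m) * left_deriv (if even s then Suc s else s - 1) (G m))"
    unfolding sum_coordinates by (simp add: sg_def m)
  also have "\<dots> = local_bracket B c F G m"
    unfolding local_bracket_def sum_even_odd by (simp add: sum_subtractf sum_negf)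
  finally show ?thesis .
qed

lemma br_outside:
  assumes "m \<notin> U" "F m = 0" shows "P.br F G m = 0"
proof -
  have "cderiv_right a F m = 0" for a
    using assms by (cases a) (auto simp: p_deriv_mono_map right_deriv_mono_map)
  then show ?thesis by (simp add: P.br_def sum_fun_apply sg_fun)
qed

text \<open>Off the domain the global bracket is 0 by definition, whereas \<open>P.br\<close> is a
  formula valid at all points; vanishing of the first argument there closes the gap.\<close>

lemma big_bracket_chart:
  assumes "\<And>m. m \<notin> U \<Longrightarrow> F c m = 0"
  shows "big_bracket B F G c = P.br (F c) (G c)"
  using br_apply br_outside assms by (auto simp: big_bracket_def c_in fun_eq_iff)

text \<open>N and \<omega> have different weights, so their sum lies in no carrier
  \<open>hom k w\<close>. Base derivatives remain additive, because the union of two finite sets of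
  monomials is finite.\<close>

lemma cderiv_add_mixed:
  assumes F: "F \<in> hom k w" and G: "G \<in> hom l v" and a: "a \<in> coordinates"
  shows "cderiv a (F + G) = cderiv a F + cderiv a G"
proof (cases a)
  case (Base i)
  then have i: "i < n" using a by (auto simp: coordinates_def)
  have "x_deriv c i (F + G) m = x_deriv c i F m + x_deriv c i G m" if m: "m \<in> U" for m
  proof -
    have pd: "pd i (\<lambda>m. coeff ((F + G) m) d) m = pd i (\<lambda>m. coeff (F m) d) m + pd i (\<lambda>m. coeff (G m) d) m" for d
      using pd_add[OF homD(3)[OF F] homD(3)[OF G] i m] by simp
    have "pd i (\<lambda>m. coeff (F m) d) m = 0" if "d \<notin> monomials k w" for d
      using homD(5)[OF F that] by simp
    moreover have "pd i (\<lambda>m. coeff (G m) d) m = 0" if "d \<notin> monomials l v" for d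
      using homD(5)[OF G that] by simp
    ultimately have "{d. pd i (\<lambda>m. coeff ((F + G) m) d) m \<noteq> 0} \<subseteq> monomials k w \<union> monomials l v"
      using pd by fastforce
    then have fin: "finite {d. pd i (\<lambda>m. coeff ((F + G) m) d) m \<noteq> 0}"
      by (rule finite_subset) simp
    have "coeff (x_deriv c i (F + G) m) d = pd i (\<lambda>m. coeff ((F + G) m) d) m" for d
      using fin by (auto simp: x_deriv_def coeff_gmono)
    then show ?thesis
      by (simp add: gpoly_eq_iff coeff_x_deriv[OF F] coeff_x_deriv[OF G] pd del: plus_fun_apply)
  qed
  then show ?thesis using Base by (auto simp: fun_eq_iff)
qed (auto simp: fun_eq_iff p_deriv_mono_map left_deriv_mono_map mono_map_add)

lemma br_add_mixed:
  assumes F: "F \<in> hom k w" and G: "G \<in> hom l v"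
  shows "P.br (F + G) H = P.br F H + P.br G H" "P.br H (F + G) = P.br H F + P.br H G"
proof -
  have "cderiv_right a (F + G) = cderiv_right a F + cderiv_right a G" if "a \<in> coordinates" for a
    using cderiv_add_mixed[OF F G that] by (cases a) (auto simp: fun_eq_iff right_deriv_mono_map mono_map_add)
  then show "P.br (F + G) H = P.br F H + P.br G H"
    unfolding P.br_def sum.distrib[symmetric]
    by (intro sum.cong refl) (simp add: sg_add distrib_right)
  show "P.br H (F + G) = P.br H F + P.br H G"
    unfolding P.br_def sum.distrib[symmetric]
    by (intro sum.cong refl) (simp add: sg_add distrib_left cderiv_add_mixed[OF F G P.dual_in])
qed

end

section \<open>Frames of the bundle and of its double\<close>

text \<open>\<open>star\<close> exchanges the numbers of $\tau^\alpha$ and $\theta_\alpha$.\<close>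

definition star :: "nat \<Rightarrow> nat" where "star s = (if even s then Suc s else s - 1)"

lemma star_star [simp]: "star (star s) = s"
  by (auto simp: star_def elim: oddE)

lemma star_less [simp]: "star s < 2 * k \<longleftrightarrow> s < 2 * k"
  by (auto simp: star_def elim!: evenE oddE)

lemma even_star [simp]: "even (star s) \<longleftrightarrow> odd s"
  by (auto simp: star_def)

lemma sum_star: "(\<Sum>s<2 * k. f (star s)) = (\<Sum>s<2 * k. f s)"
  by (rule sum.reindex_bij_witness[of _ star star]) auto

text \<open>The empty index set is used repeatedly to conclude that \<open>f 0\<close> is 0.\<close>

lemma linear_on_fibre_sum:
  assumes f: "linear_on_fibre W f" and W: "subspace W" and x: "\<And>i. i \<in> A \<Longrightarrow> x i \<in> W"
  shows "f (\<Sum>i\<in>A. a i *\<^sub>R x i) = (\<Sum>i\<in>A. a i *\<^sub>R f (x i))"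
proof -
  have zero: "f 0 = 0"
    using f subspace_0[OF W] unfolding linear_on_fibre_def by (metis add_0 scaleR_zero_left)
  have add: "f (b *\<^sub>R y + z) = b *\<^sub>R f y + f z" if "y \<in> W" "z \<in> W" for b y z
    using f that unfolding linear_on_fibre_def by (metis scaleR_one)
  show ?thesis
    using x
  proof (induction A rule: infinite_finite_induct)
    case (insert i A)
    have "(\<Sum>i\<in>A. a i *\<^sub>R x i) \<in> W"
      using insert.prems by (intro subspace_sum[OF W] subspace_scale[OF W]) auto
    then show ?case using insert add[of "x i" "\<Sum>i\<in>A. a i *\<^sub>R x i"] by simp
  qed (simp_all add: zero)
qed

context bundle_chart
begin

lemma frame_facts:
  assumes "m \<in> U"
  shows "m \<in> topspace (base B)" "subspace (fibre B m)"
    "inj_on (\<lambda>\<alpha>. frame c \<alpha> m) {..<r}" "independent ((\<lambda>\<alpha>. frame c \<alpha> m) ` {..<r})"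
    "span ((\<lambda>\<alpha>. frame c \<alpha> m) ` {..<r}) = fibre B m"
proof -
  show "m \<in> topspace (base B)" using vb c_in assms by (auto simp: vector_bundle_def)
  then show "subspace (fibre B m)" using vb by (auto simp: vector_bundle_def)
qed (use vb c_in assms in \<open>auto simp: vector_bundle_def\<close>)

lemma frame_in: "m \<in> U \<Longrightarrow> \<alpha> < r \<Longrightarrow> frame c \<alpha> m \<in> fibre B m"
  using frame_facts(5)[of m] span_base[of "frame c \<alpha> m" "(\<lambda>\<alpha>. frame c \<alpha> m) ` {..<r}"] by auto

lemma coframe_frame:
  assumes "m \<in> U" "\<alpha> < r" "\<beta> < r"
  shows "coframe B c \<alpha> m (frame c \<beta> m) = (if \<alpha> = \<beta> then 1 else 0)"
  using assms frame_facts(4)[OF assms(1)] inj_onD[OF frame_facts(3)[OF assms(1)], of \<alpha> \<beta>]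
  by (auto simp: coframe_def representation_basis)

lemma coframe_dual:
  assumes m: "m \<in> U" shows "coframe B c \<alpha> m \<in> dual_fibre B m"
proof -
  note ind = frame_facts(4)[OF m] and sp = frame_facts(5)[OF m] and sub = frame_facts(2)[OF m]
  have "coframe B c \<alpha> m (a *\<^sub>R x + b *\<^sub>R y) = a *\<^sub>R coframe B c \<alpha> m x + b *\<^sub>R coframe B c \<alpha> m y"
    if "x \<in> fibre B m" "y \<in> fibre B m" for a b x y
    using that ind sp sub
    by (simp add: coframe_def representation_add representation_scale subspace_scale)
  moreover have "coframe B c \<alpha> m v = 0" if "v \<notin> fibre B m" for v
    using that sp by (simp add: coframe_def representation_def)
  ultimately show ?thesis
    by (simp add: dual_fibre_def linear_on_fibre_def)
qed

lemma frame_expand: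
  assumes m: "m \<in> U" and v: "v \<in> fibre B m"
  shows "(\<Sum>\<alpha><r. coframe B c \<alpha> m v *\<^sub>R frame c \<alpha> m) = v"
proof -
  let ?b = "(\<lambda>\<alpha>. frame c \<alpha> m) ` {..<r}"
  have "(\<Sum>b\<in>?b. representation ?b v b *\<^sub>R b) = v"
    using frame_facts(4,5)[OF m] v by (intro sum_representation_eq) auto
  then show ?thesis
    using frame_facts(3)[OF m] by (simp add: sum.reindex coframe_def)
qed

lemma dual_zero: "\<xi> \<in> dual_fibre B m \<Longrightarrow> m \<in> topspace (base B) \<Longrightarrow> \<xi> 0 = 0"
  using linear_on_fibre_sum[of "fibre B m" \<xi> "{}"] vb
  by (auto simp: dual_fibre_def vector_bundle_def)

lemma dual_expand:
  assumes m: "m \<in> U" and \<xi>: "\<xi> \<in> dual_fibre B m" and v: "v \<in> fibre B m"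
  shows "\<xi> v = (\<Sum>\<alpha><r. coframe B c \<alpha> m v * \<xi> (frame c \<alpha> m))"
proof -
  have "\<xi> (\<Sum>\<alpha><r. coframe B c \<alpha> m v *\<^sub>R frame c \<alpha> m) = (\<Sum>\<alpha><r. coframe B c \<alpha> m v *\<^sub>R \<xi> (frame c \<alpha> m))"
    using \<xi> frame_in[OF m] frame_facts(2)[OF m]
    by (intro linear_on_fibre_sum[of "fibre B m"]) (auto simp: dual_fibre_def)
  then show ?thesis by (simp add: frame_expand[OF m v])
qed

lemma E_frame_in:
  assumes m: "m \<in> U" and s: "s < 2 * r" shows "E_frame B c m s \<in> E_fibre B m"
proof -
  have "(0 :: 'v \<Rightarrow> real) \<in> dual_fibre B m" by (auto simp: dual_fibre_def linear_on_fibre_def)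
  moreover have "s div 2 < r" using s by auto
  ultimately show ?thesis
    using coframe_dual[OF m] frame_in[OF m] subspace_0[OF frame_facts(2)[OF m]]
    by (auto simp: E_frame_def E_fibre_def)
qed

lemma pairing_frame:
  assumes "\<alpha> < r" "m \<in> U" "u \<in> E_fibre B m"
  shows "pairing u (E_frame B c m (2 * \<alpha>)) = coframe B c \<alpha> m (fst u)"
    "pairing u (E_frame B c m (Suc (2 * \<alpha>))) = snd u (frame c \<alpha> m)"
  using assms dual_zero[of "snd u" m] frame_facts(1)[of m] by (auto simp: pairing_def E_frame_def E_fibre_def)

lemma pairing_commute: "pairing u v = pairing v u"
  by (simp add: pairing_def)

text \<open>Under the pairing, the frame vector dual to number \<open>s\<close> is the one with
  number \<open>star s\<close>. This is the resulting completeness relation, which removes the sums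
  in every change of frame.\<close>

lemma pairing_expand:
  assumes m: "m \<in> U" and u: "u \<in> E_fibre B m" and v: "v \<in> E_fibre B m"
  shows "(\<Sum>s<2 * r. pairing u (E_frame B c m (star s)) * pairing (E_frame B c m s) v) = pairing u v"
proof -
  have "(\<Sum>s<2 * r. pairing u (E_frame B c m (star s)) * pairing (E_frame B c m s) v) =
     (\<Sum>\<alpha><r. snd u (frame c \<alpha> m) * coframe B c \<alpha> m (fst v) + coframe B c \<alpha> m (fst u) * snd v (frame c \<alpha> m))"
    unfolding sum_even_odd
    by (intro sum.cong refl)
       (simp add: star_def pairing_commute[of "E_frame B c m _" v] pairing_frame m u v)
  also have "\<dots> = snd u (fst v) + snd v (fst u)"
    using u v dual_expand[OF m, of "snd u" "fst v"] dual_expand[OF m, of "snd v" "fst u"]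
    by (auto simp: E_fibre_def sum.distrib mult.commute)
  finally show ?thesis by (simp add: pairing_def)
qed

lemma pairing_frame_frame:
  assumes "m \<in> U" "s < 2 * r" "t < 2 * r"
  shows "pairing (E_frame B c m s) (E_frame B c m (star t)) = (if s = t then 1 else 0)"
proof -
  obtain \<alpha> \<beta> where ab: "s = 2 * \<alpha> \<or> s = Suc (2 * \<alpha>)" "t = 2 * \<beta> \<or> t = Suc (2 * \<beta>)" "\<alpha> < r" "\<beta> < r"
    using assms by (metis Suc_lessD nat_mult_less_cancel_disj oddE evenE Suc_eq_plus1)
  show ?thesis
    using ab(1,2) coframe_frame[OF assms(1) ab(3,4)] coframe_frame[OF assms(1) ab(4,3)]
      dual_zero[OF coframe_dual[OF assms(1)] frame_facts(1)[OF assms(1)]]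
    by (auto simp: pairing_def E_frame_def star_def) presburger+
qed

lemma E_to_gpoly_eq:
  assumes "m \<in> U" "v \<in> E_fibre B m"
  shows "E_to_gpoly B c m v = (\<Sum>s<2 * r. pairing v (E_frame B c m (star s)) *\<^sub>R odd_gen s)"
  unfolding E_to_gpoly_def sum_even_odd
  by (intro sum.cong refl) (simp add: star_def pairing_frame assms add.commute)

text \<open>The odd coordinates of a chart correspond to its frame vectors of E, so their
  substitution is the expansion of one frame in the other.\<close>

lemma odd_image_eq: "m \<in> U \<Longrightarrow> m \<in> cdom c' \<Longrightarrow> odd_image B c c' m s = E_to_gpoly B c m (E_frame B c' m s)"
  using dual_zero[OF coframe_dual frame_facts(1)]
  by (auto simp: odd_image_def E_to_gpoly_def E_frame_def)

lemma gpoly_to_E_in: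
  assumes m: "m \<in> U" shows "gpoly_to_E B c m F \<in> E_fibre B m"
proof -
  have "(\<lambda>v. \<Sum>\<alpha><r. coeff F ({#}, {|tau_ix \<alpha>|}) * coframe B c \<alpha> m v) \<in> dual_fibre B m"
    using coframe_dual[OF m]
    by (auto simp: dual_fibre_def linear_on_fibre_def algebra_simps sum.distrib sum_distrib_left)
  moreover have "(\<Sum>\<alpha><r. coeff F ({#}, {|theta_ix \<alpha>|}) *\<^sub>R frame c \<alpha> m) \<in> fibre B m"
    using frame_facts(2)[OF m] frame_in[OF m] by (intro subspace_sum subspace_scale) auto
  ultimately show ?thesis by (simp add: gpoly_to_E_def E_fibre_def)
qed

lemma pairing_gpoly_to_E:
  assumes m: "m \<in> U" and w: "w \<in> E_fibre B m"
  shows "pairing (gpoly_to_E B c m F) w = (\<Sum>s<2 * r. coeff F ({#}, {|s|}) * pairing (E_frame B c m s) w)"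
proof -
  have lin: "linear_on_fibre (fibre B m) (snd w)" using w by (auto simp: E_fibre_def dual_fibre_def)
  have "snd w (\<Sum>\<alpha><r. coeff F ({#}, {|theta_ix \<alpha>|}) *\<^sub>R frame c \<alpha> m) =
      (\<Sum>\<alpha><r. coeff F ({#}, {|theta_ix \<alpha>|}) *\<^sub>R snd w (frame c \<alpha> m))"
    using frame_in[OF m] by (intro linear_on_fibre_sum[OF lin frame_facts(2)[OF m]]) auto
  moreover have "(\<Sum>s<2 * r. coeff F ({#}, {|s|}) * pairing (E_frame B c m s) w) =
      (\<Sum>\<alpha><r. coeff F ({#}, {|2 * \<alpha>|}) * coframe B c \<alpha> m (fst w) +
        coeff F ({#}, {|theta_ix \<alpha>|}) * snd w (frame c \<alpha> m))"
    unfolding sum_even_odd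
    by (intro sum.cong refl) (simp add: pairing_commute[of "E_frame B c m _" w] pairing_frame m w)
  ultimately show ?thesis
    by (simp add: pairing_def gpoly_to_E_def sum.distrib)
qed

end

section \<open>Skew-symmetric endomorphisms as functions of degree two\<close>

lemma change_coords_superset:
  assumes "finite A" "supp F \<subseteq> A"
  shows "change_coords B c c' m F = (\<Sum>a\<in>A. coeff F a *\<^sub>R
     (prod_list (map (p_image B c c' m) (sorted_list_of_multiset (fst a))) *
      prod_list (map (odd_image B c c' m) (sorted_list_of_fset (snd a)))))"
  unfolding change_coords_def using assms by (intro sum.mono_neutral_left) (auto simp: supp_def)

lemma additive_change_coords: "Modules.additive (change_coords B c c' m)"
proof
  fix F G
  let ?A = "supp F \<union> supp G \<union> supp (F + G)"
  have sub: "supp F \<subseteq> ?A" "supp G \<subseteq> ?A" "supp (F + G) \<subseteq> ?A" by auto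
  have fin: "finite ?A" by simp
  show "change_coords B c c' m (F + G) = change_coords B c c' m F + change_coords B c c' m G"
    unfolding change_coords_superset[OF fin sub(1)] change_coords_superset[OF fin sub(2)]
      change_coords_superset[OF fin sub(3)]
    by (simp add: scaleR_add_left sum.distrib)
qed

lemmas change_coords_sum = Modules.additive.sum[OF additive_change_coords]
  and change_coords_zero [simp] = Modules.additive.zero[OF additive_change_coords]
  and change_coords_minus = Modules.additive.minus[OF additive_change_coords]

lemma change_coords_scaleR: "change_coords B c c' m (x *\<^sub>R F) = x *\<^sub>R change_coords B c c' m F"
proof -
  have "supp (x *\<^sub>R F) \<subseteq> supp F" by (auto simp: supp_def)
  from change_coords_superset[OF finite_supp this] show ?thesis
    by (simp add: change_coords_def scaleR_sum_right)
qed

lemma change_coords_gmono: "change_coords B c c' m (gmono a x) = x *\<^sub>R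
     (prod_list (map (p_image B c c' m) (sorted_list_of_multiset (fst a))) *
      prod_list (map (odd_image B c c' m) (sorted_list_of_fset (snd a))))"
  by (subst change_coords_superset[of "{a}"]) (auto simp: supp_def coeff_gmono split: if_splits)

lemma change_coords_odd_gen: "change_coords B c c' m (odd_gen s) = odd_image B c c' m s"
  by (simp add: odd_gen_def change_coords_gmono sorted_list_of_fset.rep_eq)

lemma coeff_odd_gen: "coeff (odd_gen s) a = (if a = ({#}, {|s|}) then 1 else 0)"
  by (auto simp: odd_gen_def coeff_gmono)

lemma parity_odd_gen: "gpoly_parity 1 (odd_gen s)"
  by (auto simp: gpoly_parity_def coeff_odd_gen split: if_splits)

lemma gpoly_parity_scaleR: "gpoly_parity k F \<Longrightarrow> gpoly_parity k (x *\<^sub>R F)"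
  unfolding gpoly_parity_def by auto

lemma gpoly_parity_sum: "(\<And>i. i \<in> A \<Longrightarrow> gpoly_parity k (f i)) \<Longrightarrow> gpoly_parity k (sum f A)"
  unfolding gpoly_parity_def coeff_sum by (metis (mono_tags, lifting) sum.neutral)

lemma parity_odd_image: "gpoly_parity 1 (odd_image B c c' m s)"
  unfolding odd_image_def
  by (cases "even s") (auto intro!: gpoly_parity_sum gpoly_parity_scaleR parity_odd_gen)

lemma odd_anticommute: "gpoly_parity 1 F \<Longrightarrow> gpoly_parity 1 G \<Longrightarrow> F * G = - (G * F)"
  using gpoly_mult_commute[of 1 F 1 G] by (simp add: sg_def)

lemma odd_square: "gpoly_parity 1 F \<Longrightarrow> F * F = 0"
proof -
  assume "gpoly_parity 1 F"
  then have "coeff (F * F) a = - coeff (F * F) a" for a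
    using odd_anticommute[of F F] by (metis coeff_uminus)
  then show ?thesis by (simp add: gpoly_eq_iff)
qed

lemma odd_gen_mult: "odd_gen s * odd_gen t = gmono ({#}, {|s, t|}) (shuffle_sign {|s|} {|t|})"
  by (simp add: odd_gen_def gmono_times_gmono mono_mult_def finsert_commute)

text \<open>The substitution is defined on increasing monomials. Both sides change sign when the
  factors are exchanged and vanish for equal factors, since the images are odd too.\<close>

lemma change_coords_odd_gen_mult:
  "change_coords B c c' m (odd_gen s * odd_gen t) = odd_image B c c' m s * odd_image B c c' m t"
proof -
  have ordered: "change_coords B c c' m (odd_gen s * odd_gen t) = odd_image B c c' m s * odd_image B c c' m t"
    if st: "s < t" for s t
  proof -
    have empty: "{(a, b). a |\<in>| {|s|} \<and> b |\<in>| {|t|} \<and> b < a} = {}" using st by auto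
    have "shuffle_sign {|s|} {|t|} = 1"
      unfolding shuffle_sign_def empty using st by simp
    moreover have "sorted_list_of_fset {|s, t|} = [s, t]"
      using st by (simp add: sorted_list_of_fset.rep_eq)
    ultimately show ?thesis by (simp add: odd_gen_mult change_coords_gmono)
  qed
  show ?thesis
  proof (cases s t rule: linorder_cases)
    case less
    then show ?thesis by (rule ordered)
  next
    case equal
    then show ?thesis by (simp add: odd_square parity_odd_gen parity_odd_image)
  next
    case greater
    then show ?thesis
      using ordered[OF greater] odd_anticommute[OF parity_odd_gen parity_odd_gen, of s t]
        odd_anticommute[OF parity_odd_image parity_odd_image, of B c c' m s B c c' m t]
      by (simp add: change_coords_minus)
  qed
qed

lemma left_deriv_odd_gen: "left_deriv t (odd_gen s) = (if s = t then 1 else 0)"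
proof -
  have "shuffle_sign {|s|} {||} = 1" by (simp add: shuffle_sign_def)
  then show ?thesis
    by (auto simp: left_deriv_mono_map odd_gen_def mono_map_gmono odd_sign_def one_gpoly_def)
qed

lemma right_deriv_odd_gen: "right_deriv t (odd_gen s) = (if s = t then 1 else 0)"
  using right_deriv_parity[OF parity_odd_gen] left_deriv_odd_gen by (simp add: sg_def)

lemma left_deriv_odd_gen_mult:
  "left_deriv t (odd_gen s * odd_gen q) = (if s = t then odd_gen q else 0) - (if q = t then odd_gen s else 0)"
  by (auto simp: left_deriv_mult left_deriv_odd_gen grade_inv_parity[OF parity_odd_gen] sg_def)

lemma p_deriv_sum: "p_deriv i (sum f A) = (\<Sum>j\<in>A. p_deriv i (f j))"
  unfolding p_deriv_mono_map by (rule mono_map_sum)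

lemma p_deriv_scaleR: "p_deriv i (x *\<^sub>R F) = x *\<^sub>R p_deriv i F"
  unfolding p_deriv_mono_map by (rule mono_map_scaleR)

lemma p_deriv_zero: "p_deriv i 0 = 0"
  unfolding p_deriv_mono_map by (rule mono_map_zero)

lemma p_deriv_odd_gen: "p_deriv i (odd_gen s) = 0"
  by (simp add: p_deriv_mono_map odd_gen_def mono_map_gmono)

lemma sum_scaleR_delta:
  "finite A \<Longrightarrow> (\<Sum>t\<in>A. f t *\<^sub>R (if t = s then x else 0)) = (if s \<in> A then f s *\<^sub>R x else (0 :: gpoly))"
  by (subst sum.cong[OF refl, of A _ "\<lambda>t. if t = s then f t *\<^sub>R x else 0"]) auto

lemma mono_degree_one:
  assumes "mono_degree a = 1" obtains s where "a = ({#}, {|s|})"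
proof -
  have "size (fst a) = 0 \<and> fcard (snd a) = 1" using assms unfolding mono_degree_def by arith
  then have "fst a = {#}" "fcard (snd a) = 1" by auto
  then show ?thesis
    using that by (metis card_1_singletonE fcard.rep_eq fset_inverse bot_fset.rep_eq finsert.rep_eq prod.collapse)
qed

text \<open>The quadratic function of the skew-symmetric form that pairs \<N> u with v, with its
  matrix taken in the dual frame, hence the \<open>star\<close>. Skew-symmetry lets each pair of
  generators occur twice, which the factor 1/2 compensates.\<close>

definition endo_gpoly :: "('m, 'v::real_vector) vbundle \<Rightarrow> ('m \<Rightarrow> 'v evec \<Rightarrow> 'v evec) \<Rightarrow>
    ('m, 'v) family" where
  "endo_gpoly B \<N> c m = (if c \<in> atlas B \<and> m \<in> cdom c then
     (1 / 2) *\<^sub>R (\<Sum>s<2 * fibre_dim B. \<Sum>t<2 * fibre_dim B.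
       pairing (\<N> m (E_frame B c m (star s))) (E_frame B c m (star t)) *\<^sub>R (odd_gen s * odd_gen t)) else 0)"

lemma sum_swap_pairs: "(\<Sum>s\<in>A. \<Sum>t\<in>A. \<Sum>p\<in>C. \<Sum>q\<in>C. f s t p q) =
    (\<Sum>p\<in>C. \<Sum>q\<in>C. \<Sum>s\<in>A. \<Sum>t\<in>A. f s t p q)"
proof -
  have "(\<Sum>s\<in>A. \<Sum>t\<in>A. \<Sum>p\<in>C. \<Sum>q\<in>C. f s t p q) = (\<Sum>s\<in>A. \<Sum>p\<in>C. \<Sum>t\<in>A. \<Sum>q\<in>C. f s t p q)"
    by (rule sum.cong[OF refl sum.swap])
  also have "\<dots> = (\<Sum>p\<in>C. \<Sum>s\<in>A. \<Sum>t\<in>A. \<Sum>q\<in>C. f s t p q)"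
    by (rule sum.swap)
  also have "\<dots> = (\<Sum>p\<in>C. \<Sum>s\<in>A. \<Sum>q\<in>C. \<Sum>t\<in>A. f s t p q)"
    by (rule sum.cong[OF refl sum.cong[OF refl sum.swap]])
  also have "\<dots> = (\<Sum>p\<in>C. \<Sum>q\<in>C. \<Sum>s\<in>A. \<Sum>t\<in>A. f s t p q)"
    by (rule sum.cong[OF refl sum.swap])
  finally show ?thesis .
qed

lemma skew_endoD:
  assumes "skew_endo B \<N>" "m \<in> topspace (base B)" "u \<in> E_fibre B m"
  shows "\<N> m u \<in> E_fibre B m" "v \<in> E_fibre B m \<Longrightarrow> pairing (\<N> m u) v = - pairing u (\<N> m v)"
  using assms by (auto simp: skew_endo_def add_eq_0_iff)

section \<open>The quadratic function attached to a skew-symmetric endomorphism\<close>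

context bundle_chart
begin

lemma degree_one_expand:
  assumes "\<And>a. coeff F a \<noteq> 0 \<Longrightarrow> fset (snd a) \<subseteq> {..<2 * r} \<and> mono_degree a = 1"
  shows "F = (\<Sum>s<2 * r. coeff F ({#}, {|s|}) *\<^sub>R odd_gen s)"
proof -
  have "coeff F a = (\<Sum>s<2 * r. coeff F ({#}, {|s|}) * (if a = ({#}, {|s|}) then 1 else 0))" for a
  proof (cases "\<exists>s<2 * r. a = ({#}, {|s|})")
    case True
    then obtain s where s: "s < 2 * r" "a = ({#}, {|s|})" by blast
    have "(\<Sum>t<2 * r. coeff F ({#}, {|t|}) * (if a = ({#}, {|t|}) then 1 else 0)) =
        (\<Sum>t<2 * r. if t = s then coeff F a else 0)"
      by (rule sum.cong) (auto simp: s)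
    then show ?thesis using s by simp
  next
    case False
    then have "coeff F a = 0"
      using assms[of a] by (metis mono_degree_one finsert.rep_eq insert_subset lessThan_iff snd_conv)
    then show ?thesis using False by (auto intro!: sum.neutral[symmetric])
  qed
  then show ?thesis
    unfolding gpoly_eq_iff coeff_sum coeff_scaleR coeff_odd_gen by (rule allI)
qed

text \<open>A function of degree 1 contains no momenta and its odd derivatives are scalars. In
  particular no base derivative of \<open>G\<close> occurs, so only the value of \<open>G\<close> at
  the point enters.\<close>

lemma bracket_degree_one:
  assumes "\<And>a. coeff (F m) a \<noteq> 0 \<Longrightarrow> fset (snd a) \<subseteq> {..<2 * r} \<and> mono_degree a = 1"
  shows "local_bracket B c F G m = (\<Sum>i<n. x_deriv c i F m * p_deriv i (G m)) +
    (\<Sum>s<2 * r. coeff (F m) ({#}, {|s|}) *\<^sub>R left_deriv (star s) (G m))"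
proof -
  have F: "F m = (\<Sum>s<2 * r. coeff (F m) ({#}, {|s|}) *\<^sub>R odd_gen s)"
    by (rule degree_one_expand) (rule assms)
  have "p_deriv i (F m) = 0" for i
    using arg_cong[OF F, of "p_deriv i"] unfolding p_deriv_sum p_deriv_scaleR p_deriv_odd_gen by simp
  moreover have "right_deriv s (F m) = coeff (F m) ({#}, {|s|}) *\<^sub>R 1" if "s < 2 * r" for s
  proof -
    have "right_deriv s (F m) = (\<Sum>t<2 * r. coeff (F m) ({#}, {|t|}) *\<^sub>R right_deriv s (odd_gen t))"
      by (subst F) (simp add: right_deriv_mono_map mono_map_sum mono_map_scaleR)
    then show ?thesis
      using that by (simp add: right_deriv_odd_gen sum_scaleR_delta)
  qed
  ultimately show ?thesis
    unfolding local_bracket_def sum_even_odd by (simp add: star_def)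
qed

lemma endo_gpoly_left_deriv:
  assumes \<N>: "skew_endo B \<N>" and m: "m \<in> U" and t: "t < 2 * r"
  shows "left_deriv t (endo_gpoly B \<N> c m) =
    (\<Sum>q<2 * r. pairing (\<N> m (E_frame B c m (star t))) (E_frame B c m (star q)) *\<^sub>R odd_gen q)"
proof -
  define K where "K s t = pairing (\<N> m (E_frame B c m (star s))) (E_frame B c m (star t))" for s t
  have K: "K s t = - K t s" if "s < 2 * r" "t < 2 * r" for s t
    using skew_endoD(2)[OF \<N> frame_facts(1)[OF m] E_frame_in[OF m] E_frame_in[OF m], of "star s" "star t"] that
    by (simp add: K_def pairing_commute)
  have "left_deriv t (endo_gpoly B \<N> c m) = (1 / 2) *\<^sub>R (\<Sum>s<2 * r. \<Sum>q<2 * r. K s q *\<^sub>R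
      ((if s = t then odd_gen q else 0) - (if q = t then odd_gen s else 0)))"
    by (simp add: endo_gpoly_def c_in m K_def left_deriv_mono_map mono_map_sum mono_map_scaleR
        left_deriv_odd_gen_mult[unfolded left_deriv_mono_map])
  also have "\<dots> = (1 / 2) *\<^sub>R ((\<Sum>q<2 * r. K t q *\<^sub>R odd_gen q) - (\<Sum>s<2 * r. K s t *\<^sub>R odd_gen s))"
  proof -
    have "(\<Sum>s<2 * r. \<Sum>q<2 * r. K s q *\<^sub>R (if s = t then odd_gen q else 0)) = (\<Sum>q<2 * r. K t q *\<^sub>R odd_gen q)"
      using t by (subst sum.swap) (simp add: sum_scaleR_delta)
    moreover have "(\<Sum>s<2 * r. \<Sum>q<2 * r. K s q *\<^sub>R (if q = t then odd_gen s else 0)) = (\<Sum>s<2 * r. K s t *\<^sub>R odd_gen s)"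
      using t by (simp add: sum_scaleR_delta)
    ultimately show ?thesis
      by (simp only: scaleR_diff_right sum_subtractf)
  qed
  \<comment> \<open>Skew-symmetry of \<open>K\<close> makes the two contributions equal, which
    absorbs the factor 1/2.\<close>
  also have "(\<Sum>s<2 * r. K s t *\<^sub>R odd_gen s) = - (\<Sum>q<2 * r. K t q *\<^sub>R odd_gen q)"
    unfolding sum_negf[symmetric]
  proof (intro sum.cong refl)
    fix s assume "s \<in> {..<2 * r}"
    then show "K s t *\<^sub>R odd_gen s = - (K t s *\<^sub>R odd_gen s)" using K[of s t] t by simp
  qed
  finally show ?thesis
    by (simp add: K_def scaleR_2[symmetric])
qed

lemma endo_gpoly_p_deriv: "p_deriv i (endo_gpoly B \<N> c m) = 0"
  by (simp add: endo_gpoly_def p_deriv_mult p_deriv_sum p_deriv_scaleR p_deriv_zero p_deriv_odd_gen)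

lemma endo_gpoly_bracket:
  assumes \<N>: "skew_endo B \<N>" and m: "m \<in> U"
    and F: "\<And>a. coeff (F m) a \<noteq> 0 \<Longrightarrow> fset (snd a) \<subseteq> {..<2 * r} \<and> mono_degree a = 1"
  shows "local_bracket B c F (endo_gpoly B \<N> c) m = E_to_gpoly B c m (\<N> m (gpoly_to_E B c m (F m)))"
proof -
  let ?g = "gpoly_to_E B c m (F m)"
  note sk = skew_endoD[OF \<N> frame_facts(1)[OF m]]
  have "pairing (\<N> m ?g) (E_frame B c m (star q)) =
      (\<Sum>s<2 * r. coeff (F m) ({#}, {|s|}) * pairing (\<N> m (E_frame B c m s)) (E_frame B c m (star q)))"
    if q: "q < 2 * r" for q
  proof -
    have e: "E_frame B c m (star q) \<in> E_fibre B m" using E_frame_in[OF m] q by simp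
    \<comment> \<open>Skew-symmetry stands in for linearity: the endomorphism is moved to the other
      entry, the free entry is expanded in the frame, and the endomorphism is moved back.\<close>
    have "pairing (\<N> m ?g) (E_frame B c m (star q)) =
      - (\<Sum>s<2 * r. coeff (F m) ({#}, {|s|}) * pairing (E_frame B c m s) (\<N> m (E_frame B c m (star q))))"
      using sk(2)[OF gpoly_to_E_in[OF m] e] pairing_gpoly_to_E[OF m sk(1)[OF e]] by simp
    also have "\<dots> = (\<Sum>s<2 * r. coeff (F m) ({#}, {|s|}) * pairing (\<N> m (E_frame B c m s)) (E_frame B c m (star q)))"
      unfolding sum_negf[symmetric]
      by (intro sum.cong refl) (simp add: sk(2)[OF E_frame_in[OF m] e])
    finally show ?thesis .
  qed
  then have "E_to_gpoly B c m (\<N> m ?g) = (\<Sum>q<2 * r. \<Sum>s<2 * r. coeff (F m) ({#}, {|s|}) *\<^sub>R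
      (pairing (\<N> m (E_frame B c m s)) (E_frame B c m (star q)) *\<^sub>R odd_gen q))"
    by (simp add: E_to_gpoly_eq[OF m sk(1)[OF gpoly_to_E_in[OF m]]] scaleR_sum_left)
  also have "\<dots> = (\<Sum>s<2 * r. coeff (F m) ({#}, {|s|}) *\<^sub>R left_deriv (star s) (endo_gpoly B \<N> c m))"
    by (subst sum.swap) (simp add: endo_gpoly_left_deriv[OF \<N> m] scaleR_sum_right)
  also have "\<dots> = local_bracket B c F (endo_gpoly B \<N> c) m"
    using bracket_degree_one[of F m "endo_gpoly B \<N> c", OF F] by (simp add: endo_gpoly_p_deriv)
  finally show ?thesis ..
qed

lemma coeff_endo_gpoly:
  assumes "m \<in> U"
  shows "coeff (endo_gpoly B \<N> c m) a = (\<Sum>s<2 * r. \<Sum>t<2 * r. if ({#}, {|s, t|}) = a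
    then shuffle_sign {|s|} {|t|} / 2 * pairing (\<N> m (E_frame B c m (star s))) (E_frame B c m (star t)) else 0)"
  using assms by (simp add: endo_gpoly_def c_in odd_gen_mult coeff_gmono sum_distrib_left if_distrib
      mult_ac cong: if_cong)

lemma coeff_endo_gpoly_nonzero:
  assumes m: "m \<in> U" and "coeff (endo_gpoly B \<N> c m) a \<noteq> 0"
  obtains s t where "s < 2 * r" "t < 2 * r" "s \<noteq> t" "a = ({#}, {|s, t|})"
    "pairing (\<N> m (E_frame B c m (star s))) (E_frame B c m (star t)) \<noteq> 0"
proof -
  let ?k = "\<lambda>s t. if ({#}, {|s, t|}) = a
    then shuffle_sign {|s|} {|t|} / 2 * pairing (\<N> m (E_frame B c m (star s))) (E_frame B c m (star t)) else 0"
  have "(\<Sum>s<2 * r. \<Sum>t<2 * r. ?k s t) \<noteq> 0"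
    using assms(2) unfolding coeff_endo_gpoly[OF m] .
  then obtain s where s: "s \<in> {..<2 * r}" "(\<Sum>t<2 * r. ?k s t) \<noteq> 0"
    by (rule sum.not_neutral_contains_not_neutral)
  from this(2) obtain t where t: "t \<in> {..<2 * r}" "?k s t \<noteq> 0"
    by (rule sum.not_neutral_contains_not_neutral)
  have "shuffle_sign {|s|} {|s|} = 0" by (simp add: shuffle_sign_def)
  then show thesis
    using s(1) t by (intro that[of s t]) (auto split: if_splits)
qed

lemma sm_endo_gpoly:
  assumes "skew_endo B \<N>" shows "sm (\<lambda>m. coeff (endo_gpoly B \<N> c m) a)"
proof -
  have "sm (\<lambda>m. pairing (\<N> m (E_frame B c m (star s))) (E_frame B c m (star t)))"
    if "s < 2 * r" "t < 2 * r" for s t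
    using assms c_in that by (auto simp: skew_endo_def)
  then have "sm (\<lambda>m. \<Sum>s<2 * r. \<Sum>t<2 * r. if ({#}, {|s, t|}) = a
    then shuffle_sign {|s|} {|t|} / 2 * pairing (\<N> m (E_frame B c m (star s))) (E_frame B c m (star t)) else 0)"
    by (intro sm_sum sm_if sm_mult sm_const) auto
  then show ?thesis
    by (rule sm_cong) (simp add: coeff_endo_gpoly)
qed

lemma endo_gpoly_hom:
  assumes "skew_endo B \<N>"
    and w: "\<And>m s t. m \<in> U \<Longrightarrow> s < 2 * r \<Longrightarrow> t < 2 * r \<Longrightarrow>
      pairing (\<N> m (E_frame B c m (star s))) (E_frame B c m (star t)) \<noteq> 0 \<Longrightarrow>
      (if even s then 1 else - 1) + (if even t then 1 else - 1) = w"
  shows "endo_gpoly B \<N> c \<in> hom 2 w"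
proof (rule homI)
  fix m a assume m: "m \<in> U" and "coeff (endo_gpoly B \<N> c m) a \<noteq> 0"
  then obtain s t where "s < 2 * r" "t < 2 * r" "s \<noteq> t" "a = ({#}, {|s, t|})"
    "pairing (\<N> m (E_frame B c m (star s))) (E_frame B c m (star t)) \<noteq> 0"
    by (rule coeff_endo_gpoly_nonzero)
  then show "a \<in> monomials 2 w"
    using w[OF m] by (auto simp: monomials_def mono_degree_def mono_weight_def fcard.rep_eq)
next
  fix a show "sm (\<lambda>m. coeff (endo_gpoly B \<N> c m) a)" by (rule sm_endo_gpoly[OF assms(1)])
qed (simp add: endo_gpoly_def)

lemma change_coords_E_to_gpoly:
  assumes c': "bundle_chart B c'" and m: "m \<in> U" "m \<in> cdom c'" and v: "v \<in> E_fibre B m"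
  shows "change_coords B c c' m (E_to_gpoly B c' m v) = E_to_gpoly B c m v"
proof -
  interpret c': bundle_chart B c' by (rule c')
  have "change_coords B c c' m (E_to_gpoly B c' m v) =
      (\<Sum>q<2 * r. pairing v (E_frame B c' m (star q)) *\<^sub>R
        (\<Sum>p<2 * r. pairing (E_frame B c' m q) (E_frame B c m (star p)) *\<^sub>R odd_gen p))"
    by (simp add: c'.E_to_gpoly_eq[OF m(2) v] change_coords_sum change_coords_scaleR change_coords_odd_gen
        odd_image_eq[OF m] E_to_gpoly_eq[OF m(1) c'.E_frame_in[OF m(2)]])
  also have "\<dots> = (\<Sum>p<2 * r. (\<Sum>q<2 * r. pairing v (E_frame B c' m (star q)) *
      pairing (E_frame B c' m q) (E_frame B c m (star p))) *\<^sub>R odd_gen p)"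
    unfolding scaleR_sum_right scaleR_sum_left scaleR_scaleR by (rule sum.swap)
  also have "\<dots> = E_to_gpoly B c m v"
    by (simp add: E_to_gpoly_eq[OF m(1) v] c'.pairing_expand[OF m(2) v E_frame_in[OF m(1)]])
  finally show ?thesis .
qed

text \<open>The coefficients are the matrix of a bilinear form on E. The completeness relation of
  the primed frame removes the two inner sums, one for each entry of the form.\<close>

lemma change_coords_endo_gpoly:
  assumes \<N>: "skew_endo B \<N>" and c': "bundle_chart B c'" and m: "m \<in> U" "m \<in> cdom c'"
  shows "change_coords B c c' m (endo_gpoly B \<N> c' m) = endo_gpoly B \<N> c m"
proof -
  interpret c': bundle_chart B c' by (rule c')
  note sk = skew_endoD[OF \<N> frame_facts(1)[OF m(1)]]
  define K where "K s t = pairing (\<N> m (E_frame B c' m (star s))) (E_frame B c' m (star t))" for s t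
  define A where "A s p = pairing (E_frame B c' m s) (E_frame B c m (star p))" for s p
  have im: "odd_image B c c' m s = (\<Sum>p<2 * r. A s p *\<^sub>R odd_gen p)" if "s < 2 * r" for s
    by (simp add: odd_image_eq[OF m] E_to_gpoly_eq[OF m(1) c'.E_frame_in[OF m(2) that]] A_def)
  have KA: "(\<Sum>s<2 * r. \<Sum>t<2 * r. K s t * A s p * A t q) =
      pairing (\<N> m (E_frame B c m (star p))) (E_frame B c m (star q))" if "p < 2 * r" "q < 2 * r" for p q
  proof -
    have e: "E_frame B c m (star p) \<in> E_fibre B m" "E_frame B c m (star q) \<in> E_fibre B m"
      using E_frame_in[OF m(1)] that by auto
    have e': "E_frame B c' m s \<in> E_fibre B m" if "s < 2 * r" for s
      using c'.E_frame_in[OF m(2) that] .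
    have "(\<Sum>t<2 * r. K s t * A s p * A t q) =
        - (pairing (E_frame B c m (star p)) (E_frame B c' m s) *
          pairing (E_frame B c' m (star s)) (\<N> m (E_frame B c m (star q))))" if s: "s < 2 * r" for s
    proof -
      have "(\<Sum>t<2 * r. K s t * A s p * A t q) = A s p * (\<Sum>t<2 * r. K s t * A t q)"
        by (simp add: sum_distrib_left mult_ac)
      also have "(\<Sum>t<2 * r. K s t * A t q) = pairing (\<N> m (E_frame B c' m (star s))) (E_frame B c m (star q))"
        unfolding K_def A_def using s by (intro c'.pairing_expand[OF m(2)] sk(1) e' e) auto
      also have "\<dots> = - pairing (E_frame B c' m (star s)) (\<N> m (E_frame B c m (star q)))"
        using s by (intro sk(2) e' e) auto
      finally show ?thesis by (simp add: A_def pairing_commute)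
    qed
    then have "(\<Sum>s<2 * r. \<Sum>t<2 * r. K s t * A s p * A t q) =
        - (\<Sum>s<2 * r. pairing (E_frame B c m (star p)) (E_frame B c' m s) *
          pairing (E_frame B c' m (star s)) (\<N> m (E_frame B c m (star q))))"
      by (simp add: sum_negf)
    also have "\<dots> = - pairing (E_frame B c m (star p)) (\<N> m (E_frame B c m (star q)))"
      using c'.pairing_expand[OF m(2) e(1) sk(1)[OF e(2)]]
        sum_star[of "\<lambda>s. pairing (E_frame B c m (star p)) (E_frame B c' m s) *
          pairing (E_frame B c' m (star s)) (\<N> m (E_frame B c m (star q)))" r]
      by simp
    also have "\<dots> = pairing (\<N> m (E_frame B c m (star p))) (E_frame B c m (star q))"
      by (simp add: sk(2)[OF e])
    finally show ?thesis .
  qed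
  have "change_coords B c c' m (endo_gpoly B \<N> c' m) = (1 / 2) *\<^sub>R (\<Sum>s<2 * r. \<Sum>t<2 * r.
      K s t *\<^sub>R ((\<Sum>p<2 * r. A s p *\<^sub>R odd_gen p) * (\<Sum>q<2 * r. A t q *\<^sub>R odd_gen q)))"
    using c'.c_in m(2)
    by (simp add: endo_gpoly_def K_def change_coords_scaleR change_coords_sum change_coords_odd_gen_mult im)
  also have "(\<Sum>s<2 * r. \<Sum>t<2 * r.
      K s t *\<^sub>R ((\<Sum>p<2 * r. A s p *\<^sub>R odd_gen p) * (\<Sum>q<2 * r. A t q *\<^sub>R odd_gen q))) =
    (\<Sum>s<2 * r. \<Sum>t<2 * r. \<Sum>p<2 * r. \<Sum>q<2 * r. (K s t * A s p * A t q) *\<^sub>R (odd_gen p * odd_gen q))"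
    by (simp add: sum_product scaleR_sum_right mult_ac)
  also have "\<dots> = (\<Sum>p<2 * r. \<Sum>q<2 * r. (\<Sum>s<2 * r. \<Sum>t<2 * r. K s t * A s p * A t q) *\<^sub>R (odd_gen p * odd_gen q))"
    unfolding scaleR_sum_left
    by (rule sum_swap_pairs)
  also have "\<dots> = (\<Sum>p<2 * r. \<Sum>q<2 * r.
      pairing (\<N> m (E_frame B c m (star p))) (E_frame B c m (star q)) *\<^sub>R (odd_gen p * odd_gen q))"
    by (simp add: KA)
  finally show ?thesis
    using c_in m by (simp add: endo_gpoly_def)
qed

end

lemma endo_gpoly_graded:
  assumes vb: "vector_bundle B" and \<N>: "skew_endo B \<N>"
  shows "endo_gpoly B \<N> \<in> graded_fun B 2"
proof -
  have chart: "bundle_chart B c" if "c \<in> atlas B" for c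
    using vb that by unfold_locales
  have "set_mset (fst a) \<subseteq> {..<base_dim B} \<and> fset (snd a) \<subseteq> {..<2 * fibre_dim B} \<and> mono_degree a = 2"
    if a: "coeff (endo_gpoly B \<N> c m) a \<noteq> 0" for c m a
  proof -
    have m: "c \<in> atlas B" "m \<in> cdom c" using a by (auto simp: endo_gpoly_def split: if_splits)
    interpret bundle_chart B c using chart m(1) .
    obtain s t where "s < 2 * r" "t < 2 * r" "s \<noteq> t" "a = ({#}, {|s, t|})"
      using m(2) a by (rule coeff_endo_gpoly_nonzero)
    then show ?thesis by (auto simp: mono_degree_def fcard.rep_eq)
  qed
  moreover have "endo_gpoly B \<N> c m = change_coords B c c' m (endo_gpoly B \<N> c' m)"
    if "c \<in> atlas B" "c' \<in> atlas B" "m \<in> cdom c \<inter> cdom c'" for c c' m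
    using bundle_chart.change_coords_endo_gpoly[OF chart[OF that(1)] \<N> chart[OF that(2)]] that(3) by auto
  moreover have "smooth_in B c (cdom c) (\<lambda>m. coeff (endo_gpoly B \<N> c m) a)" if "c \<in> atlas B" for c a
    using bundle_chart.sm_endo_gpoly[OF chart[OF that] \<N>] .
  moreover have "endo_gpoly B \<N> c m = 0" if "\<not> (c \<in> atlas B \<and> m \<in> cdom c)" for c m
    unfolding endo_gpoly_def by (rule if_not_P[OF that])
  ultimately show ?thesis
    unfolding graded_fun_def by blast
qed

lemma graded_funD:
  assumes "F \<in> graded_fun B k"
  shows "\<not> (c \<in> atlas B \<and> m \<in> cdom c) \<Longrightarrow> F c m = 0"
    and "coeff (F c m) a \<noteq> 0 \<Longrightarrow> set_mset (fst a) \<subseteq> {..<base_dim B} \<and>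
      fset (snd a) \<subseteq> {..<2 * fibre_dim B} \<and> mono_degree a = k"
    and "c \<in> atlas B \<Longrightarrow> smooth_in B c (cdom c) (\<lambda>m. coeff (F c m) a)"
  using assms unfolding graded_fun_def by blast+

lemma endo_act_bracket:
  assumes vb: "vector_bundle B" and \<N>: "skew_endo B \<N>" and u: "u \<in> graded_fun B 1"
  shows "endo_act B \<N> u = big_bracket B u (endo_gpoly B \<N>)"
proof (intro ext)
  fix c m
  show "endo_act B \<N> u c m = big_bracket B u (endo_gpoly B \<N>) c m"
  proof (cases "c \<in> atlas B \<and> m \<in> cdom c")
    case True
    then interpret bundle_chart B c using vb by unfold_locales auto
    show ?thesis
      using True endo_gpoly_bracket[OF \<N>, of m "u c"] graded_funD(2)[OF u]
      by (simp add: endo_act_def big_bracket_def)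
  qed (auto simp: endo_act_def big_bracket_def)
qed

section \<open>Global sections with prescribed first-order jets\<close>

lemma smooth_in_subset:
  assumes "vector_bundle B" "c \<in> atlas B" "openin (base B) W" "openin (base B) W'" "W' \<subseteq> W" "W \<subseteq> cdom c"
    "smooth_in B c W f"
  shows "smooth_in B c W' f"
proof -
  interpret Euclidean_open "base_dim B" "coord c ` W"
    by unfold_locales (rule openin_coord_image; fact)
  show ?thesis
    using assms(7) C_diff_subset[OF _ openin_coord_image[OF assms(1,2,4)], of _ "f \<circ> inv_into (cdom c) (coord c)"]
      assms(5,6)
    by (auto simp: smooth_in_def smooth_def)
qed

text \<open>The local expression in \<open>c'\<close> is the one in \<open>c\<close> composed with
  the transition map, whose smoothness is part of the atlas axioms.\<close>

lemma smooth_in_change: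
  assumes vb: "vector_bundle B" and c: "c \<in> atlas B" and c': "c' \<in> atlas B"
    and W: "openin (base B) W" "W \<subseteq> cdom c" "W \<subseteq> cdom c'" and f: "smooth_in B c W f"
  shows "smooth_in B c' W f"
proof -
  interpret c: bundle_chart B c using vb c by unfold_locales
  interpret c': bundle_chart B c' using vb c' by unfold_locales
  interpret W: Euclidean_open "base_dim B" "coord c ` W"
    by unfold_locales (rule openin_coord_image[OF vb c W(1,2)])
  interpret W': Euclidean_open "base_dim B" "coord c' ` W"
    by unfold_locales (rule openin_coord_image[OF vb c' W(1,3)])
  have int: "openin (base B) (cdom c' \<inter> cdom c)"
    using vb c c' by (auto simp: vector_bundle_def)
  have in_W: "c'.\<psi> x \<in> W" if "x \<in> coord c' ` W" for x
    using that W(3) c'.psi_coord by auto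
  show ?thesis
    unfolding smooth_in_def smooth_def
  proof
    fix k
    have "C_diff k (base_dim B) (coord c' ` W) (\<lambda>y. (f \<circ> c.\<psi>) (coord c (c'.\<psi> y)))"
    proof (rule W.C_diff_compose[where f = "f \<circ> c.\<psi>" and G = "\<lambda>y. coord c (c'.\<psi> y)", OF W'.open_V])
      show "C_diff k (base_dim B) (coord c ` W) (f \<circ> c.\<psi>)"
        using f by (simp add: smooth_in_def smooth_def)
      show "coord c (c'.\<psi> y) \<in> coord c ` W" if "y \<in> coord c' ` W" for y
        using in_W[OF that] by blast
      fix j assume "j < base_dim B"
      then have "smooth_in B c' (cdom c' \<inter> cdom c) (\<lambda>m. coord c m j)"
        using vb c c' by (auto simp: vector_bundle_def)
      then have "smooth_in B c' W (\<lambda>m. coord c m j)"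
        by (rule smooth_in_subset[OF vb c' int W(1), rotated 2]) (use W in auto)
      then show "C_diff k (base_dim B) (coord c' ` W) (\<lambda>y. coord c (c'.\<psi> y) j)"
        by (simp add: smooth_in_def smooth_def o_def)
    qed
    then show "C_diff k (base_dim B) (coord c' ` W) (f \<circ> c'.\<psi>)"
      by (rule W'.C_diff_cong) (use in_W W(2) c.psi_coord in force)
  qed
qed

text \<open>Without collisions among monomials of nonzero weight no cancellation occurs. Removing a
  factor is injective on the monomials that contain it, so a vanishing derivative excludes all of
  these.\<close>

lemma coeff_mono_map_inj:
  assumes "\<And>b. \<phi> b = \<phi> a \<Longrightarrow> w b \<noteq> 0 \<Longrightarrow> b = a"
  shows "coeff (mono_map \<phi> w F) (\<phi> a) = w a * coeff F a"
proof -
  have "coeff (mono_map \<phi> w F) (\<phi> a) = (\<Sum>b\<in>insert a (supp F). if \<phi> b = \<phi> a then w b * coeff F b else 0)"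
    by (rule coeff_mono_map) auto
  also have "\<dots> = (\<Sum>b\<in>insert a (supp F). if b = a then w a * coeff F a else 0)"
    using assms by (intro sum.cong refl) auto
  finally show ?thesis by simp
qed

lemma left_deriv_eq_0D:
  assumes "left_deriv s F = 0" "s |\<in>| snd a" shows "coeff F a = 0"
proof -
  have "coeff (left_deriv s F) (fst a, snd a |-| {|s|}) = odd_sign s (snd a) * coeff F a"
    unfolding left_deriv_mono_map
  proof (rule coeff_mono_map_inj)
    fix b assume b: "(fst b, snd b |-| {|s|}) = (fst a, snd a |-| {|s|})" "odd_sign s (snd b) \<noteq> 0"
    then have "s |\<in>| snd b" by (auto simp: odd_sign_def split: if_splits)
    then show "b = a" using b(1) assms(2) by (metis finsert_fminus prod.inject prod.collapse)
  qed
  moreover have "odd_sign s (snd a) \<noteq> 0"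
    using assms(2) by (simp add: odd_sign_def shuffle_sign_def)
  ultimately show ?thesis using assms(1) by simp
qed

lemma p_deriv_eq_0D:
  assumes "p_deriv i F = 0" "i \<in># fst a" shows "coeff F a = 0"
proof -
  have "coeff (p_deriv i F) (fst a - {#i#}, snd a) = real (count (fst a) i) * coeff F a"
    unfolding p_deriv_mono_map
  proof (rule coeff_mono_map_inj)
    fix b assume b: "(fst b - {#i#}, snd b) = (fst a - {#i#}, snd a)" "real (count (fst b) i) \<noteq> 0"
    then have "i \<in># fst b" by (simp add: not_in_iff)
    then show "b = a" using b(1) assms(2) by (metis insert_DiffM prod.inject prod.collapse)
  qed
  then show ?thesis using assms by (auto simp: count_eq_zero_iff)
qed

section \<open>Bump functions and the global sections built from them\<close>

context bundle_chart
begin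

text \<open>Compactness, unlike closedness in the chart, passes to the whole base: since the base is
  Hausdorff, the box is closed there, and functions supported in it extend smoothly by zero.\<close>

lemma compactin_coordinate_box:
  assumes box: "\<And>x. x \<in> topspace (Euclidean_space n) \<Longrightarrow> (\<And>i. i < n \<Longrightarrow> \<bar>x i - a i\<bar> \<le> \<delta>) \<Longrightarrow> x \<in> coord c ` U"
  shows "compactin (base B) {m \<in> U. \<forall>i<n. \<bar>coord c m i - a i\<bar> \<le> \<delta>}"
proof -
  define X where "X = {x \<in> topspace (Euclidean_space n). \<forall>i<n. \<bar>x i - a i\<bar> \<le> \<delta>}"
  have X_sub: "X \<subseteq> coord c ` U" using box by (auto simp: X_def)
  \<comment> \<open>The coordinates from \<open>n\<close> on are confined to 0, so the box is a full
    product of compact sets and Tychonoff's theorem applies.\<close>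
  have "X = PiE UNIV (\<lambda>i. if i < n then cball (a i) \<delta> else {0})"
  proof (rule set_eqI)
    fix x
    have "x \<in> X \<longleftrightarrow> (\<forall>i. if i < n then \<bar>x i - a i\<bar> \<le> \<delta> else x i = 0)"
      unfolding X_def topspace_Euclidean_space by (auto simp: not_less)
    then show "x \<in> X \<longleftrightarrow> x \<in> PiE UNIV (\<lambda>i. if i < n then cball (a i) \<delta> else {0})"
      by (simp add: PiE_UNIV_domain Pi_iff dist_real_def abs_minus_commute if_distrib cong: if_cong)
  qed
  moreover have "compactin (powertop_real UNIV) (PiE UNIV (\<lambda>i. if i < n then cball (a i) \<delta> else {0}))"
    by (subst compactin_PiE) auto
  ultimately have "compactin (Euclidean_space n) X"
    by (auto simp: Euclidean_space_def compactin_subtopology X_def topspace_Euclidean_space)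
  then have X: "compactin (subtopology (Euclidean_space n) (coord c ` U)) X"
    using X_sub by (simp add: compactin_subtopology)
  have U: "openin (base B) U" "homeomorphic_map (subtopology (base B) U)
      (subtopology (Euclidean_space n) (coord c ` U)) (coord c)"
    using vb c_in by (auto simp: vector_bundle_def)
  then obtain g where g: "homeomorphic_maps (subtopology (base B) U)
      (subtopology (Euclidean_space n) (coord c ` U)) (coord c) g"
    using homeomorphic_map_maps by blast
  have top: "topspace (subtopology (base B) U) = U" using openin_subset[OF U(1)] by auto
  have gc: "g (coord c m) = m" if "m \<in> U" for m
    using g that top by (auto simp: homeomorphic_maps_def)
  have "compactin (subtopology (base B) U) (g ` X)"
    using X g by (intro image_compactin) (auto simp: homeomorphic_maps_def)
  moreover have "g ` X = {m \<in> U. \<forall>i<n. \<bar>coord c m i - a i\<bar> \<le> \<delta>}"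
  proof
    show "g ` X \<subseteq> {m \<in> U. \<forall>i<n. \<bar>coord c m i - a i\<bar> \<le> \<delta>}"
    proof
      fix y assume "y \<in> g ` X"
      then obtain x where x: "x \<in> X" "y = g x" by blast
      then obtain m where "m \<in> U" "x = coord c m" using X_sub by blast
      then show "y \<in> {m \<in> U. \<forall>i<n. \<bar>coord c m i - a i\<bar> \<le> \<delta>}"
        using x gc by (auto simp: X_def)
    qed
    show "{m \<in> U. \<forall>i<n. \<bar>coord c m i - a i\<bar> \<le> \<delta>} \<subseteq> g ` X"
    proof
      fix m assume m: "m \<in> {m \<in> U. \<forall>i<n. \<bar>coord c m i - a i\<bar> \<le> \<delta>}"
      then have "coord c m \<in> X" using V.V_subset by (auto simp: X_def)
      then show "m \<in> g ` X" using gc[of m] m by force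
    qed
  qed
  ultimately show ?thesis by (simp add: compactin_subtopology)
qed

text \<open>A product of one factor exp(- 1 / (\<delta>^2 - s^2)) per coordinate, with s the
  distance from the centre, continued by zero. Each factor is critical at the centre; a nonzero
  value and vanishing first derivatives there are what the later arguments use, so the function need
  not be constant nearby.\<close>

lemma bump_function:
  assumes m0: "m0 \<in> U"
  obtains b K where "closedin (base B) K" "K \<subseteq> U" "\<And>m. m \<notin> K \<Longrightarrow> b m = 0" "sm b" "b m0 \<noteq> 0"
    "\<And>i. i < n \<Longrightarrow> pd i b m0 = 0"
proof -
  define a where "a = coord c m0"
  have aV: "a \<in> coord c ` U" using m0 by (simp add: a_def)
  obtain \<delta> where \<delta>: "\<delta> > 0"
    "\<And>x. x \<in> topspace (Euclidean_space n) \<Longrightarrow> (\<And>i. i < n \<Longrightarrow> \<bar>x i - a i\<bar> \<le> \<delta>) \<Longrightarrow> x \<in> coord c ` U"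
    using Euclidean_open_contains_box[OF V.open_V aV] by metis
  define \<beta> where "\<beta> x = (\<Prod>j<n. flat 1 (\<delta>\<^sup>2 - (x j - a j)\<^sup>2))" for x
  define b where "b m = (if m \<in> U then \<beta> (coord c m) else 0)" for m
  define K where "K = {m \<in> U. \<forall>i<n. \<bar>coord c m i - a i\<bar> \<le> \<delta>}"
  have closed: "closedin (base B) K"
    unfolding K_def using vb compactin_coordinate_box[OF \<delta>(2)]
    by (auto simp: vector_bundle_def intro: compactin_imp_closedin)
  have zero: "b m = 0" if mK: "m \<notin> K" for m
  proof (cases "m \<in> U")
    case True
    then obtain i where i: "i < n" "\<not> \<bar>coord c m i - a i\<bar> \<le> \<delta>" using mK by (auto simp: K_def)
    then have "\<delta>\<^sup>2 < (coord c m i - a i)\<^sup>2"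
      using \<delta>(1) by (metis abs_le_square_iff abs_of_pos not_le)
    then have "flat 1 (\<delta>\<^sup>2 - (coord c m i - a i)\<^sup>2) = 0" by (simp add: flat_def)
    then have "\<beta> (coord c m) = 0" unfolding \<beta>_def using i(1) by (intro prod_zero) auto
    then show ?thesis by (simp add: b_def)
  qed (simp add: b_def)
  have \<beta>: "C_diff k n (coord c ` U) \<beta>" for k
    unfolding \<beta>_def power2_eq_square diff_conv_add_uminus
    by (intro V.C_diff_prod V.C_diff_flat V.C_diff_add C_diff_const V.C_diff_uminus V.C_diff_mult V.C_diff_coord)
  have smb: "sm b"
    unfolding sm_iff
  proof
    fix k show "C_diff k n (coord c ` U) (b \<circ> \<psi>)"
      using \<beta> by (rule V.C_diff_cong) (simp add: b_def psi_in)
  qed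
  have pos: "flat 1 (\<delta>\<^sup>2) \<noteq> 0" using \<delta>(1) by (simp add: flat_def)
  have "pd i b m0 = 0" if i: "i < n" for i
  proof -
    have "pd i b m0 = partial i \<beta> a"
      unfolding chart_partial_def a_def
      by (rule V.partial_cong) (use m0 i in \<open>auto simp: b_def\<close>)
    moreover have "((\<lambda>t. \<beta> (a(i := t))) has_real_derivative 0) (at (a i))"
    proof -
      have "\<beta> (a(i := t)) = flat 1 (\<delta>\<^sup>2 - (t - a i)\<^sup>2) * (\<Prod>j\<in>{..<n} - {i}. flat 1 (\<delta>\<^sup>2))" for t
        unfolding \<beta>_def using i by (subst prod.remove[of _ i]) auto
      moreover have "((\<lambda>t. \<delta>\<^sup>2 - (t - a i)\<^sup>2) has_real_derivative 0) (at (a i))"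
        by (auto intro!: derivative_eq_intros)
      from DERIV_cmult_right[OF DERIV_chain2[OF DERIV_flat this], of 1 "\<Prod>j\<in>{..<n} - {i}. flat 1 (\<delta>\<^sup>2)"]
      have "((\<lambda>t. flat 1 (\<delta>\<^sup>2 - (t - a i)\<^sup>2) * (\<Prod>j\<in>{..<n} - {i}. flat 1 (\<delta>\<^sup>2))) has_real_derivative 0) (at (a i))"
        by simp
      ultimately show ?thesis by simp
    qed
    ultimately show ?thesis by (simp add: partial_def DERIV_imp_deriv)
  qed
  moreover have "b m0 \<noteq> 0"
    using m0 pos by (simp add: b_def \<beta>_def a_def)
  moreover have "K \<subseteq> U" by (auto simp: K_def)
  ultimately show thesis using that closed zero smb by blast
qed

definition frame_section :: "('m \<Rightarrow> real) \<Rightarrow> nat \<Rightarrow> ('m, 'v) family" where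
  "frame_section f s c' m = (if c' \<in> atlas B \<and> m \<in> cdom c' \<and> m \<in> U
     then f m *\<^sub>R E_to_gpoly B c' m (E_frame B c m s) else 0)"

lemma frame_section_chart:
  assumes s: "s < 2 * r"
  shows "frame_section f s c = (\<lambda>m. if m \<in> U then f m *\<^sub>R odd_gen s else 0)"
proof
  fix m
  have "E_to_gpoly B c m (E_frame B c m s) = odd_gen s" if m: "m \<in> U"
  proof -
    have "E_to_gpoly B c m (E_frame B c m s) = (\<Sum>t<2 * r. (if s = t then 1 else 0) *\<^sub>R odd_gen t)"
      unfolding E_to_gpoly_eq[OF m E_frame_in[OF m s]]
      by (intro sum.cong refl) (simp add: pairing_frame_frame m s)
    also have "\<dots> = (\<Sum>t<2 * r. if t = s then odd_gen s else 0)"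
      by (intro sum.cong refl) auto
    finally show ?thesis using s by simp
  qed
  then show "frame_section f s c m = (if m \<in> U then f m *\<^sub>R odd_gen s else 0)"
    using c_in by (simp add: frame_section_def)
qed

text \<open>Frame vectors of the same kind pair to zero. The other pairings are entries of a
  transition matrix or of its inverse; the atlas axioms give smoothness of one kind in
  \<open>c'\<close>, of the other in \<open>c\<close>.\<close>

lemma smooth_frame_pairing:
  assumes c': "c' \<in> atlas B" and s: "s < 2 * r" and t: "t < 2 * r"
  shows "smooth_in B c' (cdom c' \<inter> U) (\<lambda>m. pairing (E_frame B c m s) (E_frame B c' m t))"
proof -
  interpret c': bundle_chart B c' using vb c' by unfold_locales
  have int: "openin (base B) (cdom c' \<inter> U)" using vb c' c_in by (auto simp: vector_bundle_def)
  interpret W: Euclidean_open n "coord c' ` (cdom c' \<inter> U)"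
    by unfold_locales (rule openin_coord_image[OF vb c' int], auto)
  have cong: "smooth_in B c' (cdom c' \<inter> U) g"
    if "smooth_in B c' (cdom c' \<inter> U) f" "\<And>m. m \<in> cdom c' \<Longrightarrow> m \<in> U \<Longrightarrow> f m = g m" for f g
    unfolding smooth_in_def smooth_def
  proof
    fix k
    have "C_diff k n (coord c' ` (cdom c' \<inter> U)) (f \<circ> c'.\<psi>)" using that(1) by (simp add: smooth_in_def smooth_def)
    then show "C_diff k n (coord c' ` (cdom c' \<inter> U)) (g \<circ> c'.\<psi>)"
      by (rule W.C_diff_cong) (use that(2) c'.psi_coord in auto)
  qed
  have z: "coframe B c \<alpha> m 0 = 0" if "m \<in> U" for \<alpha> m
    using dual_zero[OF coframe_dual frame_facts(1)] that by simp
  have z': "coframe B c' \<alpha> m 0 = 0" if "m \<in> cdom c'" for \<alpha> m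
    using dual_zero[OF c'.coframe_dual c'.frame_facts(1)] that by simp
  have st: "s div 2 < r" "t div 2 < r" using s t by auto
  consider "even s = even t" | "even s" "odd t" | "odd s" "even t" by blast
  then show ?thesis
  proof cases
    case 1
    have "smooth_in B c' (cdom c' \<inter> U) (\<lambda>m. 0)"
      by (simp add: smooth_in_def smooth_def o_def C_diff_const)
    then show ?thesis
      by (rule cong) (use 1 z z' in \<open>auto simp: pairing_def E_frame_def\<close>)
  next
    case 2
    have "smooth_in B c (U \<inter> cdom c') (\<lambda>m. coframe B c (s div 2) m (frame c' (t div 2) m))"
      using vb c' c_in st by (auto simp: vector_bundle_def)
    then have "smooth_in B c' (U \<inter> cdom c') (\<lambda>m. coframe B c (s div 2) m (frame c' (t div 2) m))"
      by (rule smooth_in_change[OF vb c_in c', rotated 3]) (use int in \<open>auto simp: Int_commute\<close>)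
    then show ?thesis
      unfolding Int_commute[of U] by (rule cong) (use 2 in \<open>auto simp: pairing_def E_frame_def\<close>)
  next
    case 3
    have "smooth_in B c' (cdom c' \<inter> U) (\<lambda>m. coframe B c' (t div 2) m (frame c (s div 2) m))"
      using vb c' c_in st by (auto simp: vector_bundle_def)
    then show ?thesis
      by (rule cong) (use 3 in \<open>auto simp: pairing_def E_frame_def\<close>)
  qed
qed

text \<open>The domain of \<open>c'\<close> is covered by two open sets: the overlap with
  \<open>U\<close>, where the section has an explicit formula, and the complement of
  \<open>K\<close>, where it is zero.\<close>

lemma frame_section_smooth:
  assumes K: "closedin (base B) K" "K \<subseteq> U" "\<And>m. m \<notin> K \<Longrightarrow> f m = 0" and f: "sm f"
    and s: "s < 2 * r" and c': "c' \<in> atlas B"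
  shows "smooth_in B c' (cdom c') (\<lambda>m. coeff (frame_section f s c' m) a)"
proof -
  interpret c': bundle_chart B c' using vb c' by unfold_locales
  have U: "openin (base B) U" and U': "openin (base B) (cdom c')"
    using vb c' c_in by (auto simp: vector_bundle_def)
  let ?W = "cdom c' \<inter> U" and ?g = "\<lambda>m. coeff (frame_section f s c' m) a"
  have W: "openin (base B) ?W" using U U' by auto
  interpret W: Euclidean_open n "coord c' ` ?W"
    by unfold_locales (rule openin_coord_image[OF vb c' W], auto)
  have f': "smooth_in B c' ?W f"
    by (rule smooth_in_change[OF vb c_in c' W]) (use smooth_in_subset[OF vb c_in U W _ _ f] in auto)
  show ?thesis
    unfolding smooth_in_def smooth_def
  proof (intro allI c'.V.C_diff_glue)
    fix k x assume x: "x \<in> coord c' ` cdom c'"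
    show "\<exists>W. openin (Euclidean_space n) W \<and> x \<in> W \<and> W \<subseteq> coord c' ` cdom c' \<and> C_diff k n W (?g \<circ> c'.\<psi>)"
    proof (cases "c'.\<psi> x \<in> U")
      case True
      have "x \<in> coord c' ` ?W"
        using True x c'.psi_in[OF x] c'.coord_psi[OF x] by (metis IntI image_eqI)
      moreover have "C_diff k n (coord c' ` ?W) (?g \<circ> c'.\<psi>)"
      proof -
        have "C_diff k n (coord c' ` ?W) (\<lambda>x. f (c'.\<psi> x) * (\<Sum>q<2 * r.
            pairing (E_frame B c (c'.\<psi> x) s) (E_frame B c' (c'.\<psi> x) (star q)) *
            (if a = ({#}, {|q|}) then 1 else 0)))"
          using f' smooth_frame_pairing[OF c' s]
          by (intro W.C_diff_mult W.C_diff_sum C_diff_const) (auto simp: smooth_in_def smooth_def o_def)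
        then show ?thesis
        proof (rule W.C_diff_cong)
          fix y assume "y \<in> coord c' ` ?W"
          then have y: "c'.\<psi> y \<in> cdom c'" "c'.\<psi> y \<in> U" using c'.psi_coord by auto
          show "f (c'.\<psi> y) * (\<Sum>q<2 * r. pairing (E_frame B c (c'.\<psi> y) s) (E_frame B c' (c'.\<psi> y) (star q)) *
              (if a = ({#}, {|q|}) then 1 else 0)) = (?g \<circ> c'.\<psi>) y"
            using y c' by (simp add: frame_section_def c'.E_to_gpoly_eq[OF y(1) E_frame_in[OF y(2) s]]
                coeff_odd_gen del: sum_mult_of_bool_eq)
        qed
      qed
      moreover have "coord c' ` ?W \<subseteq> coord c' ` cdom c'" by auto
      ultimately show ?thesis using W.open_V by blast
    next
      case False
      let ?Z = "cdom c' - K"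
      have Z: "openin (base B) ?Z" using U' K(1) by (rule openin_diff)
      interpret Z: Euclidean_open n "coord c' ` ?Z"
        by unfold_locales (rule openin_coord_image[OF vb c' Z], auto)
      have "x \<in> coord c' ` ?Z"
        using False K(2) x c'.psi_in[OF x] c'.coord_psi[OF x] by (metis DiffI image_eqI subsetD)
      moreover have "C_diff k n (coord c' ` ?Z) (?g \<circ> c'.\<psi>)"
      proof (rule Z.C_diff_cong[OF C_diff_const[of _ _ _ 0]])
        fix y assume "y \<in> coord c' ` ?Z"
        then have "c'.\<psi> y \<notin> K" using c'.psi_coord by auto
        then show "0 = (?g \<circ> c'.\<psi>) y" using K(3) by (simp add: frame_section_def)
      qed
      moreover have "coord c' ` ?Z \<subseteq> coord c' ` cdom c'" by auto
      ultimately show ?thesis using Z.open_V by blast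
    qed
  qed
qed

lemma coeff_E_to_gpoly_nonzero:
  assumes "coeff (E_to_gpoly B c m v) a \<noteq> 0"
  obtains s where "s < 2 * r" "a = ({#}, {|s|})"
proof -
  have "(\<Sum>\<alpha><r. coeff (coframe B c \<alpha> m (fst v) *\<^sub>R theta \<alpha> + snd v (frame c \<alpha> m) *\<^sub>R tau \<alpha>) a) \<noteq> 0"
    using assms unfolding E_to_gpoly_def coeff_sum .
  then obtain \<alpha> where "\<alpha> \<in> {..<r}" "coeff (coframe B c \<alpha> m (fst v) *\<^sub>R theta \<alpha> + snd v (frame c \<alpha> m) *\<^sub>R tau \<alpha>) a \<noteq> 0"
    by (rule sum.not_neutral_contains_not_neutral)
  then show thesis
    using that[of "tau_ix \<alpha>"] that[of "theta_ix \<alpha>"] by (auto simp: coeff_odd_gen split: if_splits)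
qed

lemma frame_section_graded:
  assumes K: "closedin (base B) K" "K \<subseteq> U" "\<And>m. m \<notin> K \<Longrightarrow> f m = 0" and f: "sm f" and s: "s < 2 * r"
  shows "frame_section f s \<in> graded_fun B 1"
proof -
  have chart: "bundle_chart B c'" if "c' \<in> atlas B" for c'
    using vb that by unfold_locales
  have "set_mset (fst a) \<subseteq> {..<n} \<and> fset (snd a) \<subseteq> {..<2 * r} \<and> mono_degree a = 1"
    if a: "coeff (frame_section f s c' m) a \<noteq> 0" for c' m a
  proof -
    have c': "c' \<in> atlas B" and "coeff (E_to_gpoly B c' m (E_frame B c m s)) a \<noteq> 0"
      using a by (auto simp: frame_section_def split: if_splits)
    from this(2) obtain q where "q < 2 * r" "a = ({#}, {|q|})"
      by (rule bundle_chart.coeff_E_to_gpoly_nonzero[OF chart[OF c']])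
    then show ?thesis by (simp add: mono_degree_def)
  qed
  moreover have "frame_section f s c1 m = change_coords B c1 c2 m (frame_section f s c2 m)"
    if c12: "c1 \<in> atlas B" "c2 \<in> atlas B" and m: "m \<in> cdom c1 \<inter> cdom c2" for c1 c2 m
  proof (cases "m \<in> U")
    case True
    then show ?thesis
      using c12 m bundle_chart.change_coords_E_to_gpoly[OF chart[OF c12(1)] chart[OF c12(2)], of m "E_frame B c m s"]
        E_frame_in[OF True s]
      by (simp add: frame_section_def change_coords_scaleR)
  qed (simp add: frame_section_def)
  moreover have "frame_section f s c' m = 0" if "\<not> (c' \<in> atlas B \<and> m \<in> cdom c')" for c' m
    unfolding frame_section_def by (rule if_not_P) (use that in blast)
  ultimately show ?thesis
    unfolding graded_fun_def using frame_section_smooth[OF K f s] by blast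
qed

lemma frame_section_A:
  assumes "closedin (base B) K" "K \<subseteq> U" "\<And>m. m \<notin> K \<Longrightarrow> f m = 0" "sm f" "\<alpha> < r"
  shows "frame_section f (theta_ix \<alpha>) \<in> A_sections B"
proof -
  have ne: "tau_ix \<beta> \<noteq> theta_ix i" for \<beta> i by presburger
  have "coeff (frame_section f (theta_ix \<alpha>) c' m) ({#}, {|tau_ix \<beta>|}) = 0" for c' m \<beta>
    by (simp add: frame_section_def E_frame_def E_to_gpoly_def coeff_odd_gen ne)
  then show ?thesis
    using frame_section_graded[OF assms(1-4), of "theta_ix \<alpha>"] assms(5) by (simp add: A_sections_def)
qed

lemma frame_section_hom:
  assumes f: "sm f" and s: "s < 2 * r"
  shows "frame_section f s c \<in> hom 1 (if even s then 1 else - 1)"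
proof (rule homI)
  fix m a assume "m \<in> U" "coeff (frame_section f s c m) a \<noteq> 0"
  then have "a = ({#}, {|s|})" by (auto simp: frame_section_chart[OF s] coeff_odd_gen split: if_splits)
  then show "a \<in> monomials 1 (if even s then 1 else - 1)"
    using s by (simp add: monomials_def mono_degree_def mono_weight_def)
next
  fix a :: mono
  have "sm (\<lambda>m. if a = ({#}, {|s|}) then f m else 0)" by (intro sm_if f)
  then show "sm (\<lambda>m. coeff (frame_section f s c m) a)"
    by (rule sm_cong) (simp add: frame_section_chart[OF s] coeff_odd_gen)
qed (simp add: frame_section_def)

text \<open>At a point the coefficient enters through its first-order jet alone. Choosing the jet
  isolates either one odd derivative of \<open>G\<close> or one momentum derivative multiplied by an
  odd coordinate.\<close>

lemma bracket_frame_section: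
  assumes f: "sm f" and s: "s < 2 * r" and m: "m \<in> U"
  shows "local_bracket B c (frame_section f s c) G m =
    (\<Sum>i<n. pd i f m *\<^sub>R (odd_gen s * p_deriv i (G m))) + f m *\<^sub>R left_deriv (star s) (G m)"
proof -
  note hom = frame_section_hom[OF f s]
  have "fset (snd a) \<subseteq> {..<2 * r} \<and> mono_degree a = 1" if "coeff (frame_section f s c m) a \<noteq> 0" for a :: mono
    using homD(4)[OF hom that] by (auto simp: monomials_def)
  from bracket_degree_one[of "frame_section f s c" m G, OF this]
  have "local_bracket B c (frame_section f s c) G m =
      (\<Sum>i<n. x_deriv c i (frame_section f s c) m * p_deriv i (G m)) +
      (\<Sum>t<2 * r. coeff (frame_section f s c m) ({#}, {|t|}) *\<^sub>R left_deriv (star t) (G m))"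
    by simp
  moreover have "x_deriv c i (frame_section f s c) m = pd i f m *\<^sub>R odd_gen s" if i: "i < n" for i
  proof -
    have "pd i (\<lambda>m. coeff (frame_section f s c m) a) m = pd i f m * coeff (odd_gen s) a" for a
    proof -
      have "pd i (\<lambda>m. coeff (frame_section f s c m) a) m = pd i (\<lambda>m. coeff (odd_gen s) a * f m) m"
        by (rule pd_cong[OF _ m i]) (simp add: frame_section_chart[OF s])
      then show ?thesis by (simp add: pd_cmult[OF f i m])
    qed
    then show ?thesis by (simp add: gpoly_eq_iff coeff_x_deriv[OF hom])
  qed
  moreover have "(\<Sum>t<2 * r. coeff (frame_section f s c m) ({#}, {|t|}) *\<^sub>R left_deriv (star t) (G m)) =
      f m *\<^sub>R left_deriv (star s) (G m)"
  proof -
    have "(\<Sum>t<2 * r. coeff (frame_section f s c m) ({#}, {|t|}) *\<^sub>R left_deriv (star t) (G m)) =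
        (\<Sum>t<2 * r. if t = s then f m *\<^sub>R left_deriv (star s) (G m) else 0)"
      by (intro sum.cong refl) (auto simp: frame_section_chart[OF s] coeff_odd_gen m)
    then show ?thesis using s by simp
  qed
  ultimately show ?thesis by simp
qed

text \<open>At \<open>m0\<close> the function \<open>b\<close> has a nonzero value and no first
  derivatives, while \<open>h j\<close> vanishes and has a derivative in direction \<open>j\<close>
  only. The last clause records that multiples of frame vectors by these functions are global
  sections.\<close>

definition jet_sections :: "'m \<Rightarrow> ('m \<Rightarrow> real) \<Rightarrow> (nat \<Rightarrow> 'm \<Rightarrow> real) \<Rightarrow> bool" where
  "jet_sections m0 b h \<longleftrightarrow>
     sm b \<and> b m0 \<noteq> 0 \<and> (\<forall>i<n. pd i b m0 = 0) \<and>
     (\<forall>j<n. sm (h j) \<and> h j m0 = 0 \<and> (\<forall>i<n. pd i (h j) m0 = (if i = j then b m0 else 0))) \<and>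
     (\<forall>f\<in>insert b (h ` {..<n}). (\<forall>s<2 * r. frame_section f s \<in> graded_fun B 1) \<and>
       (\<forall>\<alpha><r. frame_section f (theta_ix \<alpha>) \<in> A_sections B))"

lemma jet_sections_exist:
  assumes m0: "m0 \<in> U" shows "\<exists>b h. jet_sections m0 b h"
proof -
  obtain b K where b: "closedin (base B) K" "K \<subseteq> U" "\<And>m. m \<notin> K \<Longrightarrow> b m = 0" "sm b" "b m0 \<noteq> 0"
    "\<And>i. i < n \<Longrightarrow> pd i b m0 = 0"
    using bump_function[OF m0] by metis
  define l where "l j m = coord c m j + - coord c m0 j" for j m
  \<comment> \<open>At \<open>m0\<close> the second factor is 0 with derivative 1 in direction
    \<open>j\<close>, so the product has value 0 and derivative \<open>b m0\<close> there.\<close>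
  define h where "h j m = b m * l j m" for j m
  have l: "sm (l j)" if "j < n" for j
    unfolding l_def by (intro sm_add sm_coord sm_const that)
  have pl: "pd i (l j) m0 = (if i = j then 1 else 0)" if "i < n" "j < n" for i j
    unfolding l_def
    using pd_add[OF sm_coord[OF that(2)] sm_const[of "- coord c m0 j"] that(1) m0] pd_coord[OF that(1) m0]
    by (simp del: add_uminus_conv_diff)
  have h: "sm (h j)" if "j < n" for j
    unfolding h_def by (intro sm_mult b(4) l that)
  have ph: "pd i (h j) m0 = (if i = j then b m0 else 0)" if "i < n" "j < n" for i j
    unfolding h_def using pd_mult[OF b(4) l[OF that(2)] that(1) m0] pl[OF that] b(6)[OF that(1)]
    by (simp add: l_def)
  have h0: "h j m = 0" if "m \<notin> K" for j m using b(3)[OF that] by (simp add: h_def)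
  have "h j m0 = 0" for j by (simp add: h_def l_def)
  then have "jet_sections m0 b h"
    unfolding jet_sections_def
    using b(4-6) h ph frame_section_graded[OF b(1-4)] frame_section_A[OF b(1-4)]
      frame_section_graded[OF b(1,2) h0 h] frame_section_A[OF b(1,2) h0 h]
    by simp
  then show ?thesis by blast
qed

end

text \<open>Sections built from \<open>b\<close> show that the odd derivatives of a competitor agree
  with those of the explicit function. Momentum derivatives show up only behind an odd coordinate,
  which a further odd derivative strips off; this takes at least one odd coordinate, hence positive
  rank.\<close>

lemma tilde_eq:
  assumes vb: "vector_bundle B" and rank: "fibre_dim B > 0" and \<N>: "skew_endo B \<N>"
  shows "tilde B \<N> = endo_gpoly B \<N>"
  unfolding tilde_def
proof (rule the_equality)
  show "endo_gpoly B \<N> \<in> graded_fun B 2 \<and>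
      (\<forall>u\<in>graded_fun B 1. endo_act B \<N> u = big_bracket B u (endo_gpoly B \<N>))"
    using endo_gpoly_graded[OF vb \<N>] endo_act_bracket[OF vb \<N>] by blast
  fix D assume D: "D \<in> graded_fun B 2 \<and> (\<forall>u\<in>graded_fun B 1. endo_act B \<N> u = big_bracket B u D)"
  let ?D = "endo_gpoly B \<N>"
  show "D = ?D"
  proof (intro ext)
    fix c m
    show "D c m = ?D c m"
    proof (cases "c \<in> atlas B \<and> m \<in> cdom c")
      case True
      then interpret bundle_chart B c using vb by unfold_locales auto
      have m: "m \<in> U" using True by simp
      define X where "X = D c m - ?D c m"
      obtain b h where "jet_sections m b h" using jet_sections_exist[OF m] by blast
      then have b: "sm b" "b m \<noteq> 0" "\<And>i. i < n \<Longrightarrow> pd i b m = 0"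
        and h: "\<And>j. j < n \<Longrightarrow> sm (h j)" "\<And>j. j < n \<Longrightarrow> h j m = 0"
          "\<And>i j. i < n \<Longrightarrow> j < n \<Longrightarrow> pd i (h j) m = (if i = j then b m else 0)"
        and bg: "\<And>s. s < 2 * r \<Longrightarrow> frame_section b s \<in> graded_fun B 1"
        and hg: "\<And>s j. s < 2 * r \<Longrightarrow> j < n \<Longrightarrow> frame_section (h j) s \<in> graded_fun B 1"
        unfolding jet_sections_def by auto
      have eq: "local_bracket B c (u c) (D c) m = local_bracket B c (u c) (?D c) m" if "u \<in> graded_fun B 1" for u
      proof -
        have "big_bracket B u D c m = big_bracket B u ?D c m"
          using D endo_act_bracket[OF vb \<N> that] that by metis
        then show ?thesis using True by (simp add: big_bracket_def)
      qed
      have left: "left_deriv t X = 0" if t: "t < 2 * r" for t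
      proof -
        have s: "star t < 2 * r" using t by simp
        have "b m *\<^sub>R left_deriv t (D c m) = b m *\<^sub>R left_deriv t (?D c m)"
          using eq[OF bg[OF s]] by (simp add: bracket_frame_section[OF b(1) s m] b(3))
        then show ?thesis
          using b(2) unfolding X_def left_deriv_mono_map Modules.additive.diff[OF additive_mono_map] by simp
      qed
      have right: "p_deriv i X = 0" if i: "i < n" for i
      proof -
        \<comment> \<open>Number 0 belongs to the first \<tau>, which positive rank
          provides.\<close>
        have s: "0 < 2 * r" using rank by simp
        have "(\<Sum>j<n. pd j (h i) m *\<^sub>R (odd_gen 0 * p_deriv j G)) = b m *\<^sub>R (odd_gen 0 * p_deriv i G)" for G
        proof -
          have "(\<Sum>j<n. pd j (h i) m *\<^sub>R (odd_gen 0 * p_deriv j G)) =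
              (\<Sum>j<n. if j = i then b m *\<^sub>R (odd_gen 0 * p_deriv i G) else 0)"
            by (intro sum.cong refl) (auto simp: h(3) i)
          then show ?thesis using i by simp
        qed
        then have "b m *\<^sub>R (odd_gen 0 * p_deriv i (D c m)) = b m *\<^sub>R (odd_gen 0 * p_deriv i (?D c m))"
          using eq[OF hg[OF s i]] by (simp add: bracket_frame_section[OF h(1)[OF i] s m] h(2)[OF i])
        then have "odd_gen 0 * p_deriv i X = 0"
          using b(2) unfolding X_def p_deriv_mono_map Modules.additive.diff[OF additive_mono_map]
          by (simp add: right_diff_distrib)
        then have "left_deriv 0 (odd_gen 0 * p_deriv i X) = 0"
          by (simp add: left_deriv_mono_map)
        moreover have "left_deriv 0 (p_deriv i X) = 0"
          using left[OF s] by (simp flip: p_left_deriv_commute add: p_deriv_zero)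
        ultimately show ?thesis by (simp add: left_deriv_mult left_deriv_odd_gen)
      qed
      \<comment> \<open>All derivatives of \<open>X\<close> vanish, which leaves only the constant
        monomial; degree 2 excludes it.\<close>
      have "coeff X a = 0" for a
      proof (rule ccontr)
        assume a: "coeff X a \<noteq> 0"
        then have "coeff (D c m) a \<noteq> 0 \<or> coeff (?D c m) a \<noteq> 0" by (auto simp: X_def)
        then have a': "set_mset (fst a) \<subseteq> {..<n}" "fset (snd a) \<subseteq> {..<2 * r}" "mono_degree a = 2"
          using graded_funD(2)[of D B 2 c m a] graded_funD(2)[OF endo_gpoly_graded[OF vb \<N>], of c m a] D by auto
        have "i \<notin># fst a" for i
          using a a'(1) right[of i] p_deriv_eq_0D[of i X a] by auto
        moreover have "s |\<notin>| snd a" for s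
          using a a'(2) left[of s] left_deriv_eq_0D[of s X a] by auto
        ultimately have "fst a = {#}" "snd a = {||}" by auto
        then show False using a'(3) by (simp add: mono_degree_def fcard.rep_eq)
      qed
      then show ?thesis by (simp add: X_def gpoly_eq_iff)
    next
      case False
      then show ?thesis
        using D graded_funD(1)[of D B 2] graded_funD(1)[OF endo_gpoly_graded[OF vb \<N>]] by metis
    qed
  qed
qed

section \<open>Block endomorphisms\<close>

lemma two_formD:
  assumes "two_form B \<omega>"
  shows "m \<in> topspace (base B) \<Longrightarrow> x \<in> fibre B m \<Longrightarrow> \<omega> m x \<in> dual_fibre B m"
    "m \<in> topspace (base B) \<Longrightarrow> x \<in> fibre B m \<Longrightarrow> y \<in> fibre B m \<Longrightarrow> \<omega> m x y = - \<omega> m y x"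
    "m \<in> topspace (base B) \<Longrightarrow> y \<in> fibre B m \<Longrightarrow> linear_on_fibre (fibre B m) (\<lambda>x. \<omega> m x y)"
    "c \<in> atlas B \<Longrightarrow> \<alpha> < fibre_dim B \<Longrightarrow> \<beta> < fibre_dim B \<Longrightarrow>
      smooth_in B c (cdom c) (\<lambda>m. \<omega> m (frame c \<alpha> m) (frame c \<beta> m))"
  using assms unfolding two_form_def by blast+

lemma bundle_endoD:
  assumes "bundle_endo B N"
  shows "m \<in> topspace (base B) \<Longrightarrow> x \<in> fibre B m \<Longrightarrow> N m x \<in> fibre B m"
    "m \<in> topspace (base B) \<Longrightarrow> linear_on_fibre (fibre B m) (N m)"
    "c \<in> atlas B \<Longrightarrow> \<alpha> < fibre_dim B \<Longrightarrow> \<beta> < fibre_dim B \<Longrightarrow>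
      smooth_in B c (cdom c) (\<lambda>m. coframe B c \<beta> m (N m (frame c \<alpha> m)))"
  using assms unfolding bundle_endo_def by blast+

lemma skew_block:
  assumes vb: "vector_bundle B" and N: "bundle_endo B N" and \<omega>: "two_form B \<omega>"
  shows "skew_endo B (block N 0 \<omega> (- transpose_endo B N))"
proof -
  let ?N = "block N 0 \<omega> (- transpose_endo B N)"
  note N' = bundle_endoD[OF N] and \<omega>' = two_formD[OF \<omega>]
  have form: "pairing (?N m u) v = snd v (N m (fst u)) + (\<omega> m (fst u) (fst v) - snd u (N m (fst v)))"
    if "v \<in> E_fibre B m" for m u v
    using that by (auto simp: pairing_def block_def transpose_endo_def E_fibre_def)
  have mem: "?N m u \<in> E_fibre B m" if m: "m \<in> topspace (base B)" and u: "u \<in> E_fibre B m" for m u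
  proof -
    have sub: "subspace (fibre B m)" using vb m by (auto simp: vector_bundle_def)
    have x: "fst u \<in> fibre B m" and \<xi>: "snd u \<in> dual_fibre B m" using u by (auto simp: E_fibre_def)
    have lin: "\<omega> m (fst u) (a *\<^sub>R y + b *\<^sub>R z) = a * \<omega> m (fst u) y + b * \<omega> m (fst u) z"
      "snd u (N m (a *\<^sub>R y + b *\<^sub>R z)) = a * snd u (N m y) + b * snd u (N m z)"
      "a *\<^sub>R y + b *\<^sub>R z \<in> fibre B m"
      if "y \<in> fibre B m" "z \<in> fibre B m" for a b y z
      using \<omega>'(1)[OF m x] \<xi> N'(1,2)[OF m] that sub
      by (auto simp: dual_fibre_def linear_on_fibre_def subspace_add subspace_scale)
    have off: "\<omega> m (fst u) y = 0" if "y \<notin> fibre B m" for y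
      using \<omega>'(1)[OF m x] that by (simp add: dual_fibre_def)
    have "\<omega> m (fst u) - transpose_endo B N m (snd u) \<in> dual_fibre B m"
      unfolding dual_fibre_def linear_on_fibre_def
      using lin off by (simp add: transpose_endo_def algebra_simps)
    then show ?thesis using N'(1)[OF m x] by (simp add: block_def E_fibre_def)
  qed
  have comb: "?N m (E_comb a u b v) = E_comb a (?N m u) b (?N m v)"
    if m: "m \<in> topspace (base B)" and u: "u \<in> E_fibre B m" and v: "v \<in> E_fibre B m" for m u v a b
  proof -
    have sub: "subspace (fibre B m)" using vb m by (auto simp: vector_bundle_def)
    have x: "fst u \<in> fibre B m" "fst v \<in> fibre B m" using u v by (auto simp: E_fibre_def)
    have xy: "a *\<^sub>R fst u + b *\<^sub>R fst v \<in> fibre B m" using sub x by (simp add: subspace_add subspace_scale)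
    have "\<omega> m (a *\<^sub>R fst u + b *\<^sub>R fst v) y = a * \<omega> m (fst u) y + b * \<omega> m (fst v) y" for y
    proof (cases "y \<in> fibre B m")
      case True
      then show ?thesis using \<omega>'(3)[OF m True] x by (simp add: linear_on_fibre_def)
    next
      case False
      then show ?thesis
        using \<omega>'(1)[OF m x(1)] \<omega>'(1)[OF m x(2)] \<omega>'(1)[OF m xy] by (simp add: dual_fibre_def)
    qed
    moreover have "N m (a *\<^sub>R fst u + b *\<^sub>R fst v) = a *\<^sub>R N m (fst u) + b *\<^sub>R N m (fst v)"
      using N'(2)[OF m] x by (simp add: linear_on_fibre_def)
    ultimately show ?thesis
      by (auto simp: block_def E_comb_def transpose_endo_def fun_eq_iff algebra_simps)
  qed
  have skew: "pairing (?N m u) v + pairing u (?N m v) = 0"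
    if m: "m \<in> topspace (base B)" and u: "u \<in> E_fibre B m" and v: "v \<in> E_fibre B m" for m u v
  proof -
    have "pairing u (?N m v) = pairing (?N m v) u" by (simp add: pairing_def)
    then show ?thesis
      using \<omega>'(2)[OF m, of "fst u" "fst v"] u v by (simp add: form[OF u] form[OF v] E_fibre_def mem_Times_iff)
  qed
  have "smooth_in B c (cdom c) (\<lambda>m. pairing (?N m (E_frame B c m s)) (E_frame B c m t))"
    if c: "c \<in> atlas B" and st: "s < 2 * fibre_dim B" "t < 2 * fibre_dim B" for c s t
  proof -
    interpret bundle_chart B c using vb c by unfold_locales
    let ?s = "s div 2" and ?t = "t div 2"
    have ht: "?s < r" "?t < r" using st by auto
    have N1: "sm (\<lambda>m. coframe B c \<beta> m (N m (frame c \<alpha> m)))" if "\<alpha> < r" "\<beta> < r" for \<alpha> \<beta>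
      using bundle_endoD(3)[OF N c that] .
    have \<omega>1: "sm (\<lambda>m. \<omega> m (frame c ?s m) (frame c ?t m))"
      using \<omega>'(4)[OF c ht] .
    have z: "N m 0 = 0" "\<omega> m 0 x = 0" "\<omega> m x 0 = 0" "coframe B c \<alpha> m 0 = 0" "0 \<in> fibre B m"
      if m: "m \<in> U" and x: "x \<in> fibre B m" for m x \<alpha>
    proof -
      note t = frame_facts(1)[OF m]
      show 0: "0 \<in> fibre B m" using frame_facts(2)[OF m] by (rule subspace_0)
      show "N m 0 = 0"
        using linear_on_fibre_sum[OF N'(2)[OF t] frame_facts(2)[OF m], of "{}"] by simp
      show "\<omega> m 0 x = 0"
        using linear_on_fibre_sum[OF \<omega>'(3)[OF t x] frame_facts(2)[OF m], of "{}"] by simp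
      then show "\<omega> m x 0 = 0" using \<omega>'(2)[OF t x 0] by simp
      show "coframe B c \<alpha> m 0 = 0" using dual_zero[OF coframe_dual[OF m] t] .
    qed
    have val: "pairing (?N m (E_frame B c m s)) (E_frame B c m t) =
      (if even s then if even t then 0 else - coframe B c ?s m (N m (frame c ?t m))
       else if even t then coframe B c ?t m (N m (frame c ?s m)) else \<omega> m (frame c ?s m) (frame c ?t m))"
      if m: "m \<in> U" for m
      unfolding form[OF E_frame_in[OF m st(2)]]
      using z[OF m frame_in[OF m ht(1)]] z[OF m frame_in[OF m ht(2)]]
        z(2)[OF m z(5)[OF m frame_in[OF m ht(1)]]] by (simp add: E_frame_def)
    have "sm (\<lambda>m. if even s then if even t then 0 else - coframe B c ?s m (N m (frame c ?t m))
       else if even t then coframe B c ?t m (N m (frame c ?s m)) else \<omega> m (frame c ?s m) (frame c ?t m))"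
      by (cases "even s"; cases "even t") (simp_all add: sm_const sm_uminus N1 \<omega>1 ht)
    then show ?thesis by (rule sm_cong) (simp add: val)
  qed
  then show ?thesis
    unfolding skew_endo_def using mem comb skew by blast
qed

lemma skew_endo_cong:
  assumes vb: "vector_bundle B" and \<N>: "skew_endo B \<N>"
    and eq: "\<And>m u. m \<in> topspace (base B) \<Longrightarrow> u \<in> E_fibre B m \<Longrightarrow> \<N> m u = \<N>' m u"
  shows "skew_endo B \<N>'"
proof -
  have sm: "smooth_in B c (cdom c) (\<lambda>m. pairing (\<N>' m (E_frame B c m s)) (E_frame B c m t))"
    if c: "c \<in> atlas B" and st: "s < 2 * fibre_dim B" "t < 2 * fibre_dim B" for c s t
  proof -
    interpret bundle_chart B c using vb c by unfold_locales
    have "sm (\<lambda>m. pairing (\<N> m (E_frame B c m s)) (E_frame B c m t))"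
      using \<N> c st by (simp add: skew_endo_def)
    then show ?thesis
      by (rule sm_cong) (simp add: eq frame_facts(1) E_frame_in st)
  qed
  have comb: "E_comb a u b v \<in> E_fibre B m"
    if m: "m \<in> topspace (base B)" and u: "u \<in> E_fibre B m" and v: "v \<in> E_fibre B m" for m u v a b
  proof -
    have "subspace (fibre B m)" using vb m by (auto simp: vector_bundle_def)
    then show ?thesis using u v
      by (auto simp: E_fibre_def E_comb_def dual_fibre_def linear_on_fibre_def subspace_add subspace_scale
          algebra_simps)
  qed
  have "\<N>' m u \<in> E_fibre B m \<and> (\<forall>v\<in>E_fibre B m.
     (\<forall>a b. \<N>' m (E_comb a u b v) = E_comb a (\<N>' m u) b (\<N>' m v)) \<and>
     pairing (\<N>' m u) v + pairing u (\<N>' m v) = 0)"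
    if m: "m \<in> topspace (base B)" and u: "u \<in> E_fibre B m" for m u
    using \<N> m u comb[OF m u] unfolding skew_endo_def by (simp add: eq[OF m, symmetric])
  then show ?thesis using sm unfolding skew_endo_def by blast
qed

text \<open>Obtained from the general block with \<open>N = 0\<close>. The transpose of 0 sends
  \<xi> to the value \<open>\<xi> 0\<close>, which is zero for linear \<xi> but not for every
  function; the two blocks agree on E, and the congruence rule bridges the difference.\<close>

lemma skew_form:
  assumes vb: "vector_bundle B" and \<omega>: "two_form B \<omega>"
  shows "skew_endo B (block 0 0 \<omega> 0)"
proof (rule skew_endo_cong[OF vb skew_block[OF vb _ \<omega>]])
  have "smooth_in B c (cdom c) (\<lambda>m. coframe B c \<beta> m 0)" if "c \<in> atlas B" for c \<beta>
  proof -
    interpret bundle_chart B c using vb that by unfold_locales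
    show ?thesis
      using sm_const[of 0] by (rule sm_cong) (simp add: dual_zero[OF coframe_dual frame_facts(1)])
  qed
  then show "bundle_endo B 0"
    using vb by (auto simp: bundle_endo_def linear_on_fibre_def vector_bundle_def subspace_0)
  fix m u assume m: "m \<in> topspace (base B)" "u \<in> E_fibre B m"
  have "subspace (fibre B m)" using vb m by (auto simp: vector_bundle_def)
  then have "snd u 0 = 0"
    using linear_on_fibre_sum[of "fibre B m" "snd u" "{}"] m(2) by (auto simp: E_fibre_def dual_fibre_def)
  then show "block 0 0 \<omega> (- transpose_endo B 0) m u = block 0 0 \<omega> 0 m u"
    by (auto simp: block_def transpose_endo_def fun_eq_iff)
qed

lemma two_form_zero: "two_form B 0" if "vector_bundle B"
proof -
  have "smooth_in B c (cdom c) (\<lambda>m. 0)" for c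
    by (simp add: smooth_in_def smooth_def o_def C_diff_const)
  then show ?thesis by (auto simp: two_form_def dual_fibre_def linear_on_fibre_def)
qed

lemma bundle_endo_square:
  assumes vb: "vector_bundle B" and N: "bundle_endo B N"
  shows "bundle_endo B (\<lambda>m x. N m (N m x))"
proof -
  have "smooth_in B c (cdom c) (\<lambda>m. coframe B c \<beta> m (N m (N m (frame c \<alpha> m))))"
    if c: "c \<in> atlas B" and ab: "\<alpha> < fibre_dim B" "\<beta> < fibre_dim B" for c \<alpha> \<beta>
  proof -
    interpret bundle_chart B c using vb c by unfold_locales
    have N1: "sm (\<lambda>m. coframe B c \<beta> m (N m (frame c \<alpha> m)))" if "\<alpha> < r" "\<beta> < r" for \<alpha> \<beta>
      using bundle_endoD(3)[OF N c that] .
    have "sm (\<lambda>m. \<Sum>\<gamma><r. coframe B c \<gamma> m (N m (frame c \<alpha> m)) * coframe B c \<beta> m (N m (frame c \<gamma> m)))"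
      using ab by (intro sm_sum sm_mult N1) auto
    then show ?thesis
    proof (rule sm_cong)
      fix m assume m: "m \<in> U"
      have lin: "linear_on_fibre (fibre B m) (N m)" and sub: "\<And>x. x \<in> fibre B m \<Longrightarrow> N m x \<in> fibre B m"
        using bundle_endoD(1,2)[OF N frame_facts(1)[OF m]] by auto
      have "linear_on_fibre (fibre B m) (\<lambda>x. coframe B c \<beta> m (N m x))"
        using lin sub coframe_dual[OF m, of \<beta>] by (auto simp: linear_on_fibre_def dual_fibre_def)
      from linear_on_fibre_sum[OF this frame_facts(2)[OF m], of "{..<r}" "\<lambda>\<gamma>. frame c \<gamma> m"
          "\<lambda>\<gamma>. coframe B c \<gamma> m (N m (frame c \<alpha> m))"]
      show "(\<Sum>\<gamma><r. coframe B c \<gamma> m (N m (frame c \<alpha> m)) * coframe B c \<beta> m (N m (frame c \<gamma> m))) =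
          coframe B c \<beta> m (N m (N m (frame c \<alpha> m)))"
        using frame_expand[OF m sub[OF frame_in[OF m ab(1)]]] frame_in[OF m] by simp
    qed
  qed
  moreover have "linear_on_fibre (fibre B m) (\<lambda>x. N m (N m x))"
    if "m \<in> topspace (base B)" for m
    using bundle_endoD(1,2)[OF N that] by (auto simp: linear_on_fibre_def)
  ultimately show ?thesis
    using N unfolding bundle_endo_def by (auto simp: image_subset_iff)
qed

text \<open>Compatibility lets N change sides in \<omega>, and this is what makes the composite
  skew-symmetric.\<close>

lemma two_form_compose:
  assumes vb: "vector_bundle B" and N: "bundle_endo B N" and \<omega>: "two_form B \<omega>"
    and comp: "compatible_form B \<omega> N"
  shows "two_form B (\<lambda>m x. \<omega> m (N m x))"
proof -
  have "smooth_in B c (cdom c) (\<lambda>m. \<omega> m (N m (frame c \<alpha> m)) (frame c \<beta> m))"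
    if c: "c \<in> atlas B" and ab: "\<alpha> < fibre_dim B" "\<beta> < fibre_dim B" for c \<alpha> \<beta>
  proof -
    interpret bundle_chart B c using vb c by unfold_locales
    have N1: "sm (\<lambda>m. coframe B c \<beta> m (N m (frame c \<alpha> m)))" if "\<alpha> < r" "\<beta> < r" for \<alpha> \<beta>
      using bundle_endoD(3)[OF N c that] .
    have W1: "sm (\<lambda>m. \<omega> m (frame c \<alpha> m) (frame c \<beta> m))" if "\<alpha> < r" "\<beta> < r" for \<alpha> \<beta>
      using two_formD(4)[OF \<omega> c that] .
    have "sm (\<lambda>m. \<Sum>\<gamma><r. coframe B c \<gamma> m (N m (frame c \<alpha> m)) * \<omega> m (frame c \<gamma> m) (frame c \<beta> m))"
      using ab by (intro sm_sum sm_mult N1 W1) auto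
    then show ?thesis
    proof (rule sm_cong)
      fix m assume m: "m \<in> U"
      have "linear_on_fibre (fibre B m) (\<lambda>x. \<omega> m x (frame c \<beta> m))"
        using two_formD(3)[OF \<omega> frame_facts(1)[OF m] frame_in[OF m ab(2)]] .
      from linear_on_fibre_sum[OF this frame_facts(2)[OF m], of "{..<r}" "\<lambda>\<gamma>. frame c \<gamma> m"
          "\<lambda>\<gamma>. coframe B c \<gamma> m (N m (frame c \<alpha> m))"]
      have "\<omega> m (\<Sum>\<gamma><r. coframe B c \<gamma> m (N m (frame c \<alpha> m)) *\<^sub>R frame c \<gamma> m) (frame c \<beta> m) =
          (\<Sum>\<gamma><r. coframe B c \<gamma> m (N m (frame c \<alpha> m)) * \<omega> m (frame c \<gamma> m) (frame c \<beta> m))"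
        using frame_in[OF m] by simp
      moreover have "N m (frame c \<alpha> m) \<in> fibre B m"
        using bundle_endoD(1)[OF N frame_facts(1)[OF m] frame_in[OF m ab(1)]] .
      ultimately show "(\<Sum>\<gamma><r. coframe B c \<gamma> m (N m (frame c \<alpha> m)) * \<omega> m (frame c \<gamma> m) (frame c \<beta> m)) =
          \<omega> m (N m (frame c \<alpha> m)) (frame c \<beta> m)"
        by (simp add: frame_expand[OF m])
    qed
  qed
  moreover have "\<omega> m (N m x) y = - \<omega> m (N m y) x"
    if m: "m \<in> topspace (base B)" and x: "x \<in> fibre B m" and y: "y \<in> fibre B m" for m x y
  proof -
    have "\<omega> m (N m x) y = \<omega> m x (N m y)"
      using comp m x y by (simp add: compatible_form_def transpose_endo_def)
    also have "\<dots> = - \<omega> m (N m y) x"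
      by (rule two_formD(2)[OF \<omega> m x bundle_endoD(1)[OF N m y]])
    finally show ?thesis .
  qed
  moreover have "linear_on_fibre (fibre B m) (\<lambda>x. \<omega> m (N m x) y)"
    if "m \<in> topspace (base B)" "y \<in> fibre B m" for m y
    using bundle_endoD(1,2)[OF N that(1)] two_formD(3)[OF \<omega> that] by (simp add: linear_on_fibre_def)
  moreover have "\<omega> m (N m x) \<in> dual_fibre B m" if "m \<in> topspace (base B)" "x \<in> fibre B m" for m x
    using two_formD(1)[OF \<omega> that(1) bundle_endoD(1)[OF N that]] .
  ultimately show ?thesis
    unfolding two_form_def by blast
qed

section \<open>Nijenhuis torsion and closed forms in a chart\<close>

context poisson_algebra
begin

text \<open>The degree of \<open>N\<close> is even, so the bracket with \<open>N\<close> on the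
  right is a derivation of the bracket free of signs.\<close>

lemma br_derivation:
  assumes F: "F \<in> hom f u" and G: "G \<in> hom g v" and N: "N \<in> hom 2 w"
  shows "br (br F G) N = br (br F N) G + br F (br G N)"
proof -
  have "br F (br G N) = br (br F G) N + sg (f * g) (br G (br F N))"
    by (rule jacobi[OF F G N])
  moreover have "br G (br F N) = sg (g * f + 1) (br (br F N) G)"
    using br_skew[OF G br_hom[OF F N]] by simp
  ultimately show ?thesis
    by (simp add: sg_sg) (simp add: sg_def)
qed

text \<open>
  \<open>br (br X M) Y\<close> is the bracket of \<open>X\<close> and \<open>Y\<close> for the structure \<open>M\<close>; the hypothesis \<open>torsion\<close>
  says that the torsion of \<open>N\<close> vanishes on \<open>X\<close> and \<open>Y\<close>, and \<open>N2\<close> acts as the square of \<open>N\<close>.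
\<close>

lemma torsion_bracket:
  assumes M: "M \<in> hom 3 1" and N: "N \<in> hom 2 0" and N2: "N2 \<in> hom 2 0"
    and square: "\<And>F. F \<in> hom 1 (- 1) \<Longrightarrow> br (br F N) N = br F N2"
    and X: "X \<in> hom 1 (- 1)" and Y: "Y \<in> hom 1 (- 1)"
    and torsion: "br (br (br X N) M) (br Y N) -
      br (br (br (br X N) M) Y + br (br X M) (br Y N) - br (br (br X M) Y) N) N = 0"
  shows "br (br X (br (br M N) N + br M N2)) Y = 0"
proof -
  define b where "b K X Y = br (br X K) Y" for K X Y
  define \<delta> where "\<delta> F = br F N" for F
  have XN: "\<delta> F \<in> hom k w" if "F \<in> hom k w" for F k w
    using br_hom[OF that N] by (simp add: \<delta>_def)
  have bh: "b K F G \<in> hom 1 (- 1)" if "K \<in> hom 3 1" "F \<in> hom 1 (- 1)" "G \<in> hom 1 (- 1)" for K F G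
    using br_hom[OF br_hom[OF that(2,1)] that(3)] by (simp add: b_def)
  have der: "br (b K F G) L = b (br K L) F G + b K (br F L) G + b K F (br G L)"
    if "K \<in> hom 3 1" "F \<in> hom 1 (- 1)" "G \<in> hom 1 (- 1)" "L \<in> hom 2 0" for K F G L
  proof -
    have "br (br F K) L = br (br F L) K + br F (br K L)" by (rule br_derivation[OF that(2,1,4)])
    moreover have "br (br F L) K \<in> hom 2 0" "br F (br K L) \<in> hom 2 0"
      using br_hom[OF br_hom[OF that(2,4)] that(1)] br_hom[OF that(2) br_hom[OF that(1,4)]] by simp_all
    ultimately show ?thesis
      using br_derivation[OF br_hom[OF that(2,1)] that(3,4)] by (simp add: b_def br_add_left add_ac)
  qed
  have d: "\<delta> (b K F G) = b (\<delta> K) F G + b K (\<delta> F) G + b K F (\<delta> G)"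
    if "K \<in> hom 3 1" "F \<in> hom 1 (- 1)" "G \<in> hom 1 (- 1)" for K F G
    unfolding \<delta>_def by (rule der[OF that N])
  have d_add: "\<delta> (F + G) = \<delta> F + \<delta> G" if "F \<in> hom 1 (- 1)" "G \<in> hom 1 (- 1)" for F G
    using that by (simp add: \<delta>_def br_add_left)
  have d_diff: "\<delta> (F - G) = \<delta> F - \<delta> G" if "F \<in> hom 1 (- 1)" "G \<in> hom 1 (- 1)" for F G
    using that br_add_left[OF that(1) hom_uminus[OF that(2)]] by (simp add: \<delta>_def br_uminus_left)
  note mem = M X Y XN[OF X] XN[OF Y] XN[OF M] XN[OF XN[OF X]] XN[OF XN[OF Y]]
  note h = bh[OF M]
  \<comment> \<open>On sections \<delta> applied twice is the bracket with \<open>N2\<close>, which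
    is itself a derivation. Comparing the two descriptions brings in the structure
    \<open>br M N2\<close>.\<close>
  have e: "\<delta> (\<delta> (b M X Y)) = b (br M N2) X Y + b M (\<delta> (\<delta> X)) Y + b M X (\<delta> (\<delta> Y))"
    using der[OF M X Y N2] square[OF X] square[OF Y] square[OF h[OF X Y]] by (simp add: \<delta>_def)
  have d1: "b (\<delta> M) F G = \<delta> (b M F G) - b M (\<delta> F) G - b M F (\<delta> G)"
    if "F \<in> hom 1 (- 1)" "G \<in> hom 1 (- 1)" for F G
    using d[OF M that] by (simp add: algebra_simps)
  have dd: "\<delta> (b (\<delta> M) X Y) = \<delta> (\<delta> (b M X Y)) - \<delta> (b M (\<delta> X) Y) - \<delta> (b M X (\<delta> Y))"
    unfolding d1[OF X Y]
    by (subst d_diff, (intro hom_diff XN h mem)+, subst d_diff, (intro XN h mem)+, rule refl)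
  have "b (\<delta> (\<delta> M)) X Y = \<delta> (b (\<delta> M) X Y) - b (\<delta> M) (\<delta> X) Y - b (\<delta> M) X (\<delta> Y)"
    using d[OF mem(6) X Y] by (simp add: algebra_simps)
  \<comment> \<open>The summand with \<open>N2\<close> cancels the terms in
    \<open>\<delta> (\<delta> X)\<close> and \<open>\<delta> (\<delta> Y)\<close> and supplies a
    second copy of \<open>\<delta> (\<delta> (b M X Y))\<close>; what is left is the torsion
    twice.\<close>
  then have "b (\<delta> (\<delta> M)) X Y + b (br M N2) X Y =
      (b M (\<delta> X) (\<delta> Y) - (\<delta> (b M (\<delta> X) Y) + \<delta> (b M X (\<delta> Y)) - \<delta> (\<delta> (b M X Y)))) +
      (b M (\<delta> X) (\<delta> Y) - (\<delta> (b M (\<delta> X) Y) + \<delta> (b M X (\<delta> Y)) - \<delta> (\<delta> (b M X Y))))"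
    unfolding dd d1[OF mem(4) Y] d1[OF X mem(5)] using e by (simp add: algebra_simps)
  also have "b M (\<delta> X) (\<delta> Y) - (\<delta> (b M (\<delta> X) Y) + \<delta> (b M X (\<delta> Y)) - \<delta> (\<delta> (b M X Y))) = 0"
  proof -
    have "b M (\<delta> X) (\<delta> Y) - \<delta> (b M (\<delta> X) Y + b M X (\<delta> Y) - \<delta> (b M X Y)) = 0"
      using torsion by (simp add: b_def \<delta>_def)
    then show ?thesis
      by (subst (asm) d_diff, (intro hom_add XN h mem)+, subst (asm) d_add, (intro XN h mem)+, simp)
  qed
  finally have "b (\<delta> (\<delta> M)) X Y + b (br M N2) X Y = 0" by simp
  moreover have "b (\<delta> (\<delta> M) + br M N2) X Y = b (\<delta> (\<delta> M)) X Y + b (br M N2) X Y"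
  proof -
    have MN2: "br M N2 \<in> hom 3 1" using br_hom[OF M N2] by simp
    have "br X (\<delta> (\<delta> M) + br M N2) = br X (\<delta> (\<delta> M)) + br X (br M N2)"
      by (rule br_add_right[OF XN[OF mem(6)] MN2])
    moreover have "br X (\<delta> (\<delta> M)) \<in> hom 2 0" "br X (br M N2) \<in> hom 2 0"
      using br_hom[OF X XN[OF mem(6)]] br_hom[OF X MN2] by simp_all
    ultimately show ?thesis by (simp add: b_def br_add_left)
  qed
  ultimately show ?thesis by (simp add: b_def \<delta>_def)
qed

end

lemma gpoly_double_eq_0: "F + F = 0 \<Longrightarrow> F = 0" for F :: "'m \<Rightarrow> gpoly"
proof -
  assume F: "F + F = 0"
  have "F m = 0" for m
  proof -
    have "2 *\<^sub>R F m = 0" using fun_cong[OF F, of m] by (simp add: scaleR_2)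
    then show ?thesis by simp
  qed
  then show "F = 0" by auto
qed

text \<open>If all factors were \<theta>, the weight would be minus their number. The \<tau> found
  here is what a bracket with a section of A differentiates by.\<close>

lemma mono_weight_even_factor:
  assumes "mono_weight a \<ge> 0" "snd a \<noteq> {||}"
  obtains s where "s |\<in>| snd a" "even s"
proof (rule ccontr)
  assume "\<not> thesis"
  then have "odd s" if "s \<in> fset (snd a)" for s using that \<open>\<And>s. s |\<in>| snd a \<Longrightarrow> even s \<Longrightarrow> thesis\<close> by blast
  then have "mono_weight a = - int (card (fset (snd a)))" by (simp add: mono_weight_def)
  moreover have "card (fset (snd a)) > 0"
    using assms(2) by (simp add: card_gt_0_iff) (metis bot_fset.rep_eq fset_inject)
  ultimately show False using assms(1) by simp
qed

section \<open>Detecting functions by their brackets with sections of A\<close>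

context bundle_chart
begin

lemma endo_gpoly_action:
  assumes \<N>: "skew_endo B \<N>" and F: "F \<in> hom 1 w"
  shows "P.br F (endo_gpoly B \<N> c) = (\<lambda>m. if m \<in> U then E_to_gpoly B c m (\<N> m (gpoly_to_E B c m (F m))) else 0)"
proof
  fix m
  have F1: "fset (snd a) \<subseteq> {..<2 * r} \<and> mono_degree a = 1" if "coeff (F m) a \<noteq> 0" for a
    using homD(4)[OF F that] by (auto simp: monomials_def)
  have "endo_gpoly B \<N> c m = 0" if "m \<notin> U" using that by (simp add: endo_gpoly_def)
  then show "P.br F (endo_gpoly B \<N> c) m =
      (if m \<in> U then E_to_gpoly B c m (\<N> m (gpoly_to_E B c m (F m))) else 0)"
    using endo_gpoly_bracket[OF \<N> _ F1] br_apply[of m F] br_outside[of m F] homD(1)[OF F]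
    by simp
qed

lemma gpoly_to_E_vector:
  assumes F: "F \<in> hom 1 (- 1)" and m: "m \<in> U"
  shows "gpoly_to_E B c m (F m) = (fst (gpoly_to_E B c m (F m)), 0)" "fst (gpoly_to_E B c m (F m)) \<in> fibre B m"
proof -
  have "({#}, {|tau_ix \<alpha>|}) \<notin> monomials 1 (- 1)" for \<alpha>
    by (simp add: monomials_def mono_weight_def)
  then have "coeff (F m) ({#}, {|tau_ix \<alpha>|}) = 0" for \<alpha> by (rule homD(5)[OF F])
  then show "gpoly_to_E B c m (F m) = (fst (gpoly_to_E B c m (F m)), 0)"
    by (simp add: gpoly_to_E_def fun_eq_iff)
  show "fst (gpoly_to_E B c m (F m)) \<in> fibre B m"
    using gpoly_to_E_in[OF m, of "F m"] by (auto simp: E_fibre_def)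
qed

lemma gpoly_to_E_E_to_gpoly:
  assumes m: "m \<in> U" and v: "v \<in> E_fibre B m"
  shows "gpoly_to_E B c m (E_to_gpoly B c m v) = v"
proof -
  have coeffs: "coeff (E_to_gpoly B c m v) ({#}, {|s|}) = pairing v (E_frame B c m (star s))" if "s < 2 * r" for s
  proof -
    have "coeff (E_to_gpoly B c m v) ({#}, {|s|}) =
        (\<Sum>t<2 * r. if t = s then pairing v (E_frame B c m (star s)) else 0)"
      unfolding E_to_gpoly_eq[OF m v] coeff_sum by (intro sum.cong refl) (auto simp: coeff_odd_gen)
    then show ?thesis using that by simp
  qed
  have c1: "coeff (E_to_gpoly B c m v) ({#}, {|theta_ix \<alpha>|}) = coframe B c \<alpha> m (fst v)"
    "coeff (E_to_gpoly B c m v) ({#}, {|tau_ix \<alpha>|}) = snd v (frame c \<alpha> m)" if "\<alpha> < r" for \<alpha>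
    using coeffs[of "theta_ix \<alpha>"] coeffs[of "tau_ix \<alpha>"] that pairing_frame[OF that m v]
    by (simp_all add: star_def)
  have v': "fst v \<in> fibre B m" "snd v \<in> dual_fibre B m" using v by (auto simp: E_fibre_def)
  have "(\<Sum>\<alpha><r. snd v (frame c \<alpha> m) * coframe B c \<alpha> m y) = snd v y" for y
  proof (cases "y \<in> fibre B m")
    case True
    then show ?thesis using dual_expand[OF m v'(2) True] by (simp add: mult.commute)
  next
    case False
    then show ?thesis using coframe_dual[OF m] v'(2) by (auto simp: dual_fibre_def intro!: sum.neutral)
  qed
  then show ?thesis
    unfolding gpoly_to_E_def using frame_expand[OF m v'(1)] by (simp add: c1 prod_eq_iff fun_eq_iff)
qed

text \<open>Weight 2 forces a factor \<tau>, and the bracket with the conjugate \<theta>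
  differentiates by it. The test elements are local, so the constant coefficient 1 is
  admissible.\<close>

lemma hom_2_2_eqI:
  assumes G: "G \<in> hom 2 2" and zero: "\<And>X. X \<in> hom 1 (- 1) \<Longrightarrow> P.br X G = 0"
  shows "G = 0"
proof
  fix m
  show "G m = 0 m"
  proof (cases "m \<in> U")
    case True
    have "coeff (G m) a = 0" for a
    proof (rule ccontr)
      assume a: "coeff (G m) a \<noteq> 0"
      then have am: "a \<in> monomials 2 2" by (rule homD(4)[OF G])
      have "snd a \<noteq> {||}" "mono_weight a \<ge> 0" using am by (auto simp: monomials_def mono_weight_def)
      then obtain s where s: "s |\<in>| snd a" "even s" by (metis mono_weight_even_factor)
      then have "s < 2 * r" using am by (auto simp: monomials_def)
      then have ss: "star s < 2 * r" "odd (star s)" using s by simp_all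
      have X: "frame_section (\<lambda>_. 1) (star s) c \<in> hom 1 (- 1)"
        using frame_section_hom[OF sm_const ss(1)] ss(2) by simp
      have "local_bracket B c (frame_section (\<lambda>_. 1) (star s) c) G m = 0"
        using fun_cong[OF zero[OF X], of m] br_apply[OF True] by simp
      then have "left_deriv s (G m) = 0"
        using bracket_frame_section[OF sm_const ss(1) True, of 1 G] by simp
      then show False using left_deriv_eq_0D[OF _ s(1)] a by blast
    qed
    then show ?thesis by (simp add: gpoly_eq_iff)
  qed (use homD(1)[OF G] in simp)
qed

text \<open>Weight 1 forces a factor \<tau>, so it suffices that the derivative \<open>L\<close> of
  \<open>T\<close> by each \<tau> vanishes at the point. The first section yields a nonzero multiple
  of \<open>L\<close> there. As \<open>L\<close> has degree 2 and weight 0, its monomials are p or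
  \<tau>\<theta>, and the jets \<open>h\<close> and \<open>b\<close> of the second section detect
  these two kinds.\<close>

lemma torsion_free_imp_zero:
  assumes T: "T \<in> hom 3 1"
    and zero: "\<And>X Y. X \<in> A_sections B \<Longrightarrow> Y \<in> A_sections B \<Longrightarrow> P.br (P.br (X c) T) (Y c) = 0"
  shows "T = 0"
proof
  fix m
  show "T m = 0 m"
  proof (cases "m \<in> U")
    case m: True
    obtain b h where "jet_sections m b h" using jet_sections_exist[OF m] by blast
    then have b: "sm b" "b m \<noteq> 0" "\<And>i. i < n \<Longrightarrow> pd i b m = 0"
      and h: "\<And>j. j < n \<Longrightarrow> sm (h j)" "\<And>j. j < n \<Longrightarrow> h j m = 0"
        "\<And>i j. i < n \<Longrightarrow> j < n \<Longrightarrow> pd i (h j) m = (if i = j then b m else 0)"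
      and bA: "\<And>\<alpha>. \<alpha> < r \<Longrightarrow> frame_section b (theta_ix \<alpha>) \<in> A_sections B"
      and hA: "\<And>\<alpha> j. \<alpha> < r \<Longrightarrow> j < n \<Longrightarrow> frame_section (h j) (theta_ix \<alpha>) \<in> A_sections B"
      unfolding jet_sections_def by auto
    have star_theta: "star (theta_ix \<alpha>) = tau_ix \<alpha>" for \<alpha> by (simp add: star_def)
    have theta_less: "theta_ix \<alpha> < 2 * r" if "\<alpha> < r" for \<alpha> using that by simp
    have "left_deriv (tau_ix \<alpha>) (T m) = 0" if \<alpha>: "\<alpha> < r" for \<alpha>
    proof -
      define L where "L = cderiv (Odd (tau_ix \<alpha>)) T"
      have L: "L \<in> hom 2 0"
        unfolding L_def using cderiv_hom[of "Odd (tau_ix \<alpha>)" T 3 1] T \<alpha> by (auto simp: coordinates_def)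
      have Xh: "frame_section b (theta_ix \<alpha>) c \<in> hom 1 (- 1)"
        using frame_section_hom[OF b(1) theta_less[OF \<alpha>]] by simp
      define Z where "Z = P.br (frame_section b (theta_ix \<alpha>) c) T"
      have Z: "Z \<in> hom 2 0" using P.br_hom[OF Xh T] by (simp add: Z_def)
      \<comment> \<open>The value at the single point \<open>m\<close> is enough: the bracket with a
        second section takes no base derivatives of \<open>Z\<close>.\<close>
      have Zm: "Z m = b m *\<^sub>R L m"
        using bracket_frame_section[OF b(1) theta_less[OF \<alpha>] m, of T]
        by (simp add: Z_def L_def br_apply[OF m] b(3) star_theta)
      have YZ: "local_bracket B c (frame_section f (theta_ix \<beta>) c) Z m = 0"
        if f: "sm f" "frame_section f (theta_ix \<beta>) \<in> A_sections B" and \<beta>: "\<beta> < r" for f \<beta>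
      proof -
        have Y: "frame_section f (theta_ix \<beta>) c \<in> hom 1 (- 1)"
          using frame_section_hom[OF f(1) theta_less[OF \<beta>]] by simp
        have "P.br (frame_section f (theta_ix \<beta>) c) Z = sg (1 * 2 + 1) (P.br Z (frame_section f (theta_ix \<beta>) c))"
          by (rule P.br_skew[OF Y Z])
        also have "P.br Z (frame_section f (theta_ix \<beta>) c) = 0"
          unfolding Z_def by (rule zero[OF bA[OF \<alpha>] f(2)])
        finally show ?thesis using br_apply[OF m] by (metis sg_zero zero_fun_apply)
      qed
      have left: "left_deriv (tau_ix \<beta>) (L m) = 0" if \<beta>: "\<beta> < r" for \<beta>
        using YZ[OF b(1) bA[OF \<beta>] \<beta>] bracket_frame_section[OF b(1) theta_less[OF \<beta>] m, of Z] b(2)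
        by (simp add: b(3) star_theta Zm left_deriv_mono_map mono_map_scaleR)
      have right: "p_deriv i (L m) = 0" if i: "i < n" for i
      proof -
        define Q where "Q = p_deriv i (L m)"
        \<comment> \<open>One factor \<open>b m\<close> comes from the value of \<open>Z\<close>,
          the other from the derivative of \<open>h i\<close>.\<close>
        have "(\<Sum>j<n. pd j (h i) m *\<^sub>R (theta \<alpha> * p_deriv j (Z m))) =
            (\<Sum>j<n. if j = i then (b m * b m) *\<^sub>R (theta \<alpha> * Q) else 0)"
          by (intro sum.cong refl) (auto simp: h(3) i Zm p_deriv_scaleR Q_def)
        then have "(b m * b m) *\<^sub>R (theta \<alpha> * Q) = 0"
          using YZ[OF h(1)[OF i] hA[OF \<alpha> i] \<alpha>] bracket_frame_section[OF h(1)[OF i] theta_less[OF \<alpha>] m, of Z] i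
          by (simp add: h(2)[OF i])
        then have "theta \<alpha> * Q = 0" using b(2) by simp
        then have "left_deriv (theta_ix \<alpha>) (theta \<alpha> * Q) = 0" by (simp add: left_deriv_mono_map)
        \<comment> \<open>\<open>Q\<close> has degree 0, and there are no monomials of degree
          -1.\<close>
        moreover have "left_deriv (theta_ix \<alpha>) Q = 0"
        proof -
          have Q0: "cderiv (Mom i) L \<in> hom 0 0"
            using cderiv_hom[of "Mom i" L 2 0] L i by (auto simp: coordinates_def)
          have "cderiv (Odd (theta_ix \<alpha>)) (cderiv (Mom i) L) \<in> hom (- 1) 1"
            using cderiv_hom[of "Odd (theta_ix \<alpha>)", OF _ Q0] \<alpha> by (auto simp: coordinates_def)
          moreover have "monomials (- 1) 1 = {}" by (auto simp: monomials_def)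
          ultimately have "coeff (left_deriv (theta_ix \<alpha>) Q) a = 0" for a
            using homD(5)[of _ "- 1" 1 a m] by (fastforce simp: Q_def)
          then show ?thesis by (simp add: gpoly_eq_iff)
        qed
        ultimately show ?thesis by (simp add: left_deriv_mult left_deriv_odd_gen Q_def)
      qed
      have "coeff (L m) a = 0" for a
      proof (rule ccontr)
        assume a: "coeff (L m) a \<noteq> 0"
        then have am: "a \<in> monomials 2 0" by (rule homD(4)[OF L])
        have "i \<notin># fst a" for i
          using a am right[of i] p_deriv_eq_0D[of i "L m" a] by (auto simp: monomials_def)
        then have "fst a = {#}" by (simp add: multiset_eq_iff not_in_iff)
        then have "snd a \<noteq> {||}" "mono_weight a \<ge> 0"
          using am by (auto simp: monomials_def mono_degree_def fcard.rep_eq)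
        then obtain s where s: "s |\<in>| snd a" "even s" by (metis mono_weight_even_factor)
        then obtain \<beta> where \<beta>: "s = tau_ix \<beta>" by (auto elim: evenE)
        then have "\<beta> < r" using s am by (auto simp: monomials_def)
        then show False using left left_deriv_eq_0D[OF _ s(1)] a \<beta> by blast
      qed
      then show ?thesis by (simp add: gpoly_eq_iff L_def)
    qed
    note left = this
    have "coeff (T m) a = 0" for a
    proof (rule ccontr)
      assume a: "coeff (T m) a \<noteq> 0"
      then have am: "a \<in> monomials 3 1" by (rule homD(4)[OF T])
      have "snd a \<noteq> {||}" "mono_weight a \<ge> 0" using am by (auto simp: monomials_def mono_weight_def)
      then obtain s where s: "s |\<in>| snd a" "even s" by (metis mono_weight_even_factor)
      then obtain \<beta> where \<beta>: "s = tau_ix \<beta>" by (auto elim: evenE)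
      then have "\<beta> < r" using s am by (auto simp: monomials_def)
      then show False using left left_deriv_eq_0D[OF _ s(1)] a \<beta> by blast
    qed
    then show ?thesis by (simp add: gpoly_eq_iff)
  qed (use homD(1)[OF T] in simp)
qed

end

context poisson_algebra
begin

text \<open>For \<open>M\<close> of odd degree the Jacobi identity says that twice the left-hand
  side is \<open>br (br M M) G\<close>.\<close>

lemma br_twice_eq_0:
  assumes M: "M \<in> hom 3 w" "br M M = 0" and G: "G \<in> hom k v" and double: "\<And>F :: 'r. F + F = 0 \<Longrightarrow> F = 0"
  shows "br M (br M G) = 0"
proof -
  have "br M (br M G) = br (br M M) G + sg (3 * 3) (br M (br M G))"
    by (rule jacobi[OF M(1) M(1) G])
  then have "br M (br M G) + br M (br M G) = 0"
    by (simp add: M(2) br_zero sg_def add_eq_0_iff)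
  then show ?thesis by (rule double)
qed

end

section \<open>The computation in a chart and its application to the blocks\<close>

context bundle_chart
begin

text \<open>The blocks are abstracted to functions of the right degree and weight whose actions on
  sections of A are related: \<open>N2\<close> acts as the square of \<open>N\<close>, and
  \<open>WN\<close> as \<omega>N. Compatibility of \<omega> and N takes the form of the hypothesis
  \<open>WN'\<close>.\<close>

lemma weak_deforming_chart:
  assumes M: "M \<in> hom 3 1" "P.br M M = 0" and N: "N \<in> hom 2 0" and N2: "N2 \<in> hom 2 0"
    and W: "W \<in> hom 2 2" "P.br M W = 0" and WN: "WN \<in> hom 2 2" "P.br M WN = 0"
    and square: "\<And>X. X \<in> hom 1 (- 1) \<Longrightarrow> P.br (P.br X N) N = P.br X N2"
    and NW: "\<And>X. X \<in> hom 1 (- 1) \<Longrightarrow> P.br (P.br X N) W = P.br X WN"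
    and WN': "\<And>X. X \<in> hom 1 (- 1) \<Longrightarrow> P.br (P.br X W) N = - P.br X WN"
    and A: "\<And>X. X \<in> A_sections B \<Longrightarrow> X c \<in> hom 1 (- 1)"
    and torsion: "\<And>X Y. X \<in> A_sections B \<Longrightarrow> Y \<in> A_sections B \<Longrightarrow>
      P.br (P.br (P.br (X c) N) M) (P.br (Y c) N) - P.br (P.br (P.br (P.br (X c) N) M) (Y c) +
        P.br (P.br (X c) M) (P.br (Y c) N) - P.br (P.br (P.br (X c) M) (Y c)) N) N = 0"
  shows "P.br M (P.br (P.br (N + W) M) (N + W)) = 0"
proof -
  have NWh: "P.br N W \<in> hom 2 2" using P.br_hom[OF N W(1)] by simp
  have MN: "P.br N M \<in> hom 3 1" using P.br_hom[OF N M(1)] by simp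
  have MNN: "P.br (P.br M N) N \<in> hom 3 1" using P.br_hom[OF P.br_hom[OF M(1) N] N] by simp
  have MN2: "P.br M N2 \<in> hom 3 1" using P.br_hom[OF M(1) N2] by simp
  have "P.br N W - (WN + WN) = 0"
  proof (rule hom_2_2_eqI)
    show "P.br N W - (WN + WN) \<in> hom 2 2" by (intro P.hom_diff P.hom_add NWh WN)
    fix X assume X: "X \<in> hom 1 (- 1)"
    have XW: "P.br X W \<in> hom 1 1" using P.br_hom[OF X W(1)] by simp
    have XNW: "P.br X (P.br N W) = P.br (P.br X N) W + sg (1 * 2) (P.br N (P.br X W))"
      by (rule P.jacobi[OF X N W(1)])
    have sign: "sg (1 * 2) (sg (2 * 1 + 1) (- F)) = F" for F :: "'m \<Rightarrow> gpoly"
      by (simp add: sg_def)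
    note XNW
    also have "P.br N (P.br X W) = sg (2 * 1 + 1) (P.br (P.br X W) N)"
      by (rule P.br_skew[OF N XW])
    \<comment> \<open>Exchanging \<open>N\<close> with {X, W} gives one sign and the action of minus
      the transpose another. They cancel, so {X, WN} appears twice; hence the factor 2.\<close>
    finally have XNW': "P.br X (P.br N W) = P.br X WN + P.br X WN"
      by (simp only: NW[OF X] WN'[OF X] sign)
    then show "P.br X (P.br N W - (WN + WN)) = 0"
      by (simp only: P.br_diff_right[OF NWh P.hom_add[OF WN(1) WN(1)]] P.br_add_right[OF WN(1) WN(1)]
          XNW' diff_self)
  qed
  then have "P.br M (P.br N W) = 0"
    using P.br_add_right[OF WN(1) WN(1), of M] WN(2) by simp
  moreover have "P.br N (P.br M W) = P.br (P.br N M) W + sg (2 * 3) (P.br M (P.br N W))"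
    by (rule P.jacobi[OF N M(1) W(1)])
  ultimately have NMW: "P.br (P.br N M) W = 0"
    using W(2) by (simp add: P.br_zero)
  have T: "P.br (P.br M N) N + P.br M N2 = 0"
  proof (rule torsion_free_imp_zero)
    show "P.br (P.br M N) N + P.br M N2 \<in> hom 3 1" by (intro P.hom_add MNN MN2)
    fix X Y assume XY: "X \<in> A_sections B" "Y \<in> A_sections B"
    show "P.br (P.br (X c) (P.br (P.br M N) N + P.br M N2)) (Y c) = 0"
      by (rule P.torsion_bracket[OF M(1) N N2 square A[OF XY(1)] A[OF XY(2)] torsion[OF XY]])
  qed
  have WM: "P.br W M = 0" using P.br_skew[OF W(1) M(1)] W(2) by simp
  have NM: "P.br N M = - P.br M N" using P.br_skew[OF N M(1)] by (simp add: sg_def)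
  \<comment> \<open>The sum mixes the weights 0 and 2, hence \<open>br_add_mixed\<close>. The
    brackets {W, M} and {{N, M}, W} drop out.\<close>
  have "P.br (P.br (N + W) M) (N + W) = P.br (P.br N M) N"
    by (simp add: br_add_mixed[OF N W(1)] WM NMW)
  also have "\<dots> = P.br M N2"
    using T P.br_uminus_left[OF P.br_hom[OF M(1) N], of N] by (simp add: NM minus_unique)
  finally show ?thesis
    using P.br_twice_eq_0[OF M N2 gpoly_double_eq_0] by simp
qed

lemma N_zero: "bundle_endo B N \<Longrightarrow> m \<in> U \<Longrightarrow> N m 0 = 0"
  using linear_on_fibre_sum[OF bundle_endoD(2)[OF _ frame_facts(1)] frame_facts(2), of N m "{}"] by simp

lemma form_zero:
  assumes \<omega>: "two_form B \<omega>" and m: "m \<in> U" and x: "x \<in> fibre B m"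
  shows "\<omega> m 0 x = 0" "\<omega> m x 0 = 0"
proof -
  show "\<omega> m 0 x = 0"
    using linear_on_fibre_sum[OF two_formD(3)[OF \<omega> frame_facts(1)[OF m] x] frame_facts(2)[OF m], of "{}"]
    by simp
  then show "\<omega> m x 0 = 0"
    using two_formD(2)[OF \<omega> frame_facts(1)[OF m] x subspace_0[OF frame_facts(2)[OF m]]] by simp
qed

lemma endo_gpoly_split:
  "endo_gpoly B (block N 0 \<omega> (- transpose_endo B N)) c =
    endo_gpoly B (block N 0 0 (- transpose_endo B N)) c + endo_gpoly B (block 0 0 \<omega> 0) c"
proof
  fix m
  have "pairing (block N 0 \<omega> (- transpose_endo B N) m u) (E_frame B c m t) =
      pairing (block N 0 0 (- transpose_endo B N) m u) (E_frame B c m t) +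
      pairing (block 0 0 \<omega> 0 m u) (E_frame B c m t)" if m: "m \<in> U" for u t
    using dual_zero[OF coframe_dual[OF m] frame_facts(1)[OF m]]
    by (simp add: pairing_def block_def E_frame_def)
  then show "endo_gpoly B (block N 0 \<omega> (- transpose_endo B N)) c m =
    (endo_gpoly B (block N 0 0 (- transpose_endo B N)) c + endo_gpoly B (block 0 0 \<omega> 0) c) m"
    by (simp add: endo_gpoly_def scaleR_add_left scaleR_add_right sum.distrib)
qed

text \<open>Nonzero coefficients couple a vector of A with a covector, so only products
  \<tau>\<theta> occur.\<close>

lemma endo_block_hom:
  assumes N: "bundle_endo B N"
  shows "endo_gpoly B (block N 0 0 (- transpose_endo B N)) c \<in> hom 2 0"
proof (rule endo_gpoly_hom[OF skew_block[OF vb N two_form_zero[OF vb]]])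
  fix m s t assume m: "m \<in> U" and st: "s < 2 * r" "t < 2 * r"
    and ne: "pairing (block N 0 0 (- transpose_endo B N) m (E_frame B c m (star s))) (E_frame B c m (star t)) \<noteq> 0"
  have "even s \<noteq> even t"
  proof (rule ccontr)
    assume "\<not> even s \<noteq> even t"
    then have "pairing (block N 0 0 (- transpose_endo B N) m (E_frame B c m (star s))) (E_frame B c m (star t)) = 0"
      using N_zero[OF N m] dual_zero[OF coframe_dual[OF m] frame_facts(1)[OF m]]
      by (cases "even s") (simp_all add: pairing_def block_def E_frame_def transpose_endo_def)
    then show False using ne by blast
  qed
  then show "(if even s then 1 else - 1) + (if even t then 1 else - 1) = (0 :: int)" by auto
qed

lemma form_block_hom:
  assumes \<omega>: "two_form B \<omega>"
  shows "endo_gpoly B (block 0 0 \<omega> 0) c \<in> hom 2 2"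
proof (rule endo_gpoly_hom[OF skew_form[OF vb \<omega>]])
  fix m s t assume m: "m \<in> U" and st: "s < 2 * r" "t < 2 * r"
    and ne: "pairing (block 0 0 \<omega> 0 m (E_frame B c m (star s))) (E_frame B c m (star t)) \<noteq> 0"
  note e = E_frame_in[OF m, of "star s"] E_frame_in[OF m, of "star t"]
  have f: "fst (E_frame B c m (star s)) \<in> fibre B m" "fst (E_frame B c m (star t)) \<in> fibre B m"
    "snd (E_frame B c m (star t)) \<in> dual_fibre B m"
    using e st by (auto simp: E_fibre_def)
  have "\<omega> m (fst (E_frame B c m (star s))) (fst (E_frame B c m (star t))) \<noteq> 0"
    using ne dual_zero[OF f(3) frame_facts(1)[OF m]] by (simp add: pairing_def block_def)
  then have "fst (E_frame B c m (star s)) \<noteq> 0" "fst (E_frame B c m (star t)) \<noteq> 0"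
    using form_zero[OF \<omega> m] f by auto
  then have "even s" "even t" by (auto simp: E_frame_def split: if_splits)
  then show "(if even s then 1 else - 1) + (if even t then 1 else - 1) = (2 :: int)" by simp
qed

lemma endo_block_vector: "block N 0 0 (- transpose_endo B N) m (x, 0) = (N m x, 0)"
  by (simp add: block_def transpose_endo_def fun_eq_iff)

text \<open>The second formula returns the result as a vector of the fibre, so that a further
  endomorphism can be applied to it.\<close>

lemma endo_block_action:
  assumes N: "bundle_endo B N" and X: "X \<in> hom 1 (- 1)" and m: "m \<in> U"
  shows "P.br X (endo_gpoly B (block N 0 0 (- transpose_endo B N)) c) m =
      E_to_gpoly B c m (N m (fst (gpoly_to_E B c m (X m))), 0)"
    "gpoly_to_E B c m (P.br X (endo_gpoly B (block N 0 0 (- transpose_endo B N)) c) m) =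
      (N m (fst (gpoly_to_E B c m (X m))), 0)"
proof -
  note x = gpoly_to_E_vector[OF X m]
  show 1: "P.br X (endo_gpoly B (block N 0 0 (- transpose_endo B N)) c) m =
      E_to_gpoly B c m (N m (fst (gpoly_to_E B c m (X m))), 0)"
    unfolding endo_gpoly_action[OF skew_block[OF vb N two_form_zero[OF vb]] X]
    using m by (subst x(1)) (simp add: endo_block_vector)
  have "(0 :: 'v \<Rightarrow> real) \<in> dual_fibre B m" by (auto simp: dual_fibre_def linear_on_fibre_def)
  then have "(N m (fst (gpoly_to_E B c m (X m))), 0) \<in> E_fibre B m"
    using bundle_endoD(1)[OF N frame_facts(1)[OF m] x(2)] by (simp add: E_fibre_def)
  then show "gpoly_to_E B c m (P.br X (endo_gpoly B (block N 0 0 (- transpose_endo B N)) c) m) =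
      (N m (fst (gpoly_to_E B c m (X m))), 0)"
    unfolding 1 by (rule gpoly_to_E_E_to_gpoly[OF m])
qed

lemma form_block_action:
  assumes \<omega>: "two_form B \<omega>" and X: "X \<in> hom 1 (- 1)" and m: "m \<in> U"
  shows "P.br X (endo_gpoly B (block 0 0 \<omega> 0) c) m =
      E_to_gpoly B c m (0, \<omega> m (fst (gpoly_to_E B c m (X m))))"
    "gpoly_to_E B c m (P.br X (endo_gpoly B (block 0 0 \<omega> 0) c) m) =
      (0, \<omega> m (fst (gpoly_to_E B c m (X m))))"
proof -
  note x = gpoly_to_E_vector[OF X m]
  show 1: "P.br X (endo_gpoly B (block 0 0 \<omega> 0) c) m = E_to_gpoly B c m (0, \<omega> m (fst (gpoly_to_E B c m (X m))))"
    unfolding endo_gpoly_action[OF skew_form[OF vb \<omega>] X]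
    using m by (simp add: block_def)
  have "(0, \<omega> m (fst (gpoly_to_E B c m (X m)))) \<in> E_fibre B m"
    using two_formD(1)[OF \<omega> frame_facts(1)[OF m] x(2)] subspace_0[OF frame_facts(2)[OF m]]
    by (simp add: E_fibre_def)
  then show "gpoly_to_E B c m (P.br X (endo_gpoly B (block 0 0 \<omega> 0) c) m) =
      (0, \<omega> m (fst (gpoly_to_E B c m (X m))))"
    unfolding 1 by (rule gpoly_to_E_E_to_gpoly[OF m])
qed

lemma A_section_hom:
  assumes X: "X \<in> A_sections B" shows "X c \<in> hom 1 (- 1)"
proof (rule homI)
  have g: "X \<in> graded_fun B 1" using X by (simp add: A_sections_def)
  show "X c m = 0" if "m \<notin> U" for m using graded_funD(1)[OF g] that by blast
  show "sm (\<lambda>m. coeff (X c m) a)" for a using graded_funD(3)[OF g c_in] .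
  fix m a assume a: "coeff (X c m) a \<noteq> 0"
  then have d: "fset (snd a) \<subseteq> {..<2 * r}" "mono_degree a = 1" using graded_funD(2)[OF g a] by auto
  then obtain s where s: "a = ({#}, {|s|})" using mono_degree_one by metis
  have "odd s"
  proof
    assume "even s"
    then obtain \<alpha> where "s = tau_ix \<alpha>" by (rule evenE)
    then show False using X a s by (simp add: A_sections_def)
  qed
  then show "a \<in> monomials 1 (- 1)"
    using d by (simp add: s monomials_def mono_degree_def mono_weight_def)
qed

text \<open>\<open>block N 0 0 0\<close> is in general not skew-symmetric and then has no element of
  degree 2 attached. On vectors of A it agrees with the skew block, whose lower right entry acts on
  zero there.\<close>

lemma endo_act_chart:
  assumes N: "bundle_endo B N" and F: "F c \<in> hom 1 (- 1)"
  shows "endo_act B (block N 0 0 0) F c = P.br (F c) (endo_gpoly B (block N 0 0 (- transpose_endo B N)) c)"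
proof
  fix m
  show "endo_act B (block N 0 0 0) F c m = P.br (F c) (endo_gpoly B (block N 0 0 (- transpose_endo B N)) c) m"
  proof (cases "m \<in> U")
    case True
    then show ?thesis
      unfolding endo_block_action(1)[OF N F True]
      by (simp add: endo_act_def c_in block_def)
  next
    case False
    then show ?thesis using br_outside[of m "F c"] homD(1)[OF F False] by (simp add: endo_act_def)
  qed
qed

text \<open>Brackets of sections of A, and their images under N, keep degree 1 and weight -1. So
  every occurrence of N, the nested ones included, is the bracket with its quadratic
  function.\<close>

lemma nijenhuis_chart:
  assumes N: "bundle_endo B N" and nij: "nijenhuis_tensor B \<mu> N" and M: "\<mu> c \<in> hom 3 1"
    and X: "X \<in> A_sections B" and Y: "Y \<in> A_sections B"
  defines "E \<equiv> endo_gpoly B (block N 0 0 (- transpose_endo B N)) c"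
  shows "P.br (P.br (P.br (X c) E) (\<mu> c)) (P.br (Y c) E) - P.br (P.br (P.br (P.br (X c) E) (\<mu> c)) (Y c) +
        P.br (P.br (X c) (\<mu> c)) (P.br (Y c) E) - P.br (P.br (P.br (X c) (\<mu> c)) (Y c)) E) E = 0"
proof -
  let ?N = "endo_act B (block N 0 0 0)" and ?L = "lie_bracket B \<mu>"
  have E: "E \<in> hom 2 0" unfolding E_def by (rule endo_block_hom[OF N])
  have N1: "?N F c = P.br (F c) E" if "F c \<in> hom 1 (- 1)" for F
    unfolding E_def by (rule endo_act_chart[where F = F, OF N that])
  have NE: "P.br F E \<in> hom 1 (- 1)" if "F \<in> hom 1 (- 1)" for F using P.br_hom[OF that E] by simp
  have LE: "P.br (P.br F (\<mu> c)) G \<in> hom 1 (- 1)" if "F \<in> hom 1 (- 1)" "G \<in> hom 1 (- 1)" for F G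
    using P.br_hom[OF P.br_hom[OF that(1) M] that(2)] by simp
  have L: "?L F G c = P.br (P.br (F c) (\<mu> c)) (G c)" if F: "F c \<in> hom 1 (- 1)" for F G
  proof -
    have 1: "big_bracket B F \<mu> c = P.br (F c) (\<mu> c)"
      by (rule big_bracket_chart) (rule homD(1)[OF F])
    have "big_bracket B (big_bracket B F \<mu>) G c = P.br (big_bracket B F \<mu> c) (G c)"
      by (rule big_bracket_chart) (simp add: 1 homD(1)[OF P.br_hom[OF F M]])
    then show ?thesis by (simp add: lie_bracket_def 1)
  qed
  note Xc = A_section_hom[OF X] and Yc = A_section_hom[OF Y]
  have X': "?N X c = P.br (X c) E" and Y': "?N Y c = P.br (Y c) E" using N1 Xc Yc by blast+
  have X1: "?N X c \<in> hom 1 (- 1)" and Y1: "?N Y c \<in> hom 1 (- 1)" unfolding X' Y' by (intro NE Xc Yc)+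
  have XY: "?L X Y c \<in> hom 1 (- 1)" unfolding L[where F = X, OF Xc] by (rule LE[OF Xc Yc])
  have "(?L (?N X) Y + ?L X (?N Y) - ?N (?L X Y)) c = P.br (P.br (P.br (X c) E) (\<mu> c)) (Y c) +
      P.br (P.br (X c) (\<mu> c)) (P.br (Y c) E) - P.br (P.br (P.br (X c) (\<mu> c)) (Y c)) E"
    by (simp add: L[where F = X, OF Xc] L[where F = "?N X", OF X1] X' Y' N1[where F = "?L X Y", OF XY])
  moreover have "\<dots> \<in> hom 1 (- 1)"
    by (intro P.hom_diff P.hom_add LE NE Xc Yc)
  ultimately have "?N (?L (?N X) Y + ?L X (?N Y) - ?N (?L X Y)) c = P.br (P.br (P.br (P.br (X c) E) (\<mu> c)) (Y c) +
      P.br (P.br (X c) (\<mu> c)) (P.br (Y c) E) - P.br (P.br (P.br (X c) (\<mu> c)) (Y c)) E) E"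
    using N1[where F = "?L (?N X) Y + ?L X (?N Y) - ?N (?L X Y)"] by metis
  note second = this
  have first: "?L (?N X) (?N Y) c = P.br (P.br (P.br (X c) E) (\<mu> c)) (P.br (Y c) E)"
    unfolding L[where F = "?N X" and G = "?N Y", OF X1] X' Y' ..
  have "?L (?N X) (?N Y) - ?N (?L (?N X) Y + ?L X (?N Y) - ?N (?L X Y)) = 0"
    using nij X Y unfolding nijenhuis_tensor_def Let_def by blast
  then have "?L (?N X) (?N Y) = ?N (?L (?N X) Y + ?L X (?N Y) - ?N (?L X Y))"
    by (rule right_minus_eq[THEN iffD1])
  from fun_cong[OF this, of c] show ?thesis
    unfolding first second right_minus_eq .
qed

lemma lie_algebroid_hom:
  assumes "lie_algebroid B \<mu>" shows "\<mu> c \<in> hom 3 1"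
proof (rule homI)
  have g: "\<mu> \<in> graded_fun B 3" using assms by (simp add: lie_algebroid_def)
  show "\<mu> c m = 0" if "m \<notin> U" for m using graded_funD(1)[OF g] that by blast
  show "sm (\<lambda>m. coeff (\<mu> c m) a)" for a using graded_funD(3)[OF g c_in] .
  fix m a assume a: "coeff (\<mu> c m) a \<noteq> 0"
  note d = graded_funD(2)[OF g a]
  have "(\<exists>\<alpha> i. a = ({#i#}, {|tau_ix \<alpha>|})) \<or> (\<exists>\<alpha> \<beta> \<gamma>. a = ({#}, {|tau_ix \<alpha>, tau_ix \<beta>, theta_ix \<gamma>|}))"
    using assms a unfolding lie_algebroid_def by blast
  then have "mono_weight a = 1"
  proof (elim disjE exE)
    fix \<alpha> i assume "a = ({#i#}, {|tau_ix \<alpha>|})"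
    then show ?thesis by (simp add: mono_weight_def)
  next
    fix \<alpha> \<beta> \<gamma> assume a: "a = ({#}, {|tau_ix \<alpha>, tau_ix \<beta>, theta_ix \<gamma>|})"
    have ne: "tau_ix x \<noteq> theta_ix y" for x y by presburger
    \<comment> \<open>Degree 3 excludes coinciding indices of the two \<tau>; a repeated index would
      leave a set of two elements and weight 0.\<close>
    have "card {tau_ix \<alpha>, tau_ix \<beta>, theta_ix \<gamma>} = 3" using d a by (simp add: mono_degree_def fcard.rep_eq)
    then have "tau_ix \<alpha> \<noteq> tau_ix \<beta>" by (auto simp: card_insert_if split: if_splits)
    then show ?thesis using a ne by (simp add: mono_weight_def)
  qed
  then show "a \<in> monomials 3 1" using d by (simp add: monomials_def)
qed

text \<open>Closedness refers to \<open>tilde\<close>, which positive rank allows to be replaced by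
  the explicit quadratic function. What remains are the actions on vectors of A: N after N, \<omega>
  after N, and minus the transpose of N after \<omega>.\<close>

lemma Omega_N_chart:
  assumes rank: "r > 0" and \<mu>: "lie_algebroid B \<mu>" and N: "bundle_endo B N" and \<omega>: "two_form B \<omega>"
    and comp: "compatible_form B \<omega> N" and \<Omega>N: "Omega_N_structure B \<mu> \<omega> N"
  shows "P.br (\<mu> c) (P.br (P.br (endo_gpoly B (block N 0 \<omega> (- transpose_endo B N)) c) (\<mu> c))
    (endo_gpoly B (block N 0 \<omega> (- transpose_endo B N)) c)) = 0"
proof -
  let ?N2 = "\<lambda>m x. N m (N m x)" and ?\<omega>N = "\<lambda>m x. \<omega> m (N m x)"
  let ?n = "endo_gpoly B (block N 0 0 (- transpose_endo B N)) c"
  let ?n2 = "endo_gpoly B (block ?N2 0 0 (- transpose_endo B ?N2)) c"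
  let ?w = "endo_gpoly B (block 0 0 \<omega> 0) c" and ?wn = "endo_gpoly B (block 0 0 ?\<omega>N 0) c"
  note N2 = bundle_endo_square[OF vb N] and \<omega>N = two_form_compose[OF vb N \<omega> comp]
  note M = lie_algebroid_hom[OF \<mu>]
  have n: "?n \<in> hom 2 0" and n2: "?n2 \<in> hom 2 0" and w: "?w \<in> hom 2 2" and wn: "?wn \<in> hom 2 2"
    by (rule endo_block_hom form_block_hom N N2 \<omega> \<omega>N)+
  have bb: "big_bracket B \<mu> G c = P.br (\<mu> c) (G c)" for G
    by (rule big_bracket_chart) (rule homD(1)[OF M])
  have closed: "P.br (\<mu> c) (endo_gpoly B (block 0 0 \<eta> 0) c) = 0" if "closed_form B \<mu> \<eta>" "two_form B \<eta>" for \<eta>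
    using bb[of "endo_gpoly B (block 0 0 \<eta> 0)"] that
    by (simp add: closed_form_def tilde_eq[OF vb rank skew_form[OF vb that(2)]])
  have "P.br (\<mu> c) (P.br (P.br (?n + ?w) (\<mu> c)) (?n + ?w)) = 0"
  proof (rule weak_deforming_chart[OF M _ n n2 w _ wn])
    show "P.br (\<mu> c) (\<mu> c) = 0" using bb[of \<mu>] \<mu> by (simp add: lie_algebroid_def)
    show "P.br (\<mu> c) ?w = 0" by (rule closed) (use \<Omega>N in \<open>simp_all add: Omega_N_structure_def\<close>)
    show "P.br (\<mu> c) ?wn = 0" by (rule closed) (use \<Omega>N \<omega>N in \<open>simp_all add: Omega_N_structure_def\<close>)
    show "X c \<in> hom 1 (- 1)" if "X \<in> A_sections B" for X using that by (rule A_section_hom)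
    show "P.br (P.br (P.br (X c) ?n) (\<mu> c)) (P.br (Y c) ?n) - P.br (P.br (P.br (P.br (X c) ?n) (\<mu> c)) (Y c) +
        P.br (P.br (X c) (\<mu> c)) (P.br (Y c) ?n) - P.br (P.br (P.br (X c) (\<mu> c)) (Y c)) ?n) ?n = 0"
      if "X \<in> A_sections B" "Y \<in> A_sections B" for X Y
      using \<Omega>N by (intro nijenhuis_chart[where \<mu> = \<mu> and X = X and Y = Y, OF N _ M that]) (simp add: Omega_N_structure_def)
    fix X assume X: "X \<in> hom 1 (- 1)"
    have Xn: "P.br X ?n \<in> hom 1 (- 1)" using P.br_hom[OF X n] by simp
    have Xw: "P.br X ?w \<in> hom 1 1" using P.br_hom[OF X w] by simp
    show "P.br (P.br X ?n) ?n = P.br X ?n2"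
    proof (rule hom_eqI[OF P.br_hom[OF Xn n] P.br_hom[OF X n2]])
      fix m assume m: "m \<in> U"
      show "P.br (P.br X ?n) ?n m = P.br X ?n2 m"
        unfolding endo_block_action(1)[OF N Xn m] endo_block_action(2)[OF N X m] endo_block_action(1)[OF N2 X m]
        by simp
    qed
    show "P.br (P.br X ?n) ?w = P.br X ?wn"
    proof (rule hom_eqI[OF P.br_hom[OF Xn w] P.br_hom[OF X wn]])
      fix m assume m: "m \<in> U"
      show "P.br (P.br X ?n) ?w m = P.br X ?wn m"
        unfolding form_block_action(1)[OF \<omega> Xn m] endo_block_action(2)[OF N X m] form_block_action(1)[OF \<omega>N X m]
        by simp
    qed
    show "P.br (P.br X ?w) ?n = - P.br X ?wn"
    proof (rule hom_eqI[OF P.br_hom[OF Xw n] P.hom_uminus[OF P.br_hom[OF X wn]]])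
      fix m assume m: "m \<in> U"
      let ?x = "fst (gpoly_to_E B c m (X m))"
      have x: "?x \<in> fibre B m" by (rule gpoly_to_E_vector(2)[OF X m])
      \<comment> \<open>This is where compatibility identifies the transpose of N after \<omega>
        with \<omega> after N.\<close>
      have tr: "transpose_endo B N m (\<omega> m ?x) = \<omega> m (N m ?x)"
        using comp frame_facts(1)[OF m] x by (simp add: compatible_form_def)
      have "P.br (P.br X ?w) ?n m = E_to_gpoly B c m (0, - \<omega> m (N m ?x))"
        unfolding endo_gpoly_action[OF skew_block[OF vb N two_form_zero[OF vb]] Xw] form_block_action(2)[OF \<omega> X m]
        using m by (simp add: block_def N_zero[OF N m] tr)
      also have "\<dots> = - E_to_gpoly B c m (0, \<omega> m (N m ?x))"
        using dual_zero[OF coframe_dual[OF m] frame_facts(1)[OF m]]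
        by (simp add: E_to_gpoly_def sum_negf)
      finally show "P.br (P.br X ?w) ?n m = (- P.br X ?wn) m"
        by (simp add: form_block_action(1)[OF \<omega>N X m])
    qed
  qed
  then show ?thesis unfolding endo_gpoly_split[of N \<omega>] .
qed

end

theorem proposition4p17:
  fixes B :: "('m, 'v::real_vector) vbundle"
    and \<mu> :: "('m, 'v) family"
    and N :: "'m \<Rightarrow> 'v \<Rightarrow> 'v"
    and \<omega> :: "'m \<Rightarrow> 'v \<Rightarrow> 'v \<Rightarrow> real"
  assumes "vector_bundle B"
    and "lie_algebroid B \<mu>"
    and "bundle_endo B N"
    and "two_form B \<omega>"
    and "compatible_form B \<omega> N"
    and "Omega_N_structure B \<mu> \<omega> N"
  shows "weak_deforming_tensor B \<mu> (block N 0 \<omega> (- transpose_endo B N))"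
proof -
  let ?\<N> = "block N 0 \<omega> (- transpose_endo B N)"
  have skew: "skew_endo B ?\<N>" by (rule skew_block[OF assms(1,3,4)])
  have "big_bracket B \<mu> (big_bracket B (big_bracket B (tilde B ?\<N>) \<mu>) (tilde B ?\<N>)) c = 0" for c
  proof (cases "c \<in> atlas B")
    case True
    then interpret bundle_chart B c using assms(1) by unfold_locales
    have M: "\<mu> c \<in> hom 3 1" by (rule lie_algebroid_hom[OF assms(2)])
    have bb: "big_bracket B \<mu> G c = P.br (\<mu> c) (G c)" for G
      by (rule big_bracket_chart) (rule homD(1)[OF M])
    show ?thesis
    proof (cases "r = 0")
      case True
      \<comment> \<open>Without odd coordinates every monomial has weight 0, while \<mu> has weight
        1.\<close>
      have "coeff (\<mu> c m) a = 0" for m a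
      proof (rule ccontr)
        assume "coeff (\<mu> c m) a \<noteq> 0"
        then have a: "a \<in> monomials 3 1" by (rule homD(4)[OF M])
        then have "fset (snd a) = {}" using True by (simp add: monomials_def)
        then show False using a by (simp add: monomials_def mono_weight_def)
      qed
      then have "\<mu> c = 0" by (simp add: fun_eq_iff gpoly_eq_iff)
      then show ?thesis by (simp add: bb P.br_zero)
    next
      case False
      then have rank: "r > 0" by simp
      let ?e = "endo_gpoly B ?\<N>"
      have 1: "big_bracket B ?e \<mu> c = P.br (?e c) (\<mu> c)"
        by (rule big_bracket_chart) (simp add: endo_gpoly_def)
      have "big_bracket B (big_bracket B ?e \<mu>) ?e c = P.br (big_bracket B ?e \<mu> c) (?e c)"
        by (rule big_bracket_chart) (simp add: big_bracket_def)
      then have "big_bracket B \<mu> (big_bracket B (big_bracket B ?e \<mu>) ?e) c =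
          P.br (\<mu> c) (P.br (P.br (?e c) (\<mu> c)) (?e c))"
        by (simp add: bb 1)
      also have "\<dots> = 0" by (rule Omega_N_chart[OF rank assms(2-6)])
      finally show ?thesis unfolding tilde_eq[OF assms(1) rank skew] .
    qed
  next
    case False
    then show ?thesis by (simp add: big_bracket_def fun_eq_iff)
  qed
  then show ?thesis
    unfolding weak_deforming_tensor_def using skew by (simp add: fun_eq_iff)
qed

end
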